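(* Let $d,d_1\ge 1$, let $\Sigma=(\sigma^{ij})_{1\le i\le d,\,1\le j\le d_1}$ have Borel measurable entries on $\mathbb{R}^d$, let $b=(b^i)_{1\le i\le d}$ be a Borel vector field on $\mathbb{R}^d$, and set $A=\Sigma\Sigma^t$. Suppose that either $q(x,y)>0$ for all $x\neq y$, or $q(x,y)<0$ for all $x\neq y$. Then there exists at most one probability solution $\mu$ to the equation $L^*\mu=0$ satisfying $$\int_{\mathbb{R}^d}\bigl(\|\Sigma(x)\|^2+|b(x)|\,|x|\bigr)\,\mu(dx)<\infty.$$
   Context: For a symmetric nonnegative definite matrix $A(x)=(a^{ij}(x))$ and a vector field $b(x)=(b^i(x))$ with Borel measurable entries, $Lf(x)=\mathrm{trace}(A(x)D^2f(x))+\langle b(x),\nabla f(x)\rangle$. A probability solution to $L^*\mu=0$ is a Borel probability measure $\mu$ on $\mathbb{R}^d$ such that all $a^{ij}$ and $b^i$ are $\mu$-integrable on every compact set and $\int_{\mathbb{R}^d}Lf\,d\mu=0$ for every $f\in C_0^\infty(\mathbb{R}^d)$. Here $A(x)=\Sigma(x)\Sigma(x)^t$ with $\Sigma(x)$ a $d\times d_1$ matrix, and $$q(x,y)=\langle x-y,b(x)-b(y)\rangle+\mathrm{trace}\bigl((\Sigma(x)-\Sigma(y))(\Sigma(x)-\Sigma(y))^t\bigr).$$ $\|\cdot\|$ denotes a matrix norm, $|\cdot|$ the Euclidean norm. *)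

theory Defs
  imports "HOL-Probability.Probability"
begin

definition pdiff :: "'n::finite \<Rightarrow> (real^'n \<Rightarrow> real) \<Rightarrow> real^'n \<Rightarrow> real" where
  "pdiff i f x = frechet_derivative f (at x) (axis i 1)"

fun iter_pdiff :: "'n::finite list \<Rightarrow> (real^'n \<Rightarrow> real) \<Rightarrow> real^'n \<Rightarrow> real" where
  "iter_pdiff [] f = f"
| "iter_pdiff (i # is) f = pdiff i (iter_pdiff is f)"

definition C0_inf :: "(real^'n::finite \<Rightarrow> real) set" where
  "C0_inf = {f. (\<forall>is x. iter_pdiff is f differentiable (at x))
               \<and> compact (closure {x. f x \<noteq> 0})}"

definition diff_op ::
  "(real^'n \<Rightarrow> real^'m::finite^'n::finite) \<Rightarrow> (real^'n \<Rightarrow> real^'n)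
     \<Rightarrow> (real^'n \<Rightarrow> real) \<Rightarrow> real^'n \<Rightarrow> real" where
  "diff_op Sig b f x =
     (\<Sum>i\<in>UNIV. \<Sum>j\<in>UNIV. ((Sig x ** transpose (Sig x)) $ i $ j) * pdiff i (pdiff j f) x)
     + (\<Sum>i\<in>UNIV. (b x $ i) * pdiff i f x)"

definition prob_solution ::
  "(real^'n \<Rightarrow> real^'m::finite^'n::finite) \<Rightarrow> (real^'n \<Rightarrow> real^'n) \<Rightarrow> (real^'n) measure \<Rightarrow> bool" where
  "prob_solution Sig b \<mu> \<longleftrightarrow>
     sets \<mu> = sets borel \<and> prob_space \<mu> \<and>
     (\<forall>K i j. compact K \<longrightarrow> set_integrable \<mu> K (\<lambda>x. (Sig x ** transpose (Sig x)) $ i $ j)) \<and>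
     (\<forall>K i. compact K \<longrightarrow> set_integrable \<mu> K (\<lambda>x. b x $ i)) \<and>
     (\<forall>f \<in> C0_inf. (\<integral>x. diff_op Sig b f x \<partial>\<mu>) = 0)"

definition qfun ::
  "(real^'n \<Rightarrow> real^'m::finite^'n::finite) \<Rightarrow> (real^'n \<Rightarrow> real^'n) \<Rightarrow> real^'n \<Rightarrow> real^'n \<Rightarrow> real" where
  "qfun Sig b x y = inner (x - y) (b x - b y)
     + trace ((Sig x - Sig y) ** transpose (Sig x - Sig y))"

end

theory Submission
  imports Defs
begin

text \<open>
  Expansive case \<open>q > 0\<close>. Testing the equation against rescaled bumps that look like \<open>x\<^sub>i\<close> and \<open>|x|\<^sup>2\<close> gives
  \<open>\<integral> b d\<mu> = 0\<close> and \<open>\<integral> (\<langle>x, b\<rangle> + |\<Sigma>|\<^sup>2) d\<mu> = 0\<close>, hence \<open>\<integral>\<integral> q d\<mu> d\<mu> = - 2 |\<integral> \<Sigma> d\<mu>|\<^sup>2 \<le> 0\<close>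
  (with a truncation, since \<open>x\<close> need not be integrable). So \<open>\<mu>\<close> is a Dirac mass at a common zero of \<open>b\<close> and
  \<open>\<Sigma>\<close>, and \<open>q\<close> vanishes at a pair of such points.

  Dissipative case \<open>q < 0\<close>. Let \<open>X\<close>, \<open>Y\<close> have laws \<open>\<mu>\<close>, \<open>\<nu>\<close> and couple the points \<open>x = X - \<xi>\<close>, \<open>y = Y - \<eta>\<close>, blurred by
  independent noise of size \<open>\<epsilon>\<close>, almost optimally for the bounded payoff \<open>k (x - y) = exp (- |x - y|\<^sup>2 / 2)\<close>.
  Move \<open>x\<close> and \<open>y\<close> by one Euler--Maruyama step of length \<open>h\<close> with (truncated) coefficients frozen at \<open>X\<close>
  and \<open>Y\<close>, driven by the same randomness. Because \<open>L\<^sup>*\<mu> = 0\<close>, the marginal densities change only by \<open>o(h)\<close> in \<open>L\<^sup>1\<close>,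
  while the payoff grows by at least \<open>h \<integral> k |q|\<close> up to small errors. Almost optimality forces \<open>\<integral> k |q|\<close> to be small,
  so the law of \<open>(X, Y)\<close>, a coupling of \<open>\<mu>\<close> and \<open>\<nu>\<close>, concentrates near the diagonal.
\<close>

section \<open>Compactly supported smooth functions\<close>

definition smooth :: "(real^'n::finite \<Rightarrow> real) \<Rightarrow> bool" where
  "smooth f \<longleftrightarrow> (\<forall>is x. iter_pdiff is f differentiable (at x))"

lemma smooth_imp_differentiable: "smooth f \<Longrightarrow> f differentiable (at x)"
  unfolding smooth_def by (metis iter_pdiff.simps(1))

lemma has_derivative_pdiff:
  assumes "f differentiable (at x)"
  shows "(f has_derivative (\<lambda>u. \<Sum>i\<in>UNIV. u $ i * pdiff i f x)) (at x)"
proof -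
  let ?D = "frechet_derivative f (at x)"
  have D: "(f has_derivative ?D) (at x)"
    using assms frechet_derivative_works by blast
  then have linear_D: "linear ?D" by (rule has_derivative_linear)
  have "?D u = (\<Sum>i\<in>UNIV. u $ i * pdiff i f x)" for u
  proof -
    have "u = (\<Sum>i\<in>UNIV. u $ i *\<^sub>R axis i 1)"
      by (simp add: vec_eq_iff axis_def if_distrib[of "\<lambda>x. _ * x"] cong: if_cong)
    then have "?D u = ?D (\<Sum>i\<in>UNIV. u $ i *\<^sub>R axis i 1)" by simp
    then show ?thesis by (simp add: linear_sum[OF linear_D] linear_scale[OF linear_D] pdiff_def)
  qed
  then show ?thesis using D by presburger
qed

lemma pdiff_eqI: "(f has_derivative D) (at x) \<Longrightarrow> pdiff i f x = D (axis i 1)"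
  by (simp add: pdiff_def flip: frechet_derivative_at)

lemma iter_pdiff_append: "iter_pdiff (is @ js) f = iter_pdiff is (iter_pdiff js f)"
  by (induction "is") auto

lemma smooth_iter_pdiff: "smooth f \<Longrightarrow> smooth (iter_pdiff is f)"
  by (simp add: smooth_def flip: iter_pdiff_append)

lemma has_derivative_affine:
  fixes f :: "'a::real_normed_vector \<Rightarrow> real"
  assumes "f differentiable (at (a + s *\<^sub>R x))"
  shows "((\<lambda>x. c * f (a + s *\<^sub>R x)) has_derivative
    (\<lambda>u. c * frechet_derivative f (at (a + s *\<^sub>R x)) (s *\<^sub>R u))) (at x)"
proof -
  have inner: "((\<lambda>x. a + s *\<^sub>R x) has_derivative (\<lambda>u. s *\<^sub>R u)) (at x)"
    by (auto intro!: derivative_eq_intros)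
  show ?thesis
    by (rule has_derivative_mult_right)
      (rule has_derivative_compose[OF inner assms[unfolded frechet_derivative_works]])
qed

lemma iter_pdiff_affine:
  assumes "smooth f"
  shows "iter_pdiff is (\<lambda>x. c * f (a + s *\<^sub>R x)) =
    (\<lambda>x. c * s ^ length is * iter_pdiff is f (a + s *\<^sub>R x))"
proof (induction "is")
  case (Cons i "is")
  have diff: "iter_pdiff is f differentiable (at y)" for y
    using assms by (simp add: smooth_def)
  have "iter_pdiff (i # is) (\<lambda>x. c * f (a + s *\<^sub>R x)) x =
      c * s ^ length is * frechet_derivative (iter_pdiff is f) (at (a + s *\<^sub>R x)) (s *\<^sub>R axis i 1)" for x
    using pdiff_eqI[OF has_derivative_affine[OF diff]] by (simp add: Cons.IH)
  also have "\<dots>x = c * s ^ length (i # is) * iter_pdiff (i # is) f (a + s *\<^sub>R x)" for x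
    using linear_scale[OF linear_frechet_derivative[OF diff]] by (simp add: pdiff_def)
  finally show ?case by (simp add: fun_eq_iff)
qed simp

lemma smooth_affine:
  assumes "smooth f"
  shows "smooth (\<lambda>x. c * f (a + s *\<^sub>R x))"
  using assms differentiableI[OF has_derivative_affine]
  unfolding smooth_def iter_pdiff_affine[OF assms] by metis

lemma tendsto_smooth: "smooth f \<Longrightarrow> (g \<longlongrightarrow> a) F \<Longrightarrow> ((\<lambda>t. f (g t)) \<longlongrightarrow> f a) F"
  by (rule isCont_tendsto_compose) (rule differentiable_imp_continuous_within[OF smooth_imp_differentiable])

lemma C0_inf_iff: "f \<in> C0_inf \<longleftrightarrow> smooth f \<and> bounded {x. f x \<noteq> 0}"
  by (simp add: C0_inf_def smooth_def)

lemma C0_inf_smooth: "f \<in> C0_inf \<Longrightarrow> smooth f"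
  by (simp add: C0_inf_iff)

lemma C0_inf_affine:
  assumes f: "f \<in> C0_inf" and "s \<noteq> 0"
  shows "(\<lambda>x. c * f (a + s *\<^sub>R x)) \<in> C0_inf"
proof -
  let ?g = "\<lambda>x. c * f (a + s *\<^sub>R x)" and ?pull = "(*\<^sub>R) (1 / s) ` (+) (- a) ` {x. f x \<noteq> 0}"
  have "bounded ?pull"
    using f by (intro bounded_scaling bounded_translation) (simp add: C0_inf_iff)
  moreover have "{x. ?g x \<noteq> 0} \<subseteq> ?pull"
  proof
    fix x assume "x \<in> {x. ?g x \<noteq> 0}"
    moreover have "x = (1 / s) *\<^sub>R (- a + (a + s *\<^sub>R x))" using assms(2) by simp
    ultimately show "x \<in> ?pull" by (intro image_eqI) auto
  qed
  ultimately have "bounded {x. ?g x \<noteq> 0}" by (rule bounded_subset)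
  then show ?thesis using smooth_affine[OF C0_inf_smooth[OF f]] by (simp add: C0_inf_iff)
qed

lemma support_pdiff_subset: "{x. pdiff i f x \<noteq> 0} \<subseteq> closure {x. f x \<noteq> 0}"
proof (rule ccontr)
  let ?Z = "- closure {x. f x \<noteq> 0}"
  assume "\<not> ?thesis"
  then obtain x where x: "pdiff i f x \<noteq> 0" "x \<in> ?Z" by blast
  have "(f has_derivative (\<lambda>_. 0)) (at x)"
  proof (rule has_derivative_transform_within_open[OF has_derivative_const])
    show "0 = f y" if "y \<in> ?Z" for y using that closure_subset[of "{x. f x \<noteq> 0}"] by auto
    show "x \<in> ?Z" by (rule x(2))
  qed (simp add: open_Compl)
  from pdiff_eqI[OF this] show False using x(1) by simp
qed

lemma support_iter_pdiff_subset: "{x. iter_pdiff is f x \<noteq> 0} \<subseteq> closure {x. f x \<noteq> 0}"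
proof (induction "is")
  case Nil
  show ?case by (simp add: closure_subset)
next
  case (Cons i "is")
  then have "closure {x. iter_pdiff is f x \<noteq> 0} \<subseteq> closure {x. f x \<noteq> 0}"
    by (rule closure_minimal) simp
  then show ?case using support_pdiff_subset[of i "iter_pdiff is f"] by simp
qed

lemma C0_inf_iter_pdiff: "f \<in> C0_inf \<Longrightarrow> iter_pdiff is f \<in> C0_inf"
  using smooth_iter_pdiff bounded_subset[OF bounded_closure support_iter_pdiff_subset]
  by (auto simp: C0_inf_iff)

lemma C0_inf_continuous: "f \<in> C0_inf \<Longrightarrow> continuous_on S f"
  by (simp add: C0_inf_smooth smooth_imp_differentiable differentiable_imp_continuous_within
      continuous_at_imp_continuous_on)

lemma C0_inf_borel_measurable: "f \<in> C0_inf \<Longrightarrow> f \<in> borel_measurable borel"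
  by (intro borel_measurable_continuous_onI C0_inf_continuous)

lemma C0_inf_bounded:
  assumes "f \<in> C0_inf"
  shows "\<exists>C\<ge>0. \<forall>x. \<bar>f x\<bar> \<le> C"
proof -
  have "compact (f ` closure {x. f x \<noteq> 0})"
    using assms by (intro compact_continuous_image C0_inf_continuous) (simp_all add: C0_inf_iff)
  then obtain C where C: "C > 0" "\<forall>y\<in>f ` closure {x. f x \<noteq> 0}. norm y \<le> C"
    using compact_imp_bounded bounded_pos by metis
  have "\<bar>f x\<bar> \<le> C" for x
    using C closure_subset[of "{x. f x \<noteq> 0}"] by (cases "f x = 0") auto
  then show ?thesis using C(1) by (meson less_imp_le)
qed

lemma C0_inf_derivatives_bounded:
  assumes "f \<in> C0_inf"
  shows "\<exists>C\<ge>0. \<forall>is x. length is \<le> N \<longrightarrow> \<bar>iter_pdiff is f x\<bar> \<le> C"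
proof -
  obtain C where C: "\<And>is. C is \<ge> 0" "\<And>is x. \<bar>iter_pdiff is f x\<bar> \<le> C is"
    using C0_inf_bounded[OF C0_inf_iter_pdiff[OF assms]] by metis
  let ?L = "{is :: 'a list. length is \<le> N}"
  have finite_L: "finite ?L" using finite_lists_length_le[of "UNIV :: 'a set" N] by simp
  have "\<bar>iter_pdiff is f x\<bar> \<le> sum C ?L" if "length is \<le> N" for "is" x
    using C(2)[of "is" x] member_le_sum[of "is" ?L C] that C(1) finite_L by force
  then show ?thesis using sum_nonneg[of ?L C] C(1) by blast
qed

subsection \<open>A radial bump\<close>

definition flat_exp :: "real poly \<Rightarrow> real \<Rightarrow> real" where
  "flat_exp p t = (if t > 0 then poly p (1 / t) * exp (- (1 / t)) else 0)"

lemma poly_times_exp_minus_tendsto_0: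
  fixes p :: "real poly"
  shows "((\<lambda>s. poly p s * exp (- s)) \<longlongrightarrow> 0) at_top"
proof -
  have "((\<lambda>s::real. s ^ k * exp (- s)) \<longlongrightarrow> 0) at_top" for k :: nat
    using tendsto_power_div_exp_0[of k] unfolding exp_minus divide_inverse .
  then have "((\<lambda>s. \<Sum>i\<le>degree p. coeff p i * (s ^ i * exp (- s))) \<longlongrightarrow> (\<Sum>i\<le>degree p. coeff p i * 0)) at_top"
    by (intro tendsto_sum tendsto_mult tendsto_const)
  then show ?thesis by (simp add: poly_altdef sum_distrib_right mult.assoc)
qed

lemma flat_exp_has_derivative_at_0: "(flat_exp p has_real_derivative 0) (at 0)"
proof -
  have "((\<lambda>h. poly (pCons 0 p) (inverse h) * exp (- inverse h)) \<longlongrightarrow> 0) (at_right 0)"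
    by (rule filterlim_compose[OF poly_times_exp_minus_tendsto_0 filterlim_inverse_at_top_right])
  then have "((\<lambda>h. flat_exp p h / h) \<longlongrightarrow> 0) (at_right 0)"
    by (rule Lim_transform_eventually)
      (auto simp: eventually_at_right_field flat_exp_def field_simps intro!: exI[of _ 1])
  moreover have "((\<lambda>h. flat_exp p h / h) \<longlongrightarrow> 0) (at_left 0)"
    by (rule Lim_transform_eventually[OF tendsto_const])
      (auto simp: eventually_at_left_field flat_exp_def intro!: exI[of _ "-1"])
  ultimately show ?thesis
    by (simp add: DERIV_def flat_exp_def filterlim_split_at)
qed

lemma flat_exp_has_derivative:
  "(flat_exp p has_real_derivative flat_exp ([:0, 0, 1:] * (p - pderiv p)) t) (at t)"
proof -
  consider "t > 0" | "t < 0" | "t = 0" by linarith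
  then show ?thesis
  proof cases
    assume "t > 0"
    then have "((\<lambda>t. poly p (1 / t) * exp (- (1 / t))) has_real_derivative
        flat_exp ([:0, 0, 1:] * (p - pderiv p)) t) (at t)"
      by (auto intro!: derivative_eq_intros poly_DERIV[THEN DERIV_chain2]
          simp: flat_exp_def field_simps power2_eq_square)
    then show ?thesis
      by (rule has_field_derivative_transform_within_open[where S="{0<..}"])
        (use \<open>t > 0\<close> in \<open>auto simp: flat_exp_def\<close>)
  next
    assume "t < 0"
    then have "((\<lambda>t. 0) has_real_derivative flat_exp ([:0, 0, 1:] * (p - pderiv p)) t) (at t)"
      by (auto simp: flat_exp_def)
    then show ?thesis
      by (rule has_field_derivative_transform_within_open[where S="{..<0}"])
        (use \<open>t < 0\<close> in \<open>auto simp: flat_exp_def\<close>)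
  next
    assume "t = 0"
    then show ?thesis using flat_exp_has_derivative_at_0[of p] by (simp add: flat_exp_def)
  qed
qed

definition radial_flat_exp :: "real poly \<Rightarrow> real^'n::finite \<Rightarrow> real" where
  "radial_flat_exp p x = flat_exp p (1 - (norm x)\<^sup>2)"

lemma radial_flat_exp_has_derivative:
  "(radial_flat_exp p has_derivative
    (\<lambda>u. radial_flat_exp (smult (-2) ([:0, 0, 1:] * (p - pderiv p))) x * (x \<bullet> u))) (at x)"
proof -
  have smult: "flat_exp (smult c q) t = c * flat_exp q t" for c q t
    by (simp add: flat_exp_def)
  have "((\<lambda>x. 1 - x \<bullet> x) has_derivative (\<lambda>u. - 2 * (x \<bullet> u))) (at x)"
    by (auto intro!: derivative_eq_intros simp: inner_commute)
  from has_derivative_compose[OF this flat_exp_has_derivative[unfolded has_field_derivative_def]]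
  show ?thesis
    unfolding radial_flat_exp_def power2_norm_eq_inner smult
    by (rule has_derivative_eq_rhs) (simp add: mult_ac)
qed

lemma pdiff_radial_flat_exp:
  "pdiff i (radial_flat_exp p) x =
    x $ i * radial_flat_exp (smult (-2) ([:0, 0, 1:] * (p - pderiv p))) x"
  by (simp add: pdiff_eqI[OF radial_flat_exp_has_derivative] inner_axis)

text \<open>Closed under partial derivatives, hence a set of smooth functions.\<close>

inductive_set radial_bumps :: "(real^'n::finite \<Rightarrow> real) set" where
  radial: "radial_flat_exp p \<in> radial_bumps"
| times_component: "f \<in> radial_bumps \<Longrightarrow> (\<lambda>x. x $ i * f x) \<in> radial_bumps"
| plus: "f \<in> radial_bumps \<Longrightarrow> g \<in> radial_bumps \<Longrightarrow> (\<lambda>x. f x + g x) \<in> radial_bumps"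

lemma pdiff_times_component:
  assumes "f differentiable (at x)"
  shows "pdiff j (\<lambda>x. x $ i * f x) x = (if i = j then f x else 0) + x $ i * pdiff j f x"
proof -
  have "((\<lambda>x. x $ i * f x) has_derivative
      (\<lambda>u. x $ i * frechet_derivative f (at x) u + u $ i * f x)) (at x)"
    using assms by (intro has_derivative_mult bounded_linear_imp_has_derivative bounded_linear_vec_nth)
      (simp add: frechet_derivative_works)
  from pdiff_eqI[OF this] show ?thesis by (simp add: pdiff_def axis_def)
qed

lemma pdiff_plus:
  assumes "f differentiable (at x)" "g differentiable (at x)"
  shows "pdiff j (\<lambda>x. f x + g x) x = pdiff j f x + pdiff j g x"
proof -
  have "((\<lambda>x. f x + g x) has_derivative
      (\<lambda>u. frechet_derivative f (at x) u + frechet_derivative g (at x) u)) (at x)"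
    using assms by (intro has_derivative_add) (simp_all add: frechet_derivative_works)
  from pdiff_eqI[OF this] show ?thesis by (simp add: pdiff_def)
qed

lemma radial_bumps_differentiable: "f \<in> radial_bumps \<Longrightarrow> f differentiable (at x)"
proof (induction rule: radial_bumps.induct)
  case (times_component f i)
  show ?case
    by (rule differentiable_mult[OF bounded_linear_imp_differentiable[OF bounded_linear_vec_nth] times_component.IH])
qed (auto intro: differentiableI[OF radial_flat_exp_has_derivative])

lemma radial_bumps_pdiff: "f \<in> radial_bumps \<Longrightarrow> pdiff j f \<in> radial_bumps"
proof (induction rule: radial_bumps.induct)
  case (radial p)
  show ?case unfolding pdiff_radial_flat_exp[abs_def] by (intro radial_bumps.intros)
next
  case (times_component f i)
  have "pdiff j (\<lambda>x. x $ i * f x) =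
      (if i = j then (\<lambda>x. f x + x $ i * pdiff j f x) else (\<lambda>x. x $ i * pdiff j f x))"
    using pdiff_times_component[OF radial_bumps_differentiable[OF times_component(1)]] by auto
  then show ?case using times_component by (auto intro!: radial_bumps.intros)
next
  case (plus f g)
  have "pdiff j (\<lambda>x. f x + g x) = (\<lambda>x. pdiff j f x + pdiff j g x)"
    using pdiff_plus[OF plus(1,2)[THEN radial_bumps_differentiable]] by auto
  then show ?case using plus by (auto intro!: radial_bumps.intros)
qed

lemma radial_bumps_eq_0: "f \<in> radial_bumps \<Longrightarrow> norm x \<ge> 1 \<Longrightarrow> f x = 0"
  by (induction rule: radial_bumps.induct)
    (simp_all add: radial_flat_exp_def flat_exp_def abs_square_less_1)

lemma radial_bumps_subset_C0_inf: "radial_bumps \<subseteq> C0_inf"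
proof
  fix f :: "real^'n \<Rightarrow> real"
  assume f: "f \<in> radial_bumps"
  have "iter_pdiff is f \<in> radial_bumps" for "is"
    using f by (induction "is") (auto intro: radial_bumps_pdiff)
  moreover have "{x. f x \<noteq> 0} \<subseteq> ball 0 1"
    using radial_bumps_eq_0[OF f] by (force simp: not_le)
  ultimately show "f \<in> C0_inf"
    using bounded_subset[OF bounded_ball]
    by (auto simp: C0_inf_iff smooth_def intro: radial_bumps_differentiable)
qed

definition bump :: "real^'n::finite \<Rightarrow> real" where
  "bump = radial_flat_exp 1"

definition bump_slope :: "real^'n::finite \<Rightarrow> real" where
  "bump_slope = radial_flat_exp [:0, 0, -2:]"

lemma bump_C0_inf: "bump \<in> C0_inf" and bump_slope_C0_inf: "bump_slope \<in> C0_inf"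
  using radial_bumps_subset_C0_inf radial_bumps.radial by (auto simp: bump_def bump_slope_def)

lemma pdiff_bump: "pdiff i bump x = x $ i * bump_slope x"
  by (simp add: bump_def bump_slope_def pdiff_radial_flat_exp one_pCons pderiv_pCons)

lemma pdiff_pdiff_bump_0:
  fixes i j :: "'n::finite"
  shows "pdiff j (pdiff i bump) 0 = (if i = j then bump_slope (0 :: real^'n) else 0)"
  using pdiff_times_component[of bump_slope 0 j i]
  by (simp add: pdiff_bump[abs_def] smooth_imp_differentiable C0_inf_smooth bump_slope_C0_inf)

lemma bump_slope_neq_0: "norm x < 1 \<Longrightarrow> bump_slope x \<noteq> 0"
  using abs_square_less_1[of "norm x"]
  by (simp add: bump_slope_def radial_flat_exp_def flat_exp_def)

lemma bump_nonneg: "bump x \<ge> 0"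
  by (simp add: bump_def radial_flat_exp_def flat_exp_def)

lemma bump_eq_0_iff: "bump x = 0 \<longleftrightarrow> norm x \<ge> 1"
  using abs_square_less_1[of "norm x"]
  by (auto simp: bump_def radial_flat_exp_def flat_exp_def)

lemma nn_integral_C0_inf_finite:
  fixes f :: "real^'n::finite \<Rightarrow> real"
  assumes "f \<in> C0_inf"
  shows "(\<integral>\<^sup>+x. ennreal (f x) \<partial>lborel) < \<top>"
proof -
  obtain C where C: "\<And>x. \<bar>f x\<bar> \<le> C" using C0_inf_bounded[OF assms] by blast
  obtain r where r: "{x. f x \<noteq> 0} \<subseteq> cball 0 r"
    using assms by (auto simp: C0_inf_iff bounded_iff subset_iff)
  have "ennreal (f x) \<le> ennreal C * indicator (cball 0 r) x" for x
    using C[of x] r by (cases "f x = 0") (auto simp: indicator_def intro!: ennreal_leI)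
  then have "(\<integral>\<^sup>+x. ennreal (f x) \<partial>lborel) \<le> (\<integral>\<^sup>+x. ennreal C * indicator (cball (0 :: real^'n) r) x \<partial>lborel)"
    by (rule nn_integral_mono)
  also have "\<dots> < \<top>"
    using emeasure_lborel_cball_finite[of "0 :: real^'n" r]
    by (simp add: nn_integral_cmult_indicator ennreal_mult_less_top)
  finally show ?thesis .
qed

lemma exists_mollifier:
  assumes "\<epsilon> > 0"
  shows "\<exists>f \<in> C0_inf. (\<forall>x :: real^'n::finite. f x \<ge> 0 \<and> (norm x \<ge> \<epsilon> \<longrightarrow> f x = 0)) \<and>
    (\<integral>\<^sup>+x. ennreal (f x) \<partial>lborel) = 1"
proof -
  define g :: "real^'n \<Rightarrow> real" where "g x = bump ((1 / \<epsilon>) *\<^sub>R x)" for x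
  have g: "(\<lambda>x. c * g x) \<in> C0_inf" for c
    using C0_inf_affine[OF bump_C0_inf, of "1 / \<epsilon>" c 0] assms by (simp add: g_def)
  have g_nonneg: "g x \<ge> 0" for x by (simp add: g_def bump_nonneg)
  have g_eq_0_iff: "g x = 0 \<longleftrightarrow> norm x \<ge> \<epsilon>" for x using assms by (simp add: g_def bump_eq_0_iff)
  have [measurable]: "g \<in> borel_measurable borel" using C0_inf_borel_measurable[OF g[of 1]] by simp
  define J where "J = enn2real (\<integral>\<^sup>+x. ennreal (g x) \<partial>lborel)"
  have J: "(\<integral>\<^sup>+x. ennreal (g x) \<partial>lborel) = ennreal J"
    using nn_integral_C0_inf_finite[OF g[of 1]] by (simp add: J_def)
  have "J \<noteq> 0"
  proof
    assume "J = 0"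
    then have "AE x in lborel. ennreal (g x) = 0"
      using J by (simp add: nn_integral_0_iff_AE)
    then have "AE x in lborel. x \<notin> ball (0 :: real^'n) \<epsilon>"
    proof eventually_elim
      case (elim x)
      then have "g x = 0" using g_nonneg[of x] by (simp add: ennreal_eq_0_iff)
      then show ?case using g_eq_0_iff by (simp add: not_less)
    qed
    then have "measure lborel (ball (0 :: real^'n) \<epsilon>) = 0"
      by (simp add: AE_iff_null_sets measure_eq_0_null_sets)
    then show False using content_ball_pos[OF assms, of "0 :: real^'n"] by simp
  qed
  then have "J > 0" using enn2real_nonneg by (simp add: J_def order_less_le)
  then have "(\<integral>\<^sup>+x. ennreal (1 / J * g x) \<partial>lborel) = ennreal (1 / J) * ennreal J"
    unfolding J[symmetric] using g_nonneg \<open>J > 0\<close>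
    by (subst nn_integral_cmult[symmetric]) (simp_all flip: ennreal_mult)
  also have "\<dots> = 1" using \<open>J > 0\<close> by (simp flip: ennreal_mult)
  finally show ?thesis using g[of "1 / J"] g_nonneg g_eq_0_iff \<open>J > 0\<close> by (intro bexI[of _ "\<lambda>x. 1 / J * g x"]) auto
qed

section \<open>Second-order expansion along an Euler--Maruyama step\<close>

definition ddir :: "real^'n \<Rightarrow> (real^'n \<Rightarrow> real) \<Rightarrow> real^'n::finite \<Rightarrow> real" where
  "ddir u f x = (\<Sum>i\<in>UNIV. u $ i * pdiff i f x)"

lemma ddir_add: "ddir (u + w) f x = ddir u f x + ddir w f x"
  by (simp add: ddir_def sum.distrib distrib_right)

lemma ddir_diff: "ddir (u - w) f x = ddir u f x - ddir w f x"
  by (simp add: ddir_def sum_subtractf left_diff_distrib)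

lemma ddir_scaleR: "ddir (c *\<^sub>R u) f x = c * ddir u f x"
  by (simp add: ddir_def sum_distrib_left mult.assoc)

lemma line_has_derivative:
  assumes "smooth f"
  shows "((\<lambda>t. f (x + t *\<^sub>R u)) has_real_derivative ddir u f (x + t *\<^sub>R u)) (at t)"
proof -
  have "((\<lambda>t. x + t *\<^sub>R u) has_derivative (\<lambda>s. s *\<^sub>R u)) (at t)"
    by (auto intro!: derivative_eq_intros)
  from has_derivative_compose[OF this has_derivative_pdiff[OF smooth_imp_differentiable[OF assms]]]
  show ?thesis
    unfolding has_field_derivative_def ddir_def
    by (rule has_derivative_eq_rhs) (simp add: fun_eq_iff sum_distrib_left mult_ac)
qed

lemma iter_pdiff_ddir:
  assumes "smooth f"
  shows "iter_pdiff is (ddir u f) = (\<lambda>x. \<Sum>j\<in>UNIV. u $ j * iter_pdiff (is @ [j]) f x)"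
proof (induction "is")
  case (Cons i "is")
  have "pdiff i (\<lambda>x. \<Sum>j\<in>UNIV. u $ j * iter_pdiff (is @ [j]) f x) x =
      (\<Sum>j\<in>UNIV. u $ j * pdiff i (iter_pdiff (is @ [j]) f) x)" for x
  proof -
    have "((\<lambda>x. \<Sum>j\<in>UNIV. u $ j * iter_pdiff (is @ [j]) f x) has_derivative
        (\<lambda>w. \<Sum>j\<in>UNIV. u $ j * frechet_derivative (iter_pdiff (is @ [j]) f) (at x) w)) (at x)"
      using assms by (intro has_derivative_sum has_derivative_mult_right)
        (simp add: smooth_def flip: frechet_derivative_works)
    from pdiff_eqI[OF this] show ?thesis by (simp add: pdiff_def)
  qed
  then show ?case by (simp add: Cons.IH)
qed (simp add: ddir_def)

lemma smooth_ddir: "smooth f \<Longrightarrow> smooth (ddir u f)"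
  by (simp add: iter_pdiff_ddir smooth_def)

lemma ddir_ddir:
  assumes "smooth f"
  shows "ddir u (ddir w f) x = (\<Sum>i\<in>UNIV. \<Sum>j\<in>UNIV. u $ i * (w $ j * pdiff i (pdiff j f) x))"
  using iter_pdiff_ddir[OF assms, of "[_]" w]
  by (simp add: ddir_def[of u] sum_distrib_left fun_eq_iff)

lemma ddir_ddir_parallelogram:
  assumes "smooth f"
  shows "ddir (a + c) (ddir (a + c) f) x + ddir (a - c) (ddir (a - c) f) x =
    2 * ddir a (ddir a f) x + 2 * ddir c (ddir c f) x"
  by (simp add: ddir_ddir[OF assms] sum_distrib_left sum.distrib[symmetric] algebra_simps)

lemma ddir_ddir_scaleR: "smooth f \<Longrightarrow> ddir (c *\<^sub>R u) (ddir (c *\<^sub>R u) f) x = c\<^sup>2 * ddir u (ddir u f) x"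
  by (simp add: ddir_ddir sum_distrib_left power2_eq_square mult_ac)

lemma sum_abs_le_card_norm:
  fixes u :: "real^'n::finite"
  shows "(\<Sum>i\<in>UNIV. \<bar>u $ i\<bar>) \<le> CARD('n) * norm u"
  using sum_bounded_above[of UNIV "\<lambda>i. \<bar>u $ i\<bar>" "norm u"] component_le_norm_cart by auto

lemma abs_weighted_sum_le:
  fixes u :: "real^'n::finite"
  assumes "\<And>i. \<bar>g i\<bar> \<le> C"
  shows "\<bar>\<Sum>i\<in>UNIV. u $ i * g i\<bar> \<le> C * (CARD('n) * norm u)"
proof -
  have "C \<ge> 0" using assms[of undefined] by linarith
  have "\<bar>\<Sum>i\<in>UNIV. u $ i * g i\<bar> \<le> (\<Sum>i\<in>UNIV. \<bar>u $ i\<bar> * C)"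
    by (intro sum_abs[THEN order_trans] sum_mono) (auto simp: abs_mult intro!: mult_left_mono assms)
  also have "\<dots> \<le> C * (CARD('n) * norm u)"
    using mult_left_mono[OF sum_abs_le_card_norm[of u] \<open>C \<ge> 0\<close>]
    by (simp add: sum_distrib_left[symmetric] mult.commute[of _ C])
  finally show ?thesis .
qed

lemma abs_ddir_le:
  fixes u :: "real^'n::finite"
  shows "(\<And>i. \<bar>pdiff i f x\<bar> \<le> C) \<Longrightarrow> \<bar>ddir u f x\<bar> \<le> C * (CARD('n) * norm u)"
  unfolding ddir_def by (rule abs_weighted_sum_le)

lemma abs_ddir_ddir_le:
  fixes u :: "real^'n::finite"
  assumes "smooth f" "\<And>i j. \<bar>pdiff i (pdiff j f) x\<bar> \<le> C"
  shows "\<bar>ddir u (ddir u f) x\<bar> \<le> C * (CARD('n) * norm u)\<^sup>2"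
proof -
  have "\<bar>pdiff i (ddir u f) x\<bar> \<le> C * (CARD('n) * norm u)" for i
    using iter_pdiff_ddir[OF assms(1), of "[i]" u] abs_weighted_sum_le[of "\<lambda>j. pdiff i (pdiff j f) x"] assms(2)
    by simp
  from abs_ddir_le[OF this] show ?thesis by (simp add: power2_eq_square mult.assoc)
qed

lemma abs_iterated_ddir_le:
  fixes u :: "real^'n::finite"
  assumes "smooth f" and "\<And>is x. length is = k \<Longrightarrow> \<bar>iter_pdiff is f x\<bar> \<le> C"
  shows "\<bar>(ddir u ^^ k) f x\<bar> \<le> C * (CARD('n) * norm u) ^ k"
  using assms
proof (induction k arbitrary: f C)
  case 0
  then show ?case by (metis funpow_0 iter_pdiff.simps(1) list.size(3) mult.right_neutral power_0)
next
  case (Suc k)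
  have "\<bar>iter_pdiff is (ddir u f) x\<bar> \<le> C * (CARD('n) * norm u)" if "length is = k" for "is" x
    unfolding iter_pdiff_ddir[OF Suc.prems(1)] by (intro abs_weighted_sum_le Suc.prems(2)) (simp add: that)
  from Suc.IH[OF smooth_ddir[OF Suc.prems(1)] this]
  show ?case by (simp add: funpow_swap1 mult.assoc)
qed

lemma second_order_Taylor:
  fixes f :: "real^'n::finite \<Rightarrow> real"
  assumes f: "smooth f" and bound: "\<And>is x. length is = 3 \<Longrightarrow> \<bar>iter_pdiff is f x\<bar> \<le> C"
  shows "\<bar>f (x + u) - (f x + ddir u f x + ddir u (ddir u f) x / 2)\<bar> \<le> C * (CARD('n) * norm u) ^ 3"
proof -
  let ?p = "\<lambda>m t. (ddir u ^^ m) f (x + t *\<^sub>R u)"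
  have "smooth ((ddir u ^^ m) f)" for m
    by (induction m) (auto intro: f smooth_ddir)
  from line_has_derivative[OF this]
  have "\<forall>m t. m < 3 \<and> 0 \<le> t \<and> t \<le> 1 \<longrightarrow> DERIV (?p m) t :> ?p (Suc m) t"
    by simp
  from Maclaurin[OF _ _ _ this, of "?p 0"]
  obtain t where t: "f (x + u) = f x + ddir u f x + ddir u (ddir u f) x / 2 + (ddir u ^^ 3) f (x + t *\<^sub>R u) / 6"
    by (auto simp: eval_nat_numeral)
  moreover have "\<bar>(ddir u ^^ 3) f (x + t *\<^sub>R u)\<bar> \<le> C * (CARD('n) * norm u) ^ 3"
    using f bound by (rule abs_iterated_ddir_le)
  ultimately show ?thesis by linarith
qed

lemma trace_mult_transpose:
  fixes S :: "real^'m::finite^'n::finite"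
  shows "trace (S ** transpose S) = (norm S)\<^sup>2"
  by (simp add: power2_norm_eq_inner trace_def matrix_matrix_mult_def transpose_def inner_vec_def)

lemma sum_norm_column_power2:
  fixes S :: "real^'m::finite^'n::finite"
  shows "(\<Sum>j\<in>UNIV. (norm (column j S))\<^sup>2) = (norm S)\<^sup>2"
proof -
  have "(\<Sum>j\<in>UNIV. (norm (column j S))\<^sup>2) = (\<Sum>j\<in>UNIV. \<Sum>i\<in>UNIV. S $ i $ j * S $ i $ j)"
    by (simp add: power2_norm_eq_inner inner_vec_def column_def)
  also have "\<dots> = (\<Sum>i\<in>UNIV. \<Sum>j\<in>UNIV. S $ i $ j * S $ i $ j)" by (rule sum.swap)
  also have "\<dots> = (norm S)\<^sup>2" by (simp add: power2_norm_eq_inner inner_vec_def)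
  finally show ?thesis .
qed

lemma norm_column_le_norm:
  fixes S :: "real^'m::finite^'n::finite"
  shows "norm (column j S) \<le> norm S"
proof (rule power2_le_imp_le)
  show "(norm (column j S))\<^sup>2 \<le> (norm S)\<^sup>2"
    unfolding sum_norm_column_power2[symmetric] by (rule member_le_sum) auto
qed simp

definition gen :: "real^'m::finite^'n::finite \<Rightarrow> real^'n \<Rightarrow> (real^'n \<Rightarrow> real) \<Rightarrow> real^'n \<Rightarrow> real" where
  "gen S v f x = (\<Sum>l\<in>UNIV. ddir (column l S) (ddir (column l S) f) x) + ddir v f x"

lemma diff_op_eq_gen:
  assumes "smooth f"
  shows "diff_op Sig b f x = gen (Sig x) (b x) f x"
proof -
  let ?S = "Sig x"
  have "(\<Sum>i\<in>UNIV. \<Sum>j\<in>UNIV. ((?S ** transpose ?S) $ i $ j) * pdiff i (pdiff j f) x) =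
      (\<Sum>i\<in>UNIV. \<Sum>j\<in>UNIV. \<Sum>l\<in>UNIV. column l ?S $ i * (column l ?S $ j * pdiff i (pdiff j f) x))"
    by (simp add: matrix_matrix_mult_def transpose_def column_def sum_distrib_right mult.assoc)
  also have "\<dots> = (\<Sum>i\<in>UNIV. \<Sum>l\<in>UNIV. \<Sum>j\<in>UNIV. column l ?S $ i * (column l ?S $ j * pdiff i (pdiff j f) x))"
    by (intro sum.cong refl sum.swap)
  also have "\<dots> = (\<Sum>l\<in>UNIV. ddir (column l ?S) (ddir (column l ?S) f) x)"
    by (subst sum.swap) (simp add: ddir_ddir[OF assms])
  finally show ?thesis by (simp add: diff_op_def gen_def ddir_def)
qed

lemma column_zero: "column l 0 = 0"
  by (simp add: column_def vec_eq_iff)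

lemma gen_0_left: "gen 0 v f x = ddir v f x"
  by (simp add: gen_def ddir_def column_zero)

lemma gen_zero: "gen 0 0 f x = 0"
  by (simp add: gen_0_left ddir_def)

lemma gen_eq_add: "gen S v f x = gen S 0 f x + ddir v f x"
  by (simp add: gen_def ddir_def)

lemma gen_affine:
  assumes "smooth f"
  shows "gen S v (\<lambda>x. c * f (a + s *\<^sub>R x)) x =
    c * s\<^sup>2 * gen S 0 f (a + s *\<^sub>R x) + c * s * ddir v f (a + s *\<^sub>R x)"
proof -
  have "pdiff i (pdiff j (\<lambda>x. c * f (a + s *\<^sub>R x))) = (\<lambda>x. c * s\<^sup>2 * pdiff i (pdiff j f) (a + s *\<^sub>R x))" for i j
    using iter_pdiff_affine[OF assms, of "[i, j]"] by (simp add: power2_eq_square)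
  moreover have "pdiff i (\<lambda>x. c * f (a + s *\<^sub>R x)) = (\<lambda>x. c * s * pdiff i f (a + s *\<^sub>R x))" for i
    using iter_pdiff_affine[OF assms, of "[i]"] by simp
  ultimately show ?thesis
    by (simp add: gen_def ddir_ddir[OF smooth_affine[OF assms]] ddir_ddir[OF assms] column_zero)
      (simp add: ddir_def sum_distrib_left mult_ac)
qed

lemma tendsto_gen: "smooth f \<Longrightarrow> (g \<longlongrightarrow> a) F \<Longrightarrow> ((\<lambda>t. gen S v f (g t)) \<longlongrightarrow> gen S v f a) F"
  unfolding gen_def by (intro tendsto_intros tendsto_smooth smooth_ddir)

lemma ddir_bump: "ddir v bump y = bump_slope y * inner v y"
  by (simp add: ddir_def pdiff_bump inner_vec_def sum_distrib_left mult_ac)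

lemma gen_bump_0:
  fixes S :: "real^'m::finite^'n::finite"
  shows "gen S 0 bump 0 = bump_slope (0 :: real^'n) * (norm S)\<^sup>2"
proof -
  have "ddir u (ddir u bump) 0 = bump_slope (0 :: real^'n) * (norm u)\<^sup>2" for u :: "real^'n"
    by (simp add: ddir_ddir C0_inf_smooth bump_C0_inf pdiff_pdiff_bump_0 if_distrib power2_norm_eq_inner
        inner_vec_def sum_distrib_left mult_ac cong: if_cong)
  then show ?thesis
    by (simp add: gen_def ddir_bump sum_distrib_left[symmetric] sum_norm_column_power2)
qed

lemma abs_gen_le:
  fixes S :: "real^'m::finite^'n::finite"
  assumes f: "smooth f" and bound1: "\<And>i. \<bar>pdiff i f x\<bar> \<le> C1" and bound2: "\<And>i j. \<bar>pdiff i (pdiff j f) x\<bar> \<le> C2"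
  shows "\<bar>gen S v f x\<bar> \<le> (real CARD('n))\<^sup>2 * (C1 * norm v + C2 * (norm S)\<^sup>2)"
proof -
  have "C1 \<ge> 0" using bound1[of undefined] by linarith
  have "\<bar>\<Sum>l\<in>UNIV. ddir (column l S) (ddir (column l S) f) x\<bar> \<le> (\<Sum>l\<in>UNIV. C2 * (CARD('n) * norm (column l S))\<^sup>2)"
    by (intro sum_abs[THEN order_trans] sum_mono abs_ddir_ddir_le f bound2)
  also have "\<dots> = C2 * (real CARD('n))\<^sup>2 * (norm S)\<^sup>2"
    by (simp add: sum_norm_column_power2[symmetric] sum_distrib_left power_mult_distrib mult_ac)
  finally have "\<bar>\<Sum>l\<in>UNIV. ddir (column l S) (ddir (column l S) f) x\<bar> \<le> C2 * (real CARD('n))\<^sup>2 * (norm S)\<^sup>2" .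
  moreover have "\<bar>ddir v f x\<bar> \<le> C1 * ((real CARD('n))\<^sup>2 * norm v)"
  proof (rule order_trans[OF abs_ddir_le[OF bound1]])
    show "C1 * (CARD('n) * norm v) \<le> C1 * ((real CARD('n))\<^sup>2 * norm v)"
      by (intro mult_left_mono mult_right_mono \<open>C1 \<ge> 0\<close>) (auto simp: power2_eq_square)
  qed
  ultimately show ?thesis unfolding gen_def by (simp add: algebra_simps)
qed

text \<open>One Euler--Maruyama step of length \<open>h\<close>, the Gaussian increment being replaced by a uniformly chosen
  signed column; the scaling makes its covariance \<open>2 h S S\<^sup>t\<close>.\<close>

definition em_step :: "real \<Rightarrow> real^'n \<Rightarrow> real^'m^'n \<Rightarrow> 'm::finite \<times> bool \<Rightarrow> real^'n::finite" where
  "em_step h v S l = h *\<^sub>R v + ((if snd l then 1 else -1) * sqrt (2 * h * CARD('m))) *\<^sub>R column (fst l) S"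

definition em_average :: "('m::finite \<times> bool \<Rightarrow> real) \<Rightarrow> real" where
  "em_average g = (\<Sum>l\<in>UNIV. g l) / (2 * real CARD('m))"

lemma em_average_const: "em_average (\<lambda>_ :: 'm::finite \<times> bool. c) = c"
  by (simp add: em_average_def)

lemma em_average_mono: "(\<And>l. f l \<le> g l) \<Longrightarrow> em_average f \<le> em_average g"
  by (simp add: em_average_def sum_mono divide_right_mono)

lemma abs_em_average_diff_le:
  fixes f g :: "'m::finite \<times> bool \<Rightarrow> real"
  assumes "\<And>l. \<bar>f l - g l\<bar> \<le> E"
  shows "\<bar>em_average f - em_average g\<bar> \<le> E"
  using em_average_mono[of f "\<lambda>l. g l + E"] em_average_mono[of "\<lambda>l. g l - E" f] assms
  by (simp add: abs_le_iff em_average_def sum.distrib sum_subtractf add_divide_distrib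
      diff_divide_distrib algebra_simps)

lemma em_average_em_step:
  fixes g :: "real^'n::finite \<Rightarrow> real"
  shows "em_average (\<lambda>l. g (em_step h v S l)) = (\<Sum>j\<in>(UNIV :: 'm::finite set).
      g (h *\<^sub>R v + sqrt (2 * h * CARD('m)) *\<^sub>R column j S) +
      g (h *\<^sub>R v - sqrt (2 * h * CARD('m)) *\<^sub>R column j S)) / (2 * real CARD('m))"
proof -
  have "(\<Sum>l\<in>UNIV. g (em_step h v S l)) = (\<Sum>j\<in>(UNIV :: 'm set). \<Sum>s\<in>UNIV. g (em_step h v S (j, s)))"
    unfolding sum.cartesian_product by simp
  then show ?thesis by (simp add: em_average_def UNIV_bool em_step_def add.commute)
qed

lemma em_step_diff: "em_step h v S l - em_step h v' S' l = em_step h (v - v') (S - S') l"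
proof -
  have "column (fst l) (S - S') = column (fst l) S - column (fst l) S'" by (simp add: column_def vec_eq_iff)
  then show ?thesis unfolding em_step_def by (simp add: scaleR_diff_right)
qed

lemma le_sqrt: "0 \<le> h \<Longrightarrow> h \<le> 1 \<Longrightarrow> h \<le> sqrt h"
  by (simp add: real_le_rsqrt power2_eq_square mult_left_le_one_le)

lemma norm_em_step_le:
  fixes S :: "real^'m::finite^'n::finite"
  assumes "0 \<le> h" "h \<le> 1" "norm v \<le> R" "norm S \<le> R"
  shows "norm (em_step h v S l) \<le> R * (1 + sqrt (2 * CARD('m))) * sqrt h"
proof -
  have "norm (em_step h v S l) \<le> h * norm v + sqrt (2 * h * CARD('m)) * norm (column (fst l) S)"
    unfolding em_step_def using assms(1)
    by (intro norm_triangle_ineq[THEN order_trans] add_mono) (auto simp: abs_mult)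
  also have "\<dots> \<le> sqrt h * R + sqrt (2 * h * CARD('m)) * R"
  proof (intro add_mono mult_mono assms mult_left_mono)
    show "h \<le> sqrt h" by (rule le_sqrt[OF assms(1,2)])
    show "norm (column (fst l) S) \<le> R" using norm_column_le_norm assms(4) order_trans by blast
  qed (use assms in auto)
  also have "\<dots> = R * (1 + sqrt (2 * CARD('m))) * sqrt h"
    by (simp add: real_sqrt_mult algebra_simps)
  finally show ?thesis .
qed

lemma em_average_Taylor_polynomial:
  fixes S :: "real^'m::finite^'n::finite" and x :: "real^'n"
  assumes "smooth f" "h \<ge> 0"
  defines "T \<equiv> \<lambda>u. f x + ddir u f x + ddir u (ddir u f) x / 2"
  shows "em_average (\<lambda>l. T (em_step h v S l)) = f x + h * gen S v f x + h\<^sup>2 * ddir v (ddir v f) x / 2"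
proof -
  let ?m = "real CARD('m)" and ?B = "\<lambda>u. ddir u (ddir u f) x"
  have pair: "T (a + c) + T (a - c) = 2 * f x + 2 * ddir a f x + ?B a + ?B c" for a c
    using ddir_ddir_parallelogram[OF assms(1), of a c x]
      ddir_add[of a c f x] ddir_diff[of a c f x]
    unfolding T_def by linarith
  have "em_average (\<lambda>l. T (em_step h v S l)) =
      (\<Sum>j\<in>(UNIV :: 'm set). 2 * f x + 2 * (h * ddir v f x) + h\<^sup>2 * ?B v + 2 * h * ?m * ?B (column j S)) / (2 * ?m)"
    unfolding em_average_em_step pair ddir_ddir_scaleR[OF assms(1)]
    using assms(2) by (simp add: ddir_scaleR)
  also have "\<dots> = (2 * ?m * (f x + h * gen S v f x + h\<^sup>2 * ?B v / 2)) / (2 * ?m)"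
    by (simp add: gen_def sum.distrib sum_distrib_left[symmetric] algebra_simps)
  finally show ?thesis by simp
qed

definition em_error :: "(real^'n \<Rightarrow> real) \<Rightarrow> real \<Rightarrow> real^'m::finite^'n::finite \<Rightarrow> real^'n \<Rightarrow> real^'n \<Rightarrow> real" where
  "em_error f h S v x = em_average (\<lambda>l. f (x + em_step h v S l)) - (f x + h * gen S v f x)"

lemma em_error_le:
  fixes f :: "real^'n::finite \<Rightarrow> real"
  assumes "f \<in> C0_inf" "R \<ge> 0"
  shows "\<exists>K\<ge>0. \<forall>x v h. \<forall>S :: real^'m::finite^'n. norm v \<le> R \<longrightarrow> norm S \<le> R \<longrightarrow> 0 \<le> h \<longrightarrow> h \<le> 1 \<longrightarrow>
    \<bar>em_error f h S v x\<bar> \<le> K * (h * sqrt h)"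
proof -
  obtain D where D: "D \<ge> 0" "\<And>is x. length is \<le> 3 \<Longrightarrow> \<bar>iter_pdiff is f x\<bar> \<le> D"
    using C0_inf_derivatives_bounded[OF assms(1), of 3] by blast
  have f: "smooth f" by (rule C0_inf_smooth[OF assms(1)])
  let ?n = "real CARD('n)" and ?r = "R * (1 + sqrt (2 * CARD('m)))"
  define K where "K = D * (?n * ?r) ^ 3 + D * (?n * R)\<^sup>2"
  have "\<bar>em_error f h S v x\<bar> \<le> K * (h * sqrt h)"
    if v: "norm v \<le> R" and S: "norm S \<le> R" and h: "0 \<le> h" "h \<le> 1"
    for x v h and S :: "real^'m^'n"
  proof -
    let ?T = "\<lambda>u. f x + ddir u f x + ddir u (ddir u f) x / 2"
    have "\<bar>f (x + em_step h v S l) - ?T (em_step h v S l)\<bar> \<le> D * (?n * (?r * sqrt h)) ^ 3" for l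
    proof (rule order_trans[OF second_order_Taylor[OF f]])
      show "D * (?n * norm (em_step h v S l)) ^ 3 \<le> D * (?n * (?r * sqrt h)) ^ 3"
        by (intro mult_left_mono power_mono norm_em_step_le v S h D) auto
    qed (simp add: D)
    then have "\<bar>em_average (\<lambda>l. f (x + em_step h v S l)) - em_average (\<lambda>l. ?T (em_step h v S l))\<bar>
        \<le> D * (?n * (?r * sqrt h)) ^ 3"
      by (rule abs_em_average_diff_le)
    also have "\<dots> = D * (?n * ?r) ^ 3 * (h * sqrt h)"
      using h(1) by (simp add: power_mult_distrib power3_eq_cube)
    finally have Taylor: "\<bar>em_average (\<lambda>l. f (x + em_step h v S l)) - em_average (\<lambda>l. ?T (em_step h v S l))\<bar>
        \<le> D * (?n * ?r) ^ 3 * (h * sqrt h)" .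
    have "\<bar>ddir v (ddir v f) x\<bar> \<le> D * (?n * norm v)\<^sup>2"
      using D(2)[of "[_, _]"] by (intro abs_ddir_ddir_le f) simp
    also have "\<dots> \<le> D * (?n * R)\<^sup>2"
      by (intro mult_left_mono power_mono v D) auto
    finally have "\<bar>ddir v (ddir v f) x\<bar> / 2 \<le> D * (?n * R)\<^sup>2" by linarith
    then have "(h * h) * (\<bar>ddir v (ddir v f) x\<bar> / 2) \<le> (h * sqrt h) * (D * (?n * R)\<^sup>2)"
      by (intro mult_mono mult_left_mono le_sqrt h) (use h in auto)
    then have "\<bar>h\<^sup>2 * ddir v (ddir v f) x / 2\<bar> \<le> D * (?n * R)\<^sup>2 * (h * sqrt h)"
      by (simp add: abs_mult power2_eq_square mult.commute)
    with Taylor show ?thesis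
      unfolding em_error_def em_average_Taylor_polynomial[OF f h(1)] K_def by (simp add: distrib_right)
  qed
  moreover have "K \<ge> 0" using D(1) assms(2) by (simp add: K_def)
  ultimately show ?thesis by blast
qed

section \<open>Couplings\<close>

lemma nn_integral_distr_le:
  assumes "f \<in> measurable P M" "sets M = sets N" "distr P M f \<le> N" "u \<in> borel_measurable M"
  shows "(\<integral>\<^sup>+z. u (f z) \<partial>P) \<le> (\<integral>\<^sup>+x. u x \<partial>N)"
proof -
  have "(\<integral>\<^sup>+z. u (f z) \<partial>P) = (\<integral>\<^sup>+x. u x \<partial>distr P M f)"
    using assms(1,4) by (simp add: nn_integral_distr)
  also have "\<dots> \<le> (\<integral>\<^sup>+x. u x \<partial>N)"
    using assms(2,3) by (intro nn_integral_mono_measure) simp_all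
  finally show ?thesis .
qed

lemma density_le_imp_AE_le_1:
  assumes "finite_measure M" and [measurable]: "f \<in> borel_measurable M" and density_le_M: "density M f \<le> M"
  shows "AE x in M. f x \<le> 1"
proof -
  interpret finite_measure M by fact
  let ?A = "{x\<in>space M. 1 < f x}"
  have "(\<integral>\<^sup>+x. f x * indicator ?A x \<partial>M) = emeasure (density M f) ?A"
    by (simp add: emeasure_density)
  also have "\<dots> \<le> emeasure M ?A" using density_le_M by (rule le_measureD3) simp
  also have "\<dots> = (\<integral>\<^sup>+x. indicator ?A x \<partial>M)" by simp
  finally have "(\<integral>\<^sup>+x. f x * indicator ?A x \<partial>M) \<le> (\<integral>\<^sup>+x. indicator ?A x \<partial>M)" .
  moreover from this have "(\<integral>\<^sup>+x. f x * indicator ?A x \<partial>M) < \<top>"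
    by (rule le_less_trans) (simp add: less_top[symmetric])
  moreover have "(\<integral>\<^sup>+x. f x * indicator ?A x - indicator ?A x \<partial>M) =
      (\<integral>\<^sup>+x. f x * indicator ?A x \<partial>M) - (\<integral>\<^sup>+x. indicator ?A x \<partial>M)"
    by (rule nn_integral_diff) (simp_all, auto simp: indicator_def)
  ultimately have "AE x in M. f x * indicator ?A x - indicator ?A x = 0"
    using nn_integral_0_iff_AE[of "\<lambda>x. f x * indicator ?A x - indicator ?A x" M]
    by (simp add: diff_eq_0_ennreal)
  then show ?thesis
    using AE_space
  proof eventually_elim
    case (elim x)
    then have "f x - 1 = 0" if "1 < f x" using that by (simp add: indicator_def)
    then show ?case by (force simp: diff_eq_0_iff_ennreal)
  qed
qed

lemma prob_space_eq_if_le: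
  assumes "prob_space M" "prob_space N" and same_sets: "sets M = sets N" and M_le_N: "M \<le> N"
  shows "M = N"
proof (rule measure_eqI[OF same_sets])
  interpret M: prob_space M by fact
  interpret N: prob_space N by fact
  fix A assume A: "A \<in> sets M"
  have measure_le: "measure M B \<le> measure N B" for B
    using le_measureD3[OF M_le_N same_sets, of B] by (simp add: M.emeasure_eq_measure N.emeasure_eq_measure)
  have "measure M A = measure N A"
    using measure_le[of A] measure_le[of "space M - A"] A same_sets M.prob_compl[of A] N.prob_compl[of A]
      sets_eq_imp_space_eq[OF same_sets] by simp
  then show "emeasure M A = emeasure N A"
    by (simp add: M.emeasure_eq_measure N.emeasure_eq_measure)
qed

lemma (in prob_space) nn_integral_add_complement:
  assumes "f \<in> borel_measurable M" "AE x in M. f x \<le> (1 :: ennreal)"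
  shows "(\<integral>\<^sup>+x. f x \<partial>M) + (\<integral>\<^sup>+x. 1 - f x \<partial>M) = 1"
proof -
  have "(\<integral>\<^sup>+x. f x \<partial>M) + (\<integral>\<^sup>+x. 1 - f x \<partial>M) = (\<integral>\<^sup>+x. f x + (1 - f x) \<partial>M)"
    using assms(1) by (intro nn_integral_add[symmetric]) auto
  also have "\<dots> = (\<integral>\<^sup>+x. 1 \<partial>M)"
    using assms(2) by (intro nn_integral_cong_AE) (auto simp: add_diff_inverse_ennreal)
  finally show ?thesis by (simp add: emeasure_space_1)
qed

definition coupling :: "'a measure \<Rightarrow> 'b measure \<Rightarrow> ('a \<times> 'b) measure \<Rightarrow> bool" where
  "coupling M N P \<longleftrightarrow> sets P = sets (M \<Otimes>\<^sub>M N) \<and> distr P M fst = M \<and> distr P N snd = N"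

definition subcoupling :: "'a measure \<Rightarrow> 'b measure \<Rightarrow> ('a \<times> 'b) measure \<Rightarrow> bool" where
  "subcoupling M N P \<longleftrightarrow> sets P = sets (M \<Otimes>\<^sub>M N) \<and> distr P M fst \<le> M \<and> distr P N snd \<le> N"

lemma coupling_imp_subcoupling: "coupling M N P \<Longrightarrow> subcoupling M N P"
  by (simp add: coupling_def subcoupling_def)

lemma coupling_imp_prob_space:
  assumes "coupling M N P" "prob_space M"
  shows "prob_space P"
  using assms measurable_cong_sets[of P "M \<Otimes>\<^sub>M N" M M] prob_space_distrD[of fst P M]
  by (simp add: coupling_def)

lemma nn_integral_subcoupling_le_1:
  assumes P: "subcoupling M N P" and "prob_space M" and "\<And>z. k z \<le> 1"
  shows "(\<integral>\<^sup>+z. k z \<partial>P) \<le> 1"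
proof -
  interpret prob_space M by fact
  have [measurable_cong]: "sets P = sets (M \<Otimes>\<^sub>M N)" using P by (simp add: subcoupling_def)
  have "(\<integral>\<^sup>+z. k z \<partial>P) \<le> (\<integral>\<^sup>+z. 1 \<partial>P)" by (intro nn_integral_mono assms)
  also have "\<dots> \<le> (\<integral>\<^sup>+x. 1 \<partial>M)"
    using P by (intro nn_integral_distr_le[where f=fst and M=M]) (simp_all add: subcoupling_def)
  finally show ?thesis by (simp add: emeasure_space_1)
qed

lemma couplingD:
  assumes "coupling M N P"
  shows "fst \<in> measurable P M" "snd \<in> measurable P N" "distr P M fst = M" "distr P N snd = N"
    "sets P = sets (M \<Otimes>\<^sub>M N)"
  using assms measurable_cong_sets[of P "M \<Otimes>\<^sub>M N"] by (auto simp: coupling_def)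

lemma integrable_marginal:
  fixes u :: "'a \<Rightarrow> 'c::{banach, second_countable_topology}"
  assumes "f \<in> measurable P M" "distr P M f = M" "integrable M u"
  shows "integrable P (\<lambda>z. u (f z))" "(\<integral>z. u (f z) \<partial>P) = (\<integral>x. u x \<partial>M)"
  using assms integrable_distr[of f P M u] integral_distr[of f P M u] by auto

lemma AE_marginal: "f \<in> measurable P M \<Longrightarrow> distr P M f = M \<Longrightarrow> AE x in M. A x \<Longrightarrow> AE z in P. A (f z)"
  by (metis AE_distrD)

lemma coupling_distr:
  assumes P: "coupling M N P" and [measurable]: "f \<in> measurable M A" "g \<in> measurable N B"
  shows "coupling (distr M A f) (distr N B g) (distr P (A \<Otimes>\<^sub>M B) (map_prod f g))"
proof -
  have [measurable_cong]: "sets P = sets (M \<Otimes>\<^sub>M N)" and marginals: "distr P M fst = M" "distr P N snd = N"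
    using P by (auto simp: coupling_def)
  have "distr P A (f \<circ> fst) = distr (distr P M fst) A f" "distr P B (g \<circ> snd) = distr (distr P N snd) B g"
    by (simp_all add: distr_distr)
  then have "distr P A (f \<circ> fst) = distr M A f" "distr P B (g \<circ> snd) = distr N B g"
    by (simp_all add: marginals)
  moreover have "fst \<circ> map_prod f g = f \<circ> fst" "snd \<circ> map_prod f g = g \<circ> snd" by auto
  ultimately show ?thesis
    by (simp add: coupling_def distr_distr map_prod_def split_beta comp_def cong: distr_cong)
qed

context pair_prob_space
begin

lemma distr_density_fst:
  assumes [measurable]: "\<theta> \<in> borel_measurable (M1 \<Otimes>\<^sub>M M2)"
  shows "distr (density (M1 \<Otimes>\<^sub>M M2) \<theta>) M1 fst = density M1 (\<lambda>x. \<integral>\<^sup>+y. \<theta> (x, y) \<partial>M2)"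
proof (rule measure_eqI)
  fix A assume "A \<in> sets (distr (density (M1 \<Otimes>\<^sub>M M2) \<theta>) M1 fst)"
  then have [measurable]: "A \<in> sets M1" by simp
  have "emeasure (distr (density (M1 \<Otimes>\<^sub>M M2) \<theta>) M1 fst) A =
      (\<integral>\<^sup>+z. \<theta> z * indicator A (fst z) \<partial>(M1 \<Otimes>\<^sub>M M2))"
    by (auto simp: emeasure_distr emeasure_density space_pair_measure indicator_def intro!: nn_integral_cong)
  also have "\<dots> = (\<integral>\<^sup>+x. \<integral>\<^sup>+y. \<theta> (x, y) * indicator A x \<partial>M2 \<partial>M1)"
    by (simp add: M2.nn_integral_fst[symmetric])
  also have "\<dots> = emeasure (density M1 (\<lambda>x. \<integral>\<^sup>+y. \<theta> (x, y) \<partial>M2)) A"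
    by (auto simp: emeasure_density intro!: nn_integral_cong nn_integral_multc)
  finally show "emeasure (distr (density (M1 \<Otimes>\<^sub>M M2) \<theta>) M1 fst) A =
    emeasure (density M1 (\<lambda>x. \<integral>\<^sup>+y. \<theta> (x, y) \<partial>M2)) A" .
qed simp

lemma distr_density_snd:
  assumes [measurable]: "\<theta> \<in> borel_measurable (M1 \<Otimes>\<^sub>M M2)"
  shows "distr (density (M1 \<Otimes>\<^sub>M M2) \<theta>) M2 snd = density M2 (\<lambda>y. \<integral>\<^sup>+x. \<theta> (x, y) \<partial>M1)"
proof -
  interpret flip: pair_prob_space M2 M1 ..
  let ?flip = "\<lambda>z. (snd z, fst z)"
  have "density (M1 \<Otimes>\<^sub>M M2) \<theta> = distr (density (M2 \<Otimes>\<^sub>M M1) (\<lambda>z. \<theta> (?flip z))) (M1 \<Otimes>\<^sub>M M2) ?flip"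
    using density_distr[of \<theta> "M1 \<Otimes>\<^sub>M M2" ?flip "M2 \<Otimes>\<^sub>M M1"] distr_pair_swap
    by (simp add: case_prod_beta')
  then show ?thesis
    using flip.distr_density_fst[of "\<lambda>z. \<theta> (?flip z)"] by (simp add: distr_distr comp_def)
qed

lemma coupling_density_iff:
  assumes [measurable]: "\<theta> \<in> borel_measurable (M1 \<Otimes>\<^sub>M M2)"
  shows "coupling M1 M2 (density (M1 \<Otimes>\<^sub>M M2) \<theta>) \<longleftrightarrow>
    (AE x in M1. (\<integral>\<^sup>+y. \<theta> (x, y) \<partial>M2) = 1) \<and> (AE y in M2. (\<integral>\<^sup>+x. \<theta> (x, y) \<partial>M1) = 1)"
  using M1.density_unique_iff[of "\<lambda>x. \<integral>\<^sup>+y. \<theta> (x, y) \<partial>M2" "\<lambda>_. 1"]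
    M2.density_unique_iff[of "\<lambda>y. \<integral>\<^sup>+x. \<theta> (x, y) \<partial>M1" "\<lambda>_. 1"]
  by (simp add: coupling_def distr_density_fst distr_density_snd density_1)

lemma subcoupling_densityD:
  assumes "\<theta> \<in> borel_measurable (M1 \<Otimes>\<^sub>M M2)" "subcoupling M1 M2 (density (M1 \<Otimes>\<^sub>M M2) \<theta>)"
  shows "AE x in M1. (\<integral>\<^sup>+y. \<theta> (x, y) \<partial>M2) \<le> 1" "AE y in M2. (\<integral>\<^sup>+x. \<theta> (x, y) \<partial>M1) \<le> 1"
  using assms density_le_imp_AE_le_1[OF M1.finite_measure_axioms, of "\<lambda>x. \<integral>\<^sup>+y. \<theta> (x, y) \<partial>M2"]
    density_le_imp_AE_le_1[OF M2.finite_measure_axioms, of "\<lambda>y. \<integral>\<^sup>+x. \<theta> (x, y) \<partial>M1"]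
  by (simp_all add: subcoupling_def distr_density_fst distr_density_snd)

lemma nn_integral_subcoupling_deficit:
  assumes \<theta>[measurable]: "\<theta> \<in> borel_measurable (M1 \<Otimes>\<^sub>M M2)"
    and subcoupling: "subcoupling M1 M2 (density (M1 \<Otimes>\<^sub>M M2) \<theta>)"
  defines "row_mass \<equiv> \<lambda>x. \<integral>\<^sup>+y. \<theta> (x, y) \<partial>M2" and "col_mass \<equiv> \<lambda>y. \<integral>\<^sup>+x. \<theta> (x, y) \<partial>M1"
  shows "(\<integral>\<^sup>+x. 1 - row_mass x \<partial>M1) \<noteq> \<top>" "(\<integral>\<^sup>+y. 1 - col_mass y \<partial>M2) = (\<integral>\<^sup>+x. 1 - row_mass x \<partial>M1)"
proof -
  have [measurable]: "row_mass \<in> borel_measurable M1" "col_mass \<in> borel_measurable M2"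
    unfolding row_mass_def col_mass_def by measurable
  have mass_le_1: "AE x in M1. row_mass x \<le> 1" "AE y in M2. col_mass y \<le> 1"
    using subcoupling_densityD[OF \<theta> subcoupling] by (simp_all add: row_mass_def col_mass_def)
  have rows: "(\<integral>\<^sup>+x. row_mass x \<partial>M1) + (\<integral>\<^sup>+x. 1 - row_mass x \<partial>M1) = 1"
    using mass_le_1(1) by (rule M1.nn_integral_add_complement[rotated]) simp
  have cols: "(\<integral>\<^sup>+y. col_mass y \<partial>M2) + (\<integral>\<^sup>+y. 1 - col_mass y \<partial>M2) = 1"
    using mass_le_1(2) by (rule M2.nn_integral_add_complement[rotated]) simp
  have "(\<integral>\<^sup>+x. row_mass x \<partial>M1) = (\<integral>\<^sup>+y. col_mass y \<partial>M2)"
    unfolding row_mass_def col_mass_def by (rule Fubini'[symmetric]) simp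
  moreover have "(\<integral>\<^sup>+x. row_mass x \<partial>M1) \<noteq> \<top>" using rows by (auto simp: top_add)
  ultimately show "(\<integral>\<^sup>+y. 1 - col_mass y \<partial>M2) = (\<integral>\<^sup>+x. 1 - row_mass x \<partial>M1)"
    using rows cols by (metis ennreal_add_left_cancel top_neq_ennreal infinity_ennreal_def)
  show "(\<integral>\<^sup>+x. 1 - row_mass x \<partial>M1) \<noteq> \<top>" using rows by (auto simp: add_top)
qed

text \<open>The product of the two marginal deficits, normalised, fills up a subcoupling.\<close>

lemma subcoupling_density_completion:
  assumes \<theta>[measurable]: "\<theta> \<in> borel_measurable (M1 \<Otimes>\<^sub>M M2)"
    and subcoupling: "subcoupling M1 M2 (density (M1 \<Otimes>\<^sub>M M2) \<theta>)"
  shows "\<exists>\<theta>' \<in> borel_measurable (M1 \<Otimes>\<^sub>M M2). (\<forall>z. \<theta> z \<le> \<theta>' z) \<and> coupling M1 M2 (density (M1 \<Otimes>\<^sub>M M2) \<theta>')"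
proof -
  define row where "row x = (\<integral>\<^sup>+y. \<theta> (x, y) \<partial>M2)" for x
  define col where "col y = (\<integral>\<^sup>+x. \<theta> (x, y) \<partial>M1)" for y
  have [measurable]: "row \<in> borel_measurable M1" "col \<in> borel_measurable M2"
    unfolding row_def col_def by measurable
  have row: "AE x in M1. row x \<le> 1" and col: "AE y in M2. col y \<le> 1"
    using subcoupling_densityD[OF \<theta> subcoupling] by (simp_all add: row_def col_def)
  define m where "m = (\<integral>\<^sup>+x. 1 - row x \<partial>M1)"
  have m: "m \<noteq> \<top>" "(\<integral>\<^sup>+y. 1 - col y \<partial>M2) = m"
    using nn_integral_subcoupling_deficit[OF \<theta> subcoupling] by (simp_all add: m_def row_def col_def)
  show ?thesis
  proof (cases "m = 0")
    case True
    then have "AE x in M1. 1 - row x = 0" "AE y in M2. 1 - col y = 0"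
      using m(2) nn_integral_0_iff_AE[of "\<lambda>x. 1 - row x" M1] nn_integral_0_iff_AE[of "\<lambda>y. 1 - col y" M2]
      by (simp_all add: m_def)
    with row col have "AE x in M1. row x = 1" "AE y in M2. col y = 1"
      by (auto elim!: eventually_elim2 simp: diff_eq_0_iff_ennreal intro: antisym)
    then have "coupling M1 M2 (density (M1 \<Otimes>\<^sub>M M2) \<theta>)"
      by (simp add: coupling_density_iff row_def col_def)
    then show ?thesis using \<theta> by auto
  next
    case False
    define \<theta>' where "\<theta>' z = \<theta> z + (1 - row (fst z)) * (1 - col (snd z)) / m" for z
    have cancel: "a * m / m = a" for a
      using False m(1) by (simp add: ennreal_times_divide[symmetric] ennreal_divide_self less_top)
    have [measurable]: "\<theta>' \<in> borel_measurable (M1 \<Otimes>\<^sub>M M2)" unfolding \<theta>'_def by measurable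
    have "(\<integral>\<^sup>+y. \<theta>' (x, y) \<partial>M2) = row x + (1 - row x) * m / m" if "x \<in> space M1" for x
      using that unfolding \<theta>'_def m(2)[symmetric]
      by (simp add: nn_integral_add nn_integral_cmult nn_integral_divide row_def)
    moreover have "(\<integral>\<^sup>+x. \<theta>' (x, y) \<partial>M1) = col y + m * (1 - col y) / m" if "y \<in> space M2" for y
      using that unfolding \<theta>'_def
      by (simp add: nn_integral_add nn_integral_multc nn_integral_divide col_def) (simp add: m_def)
    ultimately have "coupling M1 M2 (density (M1 \<Otimes>\<^sub>M M2) \<theta>')"
      using row col AE_space[of M1] AE_space[of M2]
      by (auto simp: coupling_density_iff cancel mult.commute[of m] add_diff_inverse_ennreal
          elim: eventually_elim2)
    then show ?thesis by (intro bexI[of _ \<theta>']) (auto simp: \<theta>'_def)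
  qed
qed

end

lemma absolutely_continuous_distr:
  assumes "absolutely_continuous M N" "sets N = sets M" "f \<in> measurable M S"
  shows "absolutely_continuous (distr M S f) (distr N S f)"
  unfolding absolutely_continuous_def
proof
  fix A assume A: "A \<in> null_sets (distr M S f)"
  have "f \<in> measurable N S" using assms(2,3) measurable_cong_sets by blast
  moreover have "f -` A \<inter> space M \<in> null_sets N"
    using assms(1) A null_sets_distr_iff[OF assms(3)] by (auto simp: absolutely_continuous_def)
  ultimately show "A \<in> null_sets (distr N S f)"
    using A assms(2) null_sets_distr_iff[of f N S] sets_eq_imp_space_eq[OF assms(2)] by auto
qed

lemma coupling_lift:
  assumes "prob_space \<Gamma>" "prob_space \<Delta>"
    and f[measurable]: "f \<in> measurable \<Gamma> A" and g[measurable]: "g \<in> measurable \<Delta> B"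
    and P: "coupling (distr \<Gamma> A f) (distr \<Delta> B g) P" "absolutely_continuous (distr \<Gamma> A f \<Otimes>\<^sub>M distr \<Delta> B g) P"
  shows "\<exists>\<Lambda>. coupling \<Gamma> \<Delta> \<Lambda> \<and> absolutely_continuous (\<Gamma> \<Otimes>\<^sub>M \<Delta>) \<Lambda> \<and> distr \<Lambda> (A \<Otimes>\<^sub>M B) (map_prod f g) = P"
proof -
  interpret G: pair_prob_space \<Gamma> \<Delta>
    using assms(1,2) by (simp add: pair_prob_space_def pair_sigma_finite_def prob_space_imp_sigma_finite)
  interpret fG: prob_space "distr \<Gamma> A f" by (rule G.M1.prob_space_distr[OF f])
  interpret gD: prob_space "distr \<Delta> B g" by (rule G.M2.prob_space_distr[OF g])
  interpret D: pair_prob_space "distr \<Gamma> A f" "distr \<Delta> B g" ..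
  have [simp]: "sets (distr \<Gamma> A f \<Otimes>\<^sub>M distr \<Delta> B g) = sets (A \<Otimes>\<^sub>M B)" by (intro sets_pair_measure_cong) simp_all
  obtain \<theta> where \<theta>: "\<theta> \<in> borel_measurable (distr \<Gamma> A f \<Otimes>\<^sub>M distr \<Delta> B g)"
    "density (distr \<Gamma> A f \<Otimes>\<^sub>M distr \<Delta> B g) \<theta> = P"
    using D.Radon_Nikodym[OF P(2)] P(1) by (auto simp: coupling_def)
  have [measurable]: "\<theta> \<in> borel_measurable (A \<Otimes>\<^sub>M B)" using \<theta>(1) by (simp cong: measurable_cong_sets)
  let ?\<theta> = "\<lambda>z. \<theta> (map_prod f g z)"
  have [measurable]: "map_prod f g \<in> measurable (\<Gamma> \<Otimes>\<^sub>M \<Delta>) (A \<Otimes>\<^sub>M B)" by (simp add: map_prod_def split_beta)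
  have "AE x in distr \<Gamma> A f. (\<integral>\<^sup>+y. \<theta> (x, y) \<partial>distr \<Delta> B g) = 1"
    "AE y in distr \<Delta> B g. (\<integral>\<^sup>+x. \<theta> (x, y) \<partial>distr \<Gamma> A f) = 1"
    using P(1) D.coupling_density_iff[OF \<theta>(1)] by (simp_all add: \<theta>(2))
  then have "coupling \<Gamma> \<Delta> (density (\<Gamma> \<Otimes>\<^sub>M \<Delta>) ?\<theta>)"
    by (auto simp: G.coupling_density_iff AE_distr_iff nn_integral_distr dest!: AE_distrD[rotated]
        elim!: eventually_mono)
  moreover have "distr (density (\<Gamma> \<Otimes>\<^sub>M \<Delta>) ?\<theta>) (A \<Otimes>\<^sub>M B) (map_prod f g) = P"
  proof -
    have "distr (density (\<Gamma> \<Otimes>\<^sub>M \<Delta>) ?\<theta>) (A \<Otimes>\<^sub>M B) (map_prod f g) =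
        density (distr (\<Gamma> \<Otimes>\<^sub>M \<Delta>) (A \<Otimes>\<^sub>M B) (map_prod f g)) \<theta>"
      by (rule density_distr[symmetric]) measurable
    also have "distr (\<Gamma> \<Otimes>\<^sub>M \<Delta>) (A \<Otimes>\<^sub>M B) (map_prod f g) = distr \<Gamma> A f \<Otimes>\<^sub>M distr \<Delta> B g"
      by (simp add: pair_measure_distr gD.sigma_finite_measure_axioms map_prod_def)
    finally show ?thesis by (simp add: \<theta>(2))
  qed
  moreover have "absolutely_continuous (\<Gamma> \<Otimes>\<^sub>M \<Delta>) (density (\<Gamma> \<Otimes>\<^sub>M \<Delta>) ?\<theta>)"
    by (rule absolutely_continuousI_density) measurable
  ultimately show ?thesis by blast
qed

lemma (in pair_prob_space) exists_almost_optimal_coupling: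
  assumes [measurable]: "k \<in> borel_measurable (M1 \<Otimes>\<^sub>M M2)" and k_le_1: "\<And>z. k z \<le> 1" and e: "e > 0"
  shows "\<exists>P. coupling M1 M2 P \<and> absolutely_continuous (M1 \<Otimes>\<^sub>M M2) P \<and>
    (\<forall>Q. subcoupling M1 M2 Q \<longrightarrow> absolutely_continuous (M1 \<Otimes>\<^sub>M M2) Q \<longrightarrow>
      (\<integral>\<^sup>+z. k z \<partial>Q) \<le> (\<integral>\<^sup>+z. k z \<partial>P) + ennreal e)"
proof -
  define C where "C = {P. subcoupling M1 M2 P \<and> absolutely_continuous (M1 \<Otimes>\<^sub>M M2) P}"
  define V where "V = (SUP P\<in>C. \<integral>\<^sup>+z. k z \<partial>P)"
  have "V \<le> 1"
    unfolding V_def C_def using nn_integral_subcoupling_le_1[OF _ M1.prob_space_axioms k_le_1]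
    by (auto intro!: SUP_least)
  then have V: "V \<noteq> \<infinity>" by (auto simp: top_unique)
  have "coupling M1 M2 (density (M1 \<Otimes>\<^sub>M M2) (\<lambda>_. 1))"
    by (simp add: coupling_density_iff M1.emeasure_space_1 M2.emeasure_space_1)
  then have "C \<noteq> {}"
    unfolding C_def
    by (auto intro!: exI[of _ "density (M1 \<Otimes>\<^sub>M M2) (\<lambda>_. 1)"] coupling_imp_subcoupling absolutely_continuousI_density)
  from SUP_approx_ennreal[OF _ this V_def V, of e] e
  obtain P where P: "P \<in> C" and almost_optimal: "V < (\<integral>\<^sup>+z. k z \<partial>P) + ennreal e" by auto
  obtain \<theta> where \<theta>[measurable]: "\<theta> \<in> borel_measurable (M1 \<Otimes>\<^sub>M M2)" and P_eq: "P = density (M1 \<Otimes>\<^sub>M M2) \<theta>"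
    using P Radon_Nikodym[of P] by (auto simp: C_def subcoupling_def)
  obtain \<theta>' where \<theta>'[measurable]: "\<theta>' \<in> borel_measurable (M1 \<Otimes>\<^sub>M M2)" and "\<And>z. \<theta> z \<le> \<theta>' z"
    and P': "coupling M1 M2 (density (M1 \<Otimes>\<^sub>M M2) \<theta>')"
    using subcoupling_density_completion[OF \<theta>] P unfolding P_eq C_def by blast
  then have "(\<integral>\<^sup>+z. k z \<partial>P) \<le> (\<integral>\<^sup>+z. k z \<partial>density (M1 \<Otimes>\<^sub>M M2) \<theta>')"
    unfolding P_eq by (simp add: nn_integral_density nn_integral_mono mult_right_mono)
  then have "V \<le> (\<integral>\<^sup>+z. k z \<partial>density (M1 \<Otimes>\<^sub>M M2) \<theta>') + ennreal e"
    using almost_optimal by (meson add_right_mono less_imp_le order_trans)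
  then have "(\<integral>\<^sup>+z. k z \<partial>Q) \<le> (\<integral>\<^sup>+z. k z \<partial>density (M1 \<Otimes>\<^sub>M M2) \<theta>') + ennreal e" if "Q \<in> C" for Q
    using SUP_upper[OF that, of "\<lambda>P. \<integral>\<^sup>+z. k z \<partial>P"] by (simp add: V_def)
  then show ?thesis using P' absolutely_continuousI_density[OF \<theta>'] by (auto simp: C_def)
qed

subsection \<open>Thinning\<close>

definition thinning :: "ennreal \<Rightarrow> ennreal \<Rightarrow> ennreal" where
  "thinning p q = p / max p q"

lemma thinning_measurable [measurable (raw)]:
  assumes [measurable]: "p \<in> borel_measurable M" "q \<in> borel_measurable M"
  shows "(\<lambda>x. thinning (p x) (q x)) \<in> borel_measurable M"
  unfolding thinning_def by measurable

lemma thinning_eq_0: "thinning 0 q = 0"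
  by (simp add: thinning_def)

lemma thinning_le_1: "thinning p q \<le> 1"
  unfolding thinning_def
  by (cases "max p q = 0") (auto intro!: divide_le_posI_ennreal simp: zero_less_iff_neq_zero max_def split: if_splits)

lemma mult_thinning_le:
  assumes "p < \<top>" "q < \<top>"
  shows "q * thinning p q \<le> p"
proof -
  have "max p q \<noteq> \<top>" using assms by (auto simp: max_def)
  then have "max p q * thinning p q \<le> p"
    by (cases "max p q = 0")
      (auto simp: thinning_def ennreal_times_divide mult_divide_eq_ennreal mult.commute[of _ p])
  then show ?thesis by (meson max.cobounded2 mult_right_mono order_trans zero_le)
qed

lemma mult_complement_thinning_le:
  assumes "p < \<top>" "q < \<top>"
  shows "q * (1 - thinning p q) \<le> q - p"
proof (cases "q \<le> p")
  case True
  then show ?thesis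
    using assms
    by (cases "p = 0") (auto simp: thinning_def max_absorb1 ennreal_divide_self zero_less_iff_neq_zero)
next
  case False
  then obtain a b where reals: "p = ennreal a" "q = ennreal b" "0 \<le> a" "0 \<le> b" "a < b"
    using assms by (cases p; cases q) (auto simp: ennreal_less_iff not_le)
  then have "thinning p q = ennreal (a / b)"
    by (simp add: thinning_def max_def ennreal_leI divide_ennreal)
  then have "q * (1 - thinning p q) = ennreal (b * (1 - a / b))"
    using reals by (simp add: ennreal_mult ennreal_minus flip: ennreal_1)
  also have "b * (1 - a / b) = b - a" using reals by (simp add: field_simps)
  finally show ?thesis using reals by (simp add: ennreal_minus)
qed

lemma one_le_mult_plus_complements:
  fixes A B :: ennreal
  assumes "A \<le> 1" "B \<le> 1"
  shows "1 \<le> A * B + (1 - A) + (1 - B)"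
proof -
  obtain a where a: "A = ennreal a" "0 \<le> a" "a \<le> 1"
    using assms(1) by (cases A) (auto simp: top_unique)
  obtain b where b: "B = ennreal b" "0 \<le> b" "b \<le> 1"
    using assms(2) by (cases B) (auto simp: top_unique)
  have "A * B + (1 - A) + (1 - B) = ennreal (a * b + (1 - a) + (1 - b))"
    using a b by (simp only: ennreal_mult[symmetric] ennreal_minus[symmetric] ennreal_1 ennreal_plus
        mult_nonneg_nonneg add_nonneg_nonneg diff_ge_0_iff_ge)
  moreover have "0 \<le> (1 - a) * (1 - b)" using a b by simp
  then have "1 \<le> a * b + (1 - a) + (1 - b)" by (simp add: algebra_simps)
  ultimately show ?thesis by (metis ennreal_1 ennreal_leI)
qed

lemma le_thinned_add_complements:
  fixes A B k :: ennreal
  assumes "A \<le> 1" "B \<le> 1" "k \<le> 1"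
  shows "k \<le> A * B * k + (1 - A) + (1 - B)"
proof -
  have "k \<le> (A * B + (1 - A) + (1 - B)) * k"
    using mult_right_mono[OF one_le_mult_plus_complements] assms(1,2) by simp
  also have "\<dots> \<le> A * B * k + (1 - A) * 1 + (1 - B) * 1"
    unfolding distrib_right by (intro add_mono mult_left_mono assms) auto
  finally show ?thesis by simp
qed

lemma distr_thinned_le:
  assumes f[measurable]: "f \<in> measurable P L" and distr_le: "distr P L f \<le> density L q"
    and [measurable]: "p \<in> borel_measurable L" "q \<in> borel_measurable L" "w \<in> borel_measurable P"
    and densities_finite: "\<And>x. p x < \<top>" "\<And>x. q x < \<top>" and w: "\<And>z. w z \<le> 1"
  shows "distr (density P (\<lambda>z. thinning (p (f z)) (q (f z)) * w z)) L f \<le> density L p"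
proof -
  let ?D = "density P (\<lambda>z. thinning (p (f z)) (q (f z)) * w z)"
  have "emeasure (distr ?D L f) A \<le> emeasure (density L p) A" if [measurable]: "A \<in> sets L" for A
  proof -
    have "emeasure (distr ?D L f) A = (\<integral>\<^sup>+z. thinning (p (f z)) (q (f z)) * w z * indicator A (f z) \<partial>P)"
      by (auto simp: emeasure_distr emeasure_density indicator_def intro!: nn_integral_cong)
    also have "\<dots> \<le> (\<integral>\<^sup>+z. thinning (p (f z)) (q (f z)) * 1 * indicator A (f z) \<partial>P)"
      by (intro nn_integral_mono mult_right_mono mult_left_mono w) auto
    also have "\<dots> \<le> (\<integral>\<^sup>+x. thinning (p x) (q x) * 1 * indicator A x \<partial>density L q)"
      by (rule nn_integral_distr_le[OF f _ distr_le]) simp_all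
    also have "\<dots> = (\<integral>\<^sup>+x. q x * thinning (p x) (q x) * indicator A x \<partial>L)"
      by (simp add: nn_integral_density mult.assoc)
    also have "\<dots> \<le> (\<integral>\<^sup>+x. p x * indicator A x \<partial>L)"
      by (intro nn_integral_mono mult_right_mono mult_thinning_le densities_finite) auto
    finally show ?thesis by (simp add: emeasure_density)
  qed
  then show ?thesis by (subst le_measure) simp_all
qed

lemma thinning_loss_le:
  assumes f[measurable]: "f \<in> measurable P L" and distr_le: "distr P L f \<le> density L q"
    and [measurable]: "p \<in> borel_measurable L" "q \<in> borel_measurable L"
    and densities_finite: "\<And>x. p x < \<top>" "\<And>x. q x < \<top>"
  shows "(\<integral>\<^sup>+z. 1 - thinning (p (f z)) (q (f z)) \<partial>P) \<le> (\<integral>\<^sup>+x. q x - p x \<partial>L)"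
proof -
  have "(\<integral>\<^sup>+z. 1 - thinning (p (f z)) (q (f z)) \<partial>P) \<le> (\<integral>\<^sup>+x. 1 - thinning (p x) (q x) \<partial>density L q)"
    by (rule nn_integral_distr_le[OF f _ distr_le]) simp_all
  also have "\<dots> = (\<integral>\<^sup>+x. q x * (1 - thinning (p x) (q x)) \<partial>L)"
    by (simp add: nn_integral_density)
  also have "\<dots> \<le> (\<integral>\<^sup>+x. q x - p x \<partial>L)"
    by (intro nn_integral_mono mult_complement_thinning_le densities_finite)
  finally show ?thesis .
qed

lemma absolutely_continuous_density:
  assumes ac_MN: "absolutely_continuous M N" and same_sets: "sets N = sets M"
    and [measurable]: "u \<in> borel_measurable M" "w \<in> borel_measurable M"
    and zero: "\<And>z. u z = 0 \<Longrightarrow> w z = 0"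
  shows "absolutely_continuous (density M u) (density N w)"
  unfolding absolutely_continuous_def
proof
  have w: "w \<in> borel_measurable N" using assms(4) same_sets measurable_cong_sets by blast
  fix E assume "E \<in> null_sets (density M u)"
  then have E: "E \<in> sets M" "AE z in M. z \<in> E \<longrightarrow> u z = 0" by (simp_all add: null_sets_density_iff)
  have "AE z in N. z \<in> E \<longrightarrow> u z = 0"
    by (rule absolutely_continuous_AE[OF same_sets ac_MN E(2)])
  then have "AE z in N. z \<in> E \<longrightarrow> w z = 0"
    by eventually_elim (simp add: zero)
  then show "E \<in> null_sets (density N w)" using E(1) w by (simp add: null_sets_density_iff same_sets)
qed

lemma exists_thinned_subcoupling:
  assumes "sigma_finite_measure L1" "sigma_finite_measure L2" "sigma_finite_measure (density L2 q)"
    and p[measurable]: "p \<in> borel_measurable L1" "p' \<in> borel_measurable L1" "\<And>x. p x < \<top>" "\<And>x. p' x < \<top>"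
    and q[measurable]: "q \<in> borel_measurable L2" "q' \<in> borel_measurable L2" "\<And>y. q y < \<top>" "\<And>y. q' y < \<top>"
    and P': "subcoupling (density L1 p') (density L2 q') P'" "absolutely_continuous (L1 \<Otimes>\<^sub>M L2) P'"
    and [measurable]: "k \<in> borel_measurable (L1 \<Otimes>\<^sub>M L2)" and k_le_1: "\<And>z. k z \<le> 1"
  shows "\<exists>P. subcoupling (density L1 p) (density L2 q) P \<and> absolutely_continuous (density L1 p \<Otimes>\<^sub>M density L2 q) P \<and>
    (\<integral>\<^sup>+z. k z \<partial>P') \<le> (\<integral>\<^sup>+z. k z \<partial>P) + (\<integral>\<^sup>+x. p' x - p x \<partial>L1) + (\<integral>\<^sup>+y. q' y - q y \<partial>L2)"
proof -
  define A where "A x = thinning (p x) (p' x)" for x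
  define B where "B y = thinning (q y) (q' y)" for y
  have [measurable]: "A \<in> borel_measurable L1" "B \<in> borel_measurable L2"
    unfolding A_def B_def by measurable
  have sets_P[measurable_cong]: "sets P' = sets (L1 \<Otimes>\<^sub>M L2)"
    using P'(1) sets_pair_measure_cong[of "density L1 p'" L1 "density L2 q'" L2] by (simp add: subcoupling_def)
  have marginals_le: "distr P' L1 fst \<le> density L1 p'" "distr P' L2 snd \<le> density L2 q'"
    using P'(1) by (simp_all add: subcoupling_def cong: distr_cong)
  define P where "P = density P' (\<lambda>z. A (fst z) * B (snd z))"
  have "distr P L1 fst \<le> density L1 p"
    unfolding P_def A_def
    by (rule distr_thinned_le[OF _ marginals_le(1)]) (use p in \<open>auto simp: B_def thinning_le_1\<close>)
  moreover have "distr P L2 snd \<le> density L2 q"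
    unfolding P_def B_def mult.commute[of "A _"]
    by (rule distr_thinned_le[OF _ marginals_le(2)]) (use q in \<open>auto simp: A_def thinning_le_1\<close>)
  ultimately have "subcoupling (density L1 p) (density L2 q) P"
    by (simp add: subcoupling_def P_def sets_P cong: distr_cong sets_pair_measure_cong)
  moreover have "absolutely_continuous (density L1 p \<Otimes>\<^sub>M density L2 q) P"
    unfolding P_def pair_measure_density[OF p(1) q(1) assms(2,3)]
    by (rule absolutely_continuous_density[OF P'(2) sets_P]) (auto simp: A_def B_def thinning_eq_0)
  moreover have "(\<integral>\<^sup>+z. k z \<partial>P') \<le> (\<integral>\<^sup>+z. k z \<partial>P) + (\<integral>\<^sup>+x. p' x - p x \<partial>L1) + (\<integral>\<^sup>+y. q' y - q y \<partial>L2)"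
  proof -
    have "(\<integral>\<^sup>+z. k z \<partial>P') \<le> (\<integral>\<^sup>+z. A (fst z) * B (snd z) * k z + (1 - A (fst z)) + (1 - B (snd z)) \<partial>P')"
      by (intro nn_integral_mono le_thinned_add_complements k_le_1) (simp_all add: A_def B_def thinning_le_1)
    also have "\<dots> = (\<integral>\<^sup>+z. k z \<partial>P) + (\<integral>\<^sup>+z. 1 - A (fst z) \<partial>P') + (\<integral>\<^sup>+z. 1 - B (snd z) \<partial>P')"
      by (simp add: nn_integral_add P_def nn_integral_density)
    also have "\<dots> \<le> (\<integral>\<^sup>+z. k z \<partial>P) + (\<integral>\<^sup>+x. p' x - p x \<partial>L1) + (\<integral>\<^sup>+y. q' y - q y \<partial>L2)"
      unfolding A_def B_def by (intro add_mono order_refl thinning_loss_le marginals_le p q) simp_all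
    finally show ?thesis .
  qed
  ultimately show ?thesis by blast
qed

subsection \<open>Regularisation by independent noise\<close>

lemma nn_integral_lborel_reflect:
  fixes f :: "'a::euclidean_space \<Rightarrow> ennreal"
  assumes [measurable]: "f \<in> borel_measurable borel"
  shows "(\<integral>\<^sup>+x. f (c - x) \<partial>lborel) = (\<integral>\<^sup>+x. f x \<partial>lborel)"
  using nn_integral_distr[of "\<lambda>x. c + (-1) *\<^sub>R x" lborel borel f] lborel_affine[of "-1" c]
  by (simp add: density_1)

text \<open>The density of \<open>w X - \<xi>\<close> for independent \<open>X\<close> of law \<open>M\<close> and \<open>\<xi>\<close> of density \<open>\<rho>\<close>.\<close>

definition mollified :: "('a \<Rightarrow> ennreal) \<Rightarrow> 'b measure \<Rightarrow> ('b \<Rightarrow> 'a) \<Rightarrow> 'a::ab_group_add \<Rightarrow> ennreal" where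
  "mollified \<rho> M w x = (\<integral>\<^sup>+X. \<rho> (w X - x) \<partial>M)"

lemma mollified_measurable [measurable]:
  fixes \<rho> :: "'a::euclidean_space \<Rightarrow> ennreal"
  assumes "sigma_finite_measure M" and [measurable]: "\<rho> \<in> borel_measurable borel" "w \<in> borel_measurable M"
  shows "mollified \<rho> M w \<in> borel_measurable borel"
proof -
  interpret sigma_finite_measure M by fact
  show ?thesis unfolding mollified_def by measurable
qed

lemma mollified_less_top:
  assumes "prob_space M" and "\<And>x. \<rho> x \<le> ennreal C"
  shows "mollified \<rho> M w x < \<top>"
proof -
  interpret prob_space M by fact
  have "mollified \<rho> M w x \<le> (\<integral>\<^sup>+X. ennreal C \<partial>M)"
    unfolding mollified_def by (intro nn_integral_mono assms(2))
  then show ?thesis by (simp add: emeasure_space_1 order.strict_trans1[OF _ ennreal_less_top])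
qed

lemma distr_subtract_noise:
  fixes w :: "'b \<Rightarrow> 'a::euclidean_space"
  assumes "prob_space M" and w[measurable]: "w \<in> borel_measurable M" and \<rho>[measurable]: "\<rho> \<in> borel_measurable borel"
    and "prob_space (density lborel \<rho>)"
  shows "distr (M \<Otimes>\<^sub>M density lborel \<rho>) borel (\<lambda>z. w (fst z) - snd z) = density lborel (mollified \<rho> M w)"
proof (rule measure_eqI)
  interpret M: prob_space M by fact
  interpret K: prob_space "density lborel \<rho>" by fact
  interpret pair_sigma_finite M "lborel :: 'a measure" ..
  note [measurable] = mollified_measurable[OF M.sigma_finite_measure_axioms \<rho> w]
  fix A assume "A \<in> sets (distr (M \<Otimes>\<^sub>M density lborel \<rho>) borel (\<lambda>z. w (fst z) - snd z))"
  then have A[measurable]: "A \<in> sets borel" by simp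
  have "emeasure (distr (M \<Otimes>\<^sub>M density lborel \<rho>) borel (\<lambda>z. w (fst z) - snd z)) A =
      (\<integral>\<^sup>+z. indicator A (w (fst z) - snd z) \<partial>(M \<Otimes>\<^sub>M density lborel \<rho>))"
    using nn_integral_distr[of "\<lambda>z. w (fst z) - snd z" "M \<Otimes>\<^sub>M density lborel \<rho>" borel "indicator A"] by simp
  also have "\<dots> = (\<integral>\<^sup>+X. \<integral>\<^sup>+\<xi>. indicator A (w X - \<xi>) \<partial>density lborel \<rho> \<partial>M)"
    by (subst K.nn_integral_fst[symmetric]) simp_all
  also have "\<dots> = (\<integral>\<^sup>+X. \<integral>\<^sup>+x. \<rho> (w X - x) * indicator A x \<partial>lborel \<partial>M)"
  proof (rule nn_integral_cong)
    fix X
    show "(\<integral>\<^sup>+\<xi>. indicator A (w X - \<xi>) \<partial>density lborel \<rho>) = (\<integral>\<^sup>+x. \<rho> (w X - x) * indicator A x \<partial>lborel)"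
      using nn_integral_lborel_reflect[of "\<lambda>\<xi>. \<rho> \<xi> * indicator A (w X - \<xi>)" "w X"]
      by (simp add: nn_integral_density)
  qed
  also have "\<dots> = (\<integral>\<^sup>+x. \<integral>\<^sup>+X. \<rho> (w X - x) * indicator A x \<partial>M \<partial>lborel)"
    by (rule Fubini'[symmetric]) measurable
  also have "\<dots> = emeasure (density lborel (mollified \<rho> M w)) A"
    by (simp add: emeasure_density mollified_def nn_integral_multc)
  finally show "emeasure (distr (M \<Otimes>\<^sub>M density lborel \<rho>) borel (\<lambda>z. w (fst z) - snd z)) A =
    emeasure (density lborel (mollified \<rho> M w)) A" .
qed simp

lemma distr_pair_rotate:
  assumes "prob_space L" "prob_space M" "prob_space N"
  shows "distr ((L \<Otimes>\<^sub>M M) \<Otimes>\<^sub>M N) ((L \<Otimes>\<^sub>M N) \<Otimes>\<^sub>M M) (\<lambda>u. ((fst (fst u), snd u), snd (fst u))) = (L \<Otimes>\<^sub>M N) \<Otimes>\<^sub>M M"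
proof (rule measure_eqI)
  interpret L: prob_space L by fact
  interpret M: prob_space M by fact
  interpret N: prob_space N by fact
  interpret MN: pair_sigma_finite M N ..
  let ?rot = "\<lambda>u. ((fst (fst u), snd u), snd (fst u))"
  fix A assume "A \<in> sets (distr ((L \<Otimes>\<^sub>M M) \<Otimes>\<^sub>M N) ((L \<Otimes>\<^sub>M N) \<Otimes>\<^sub>M M) ?rot)"
  then have [measurable]: "A \<in> sets ((L \<Otimes>\<^sub>M N) \<Otimes>\<^sub>M M)" by simp
  have "emeasure (distr ((L \<Otimes>\<^sub>M M) \<Otimes>\<^sub>M N) ((L \<Otimes>\<^sub>M N) \<Otimes>\<^sub>M M) ?rot) A =
      (\<integral>\<^sup>+u. indicator A (?rot u) \<partial>((L \<Otimes>\<^sub>M M) \<Otimes>\<^sub>M N))"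
    using nn_integral_distr[of ?rot "(L \<Otimes>\<^sub>M M) \<Otimes>\<^sub>M N" "(L \<Otimes>\<^sub>M N) \<Otimes>\<^sub>M M" "indicator A"] by simp
  also have "\<dots> = (\<integral>\<^sup>+x. \<integral>\<^sup>+y. \<integral>\<^sup>+z. indicator A ((x, z), y) \<partial>N \<partial>M \<partial>L)"
    by (subst N.nn_integral_fst[symmetric], measurable, subst M.nn_integral_fst[symmetric]) simp_all
  also have "\<dots> = (\<integral>\<^sup>+x. \<integral>\<^sup>+z. \<integral>\<^sup>+y. indicator A ((x, z), y) \<partial>M \<partial>N \<partial>L)"
    by (intro nn_integral_cong MN.Fubini'[symmetric]) measurable
  also have "\<dots> = emeasure ((L \<Otimes>\<^sub>M N) \<Otimes>\<^sub>M M) A"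
    by (subst M.emeasure_pair_measure) (simp_all add: N.nn_integral_fst[symmetric])
  finally show "emeasure (distr ((L \<Otimes>\<^sub>M M) \<Otimes>\<^sub>M N) ((L \<Otimes>\<^sub>M N) \<Otimes>\<^sub>M M) ?rot) A = emeasure ((L \<Otimes>\<^sub>M N) \<Otimes>\<^sub>M M) A" .
qed simp

text \<open>A point \<open>X\<close> of law \<open>M\<close> is observed as \<open>X - \<xi>\<close>, and as \<open>X + v l X - \<xi>\<close> after a random step \<open>v l\<close>,
  \<open>l\<close> of law \<open>U\<close>.\<close>

locale noisy_step = M: prob_space M + U: prob_space U
  for M :: "'a::euclidean_space measure" and U :: "'l measure" +
  fixes \<rho> :: "'a \<Rightarrow> ennreal" and v :: "'l \<Rightarrow> 'a \<Rightarrow> 'a" and C :: real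
  assumes sets_M [measurable_cong]: "sets M = sets borel"
    and density_measurable [measurable]: "\<rho> \<in> borel_measurable borel"
    and density_integral: "(\<integral>\<^sup>+x. \<rho> x \<partial>lborel) = 1"
    and density_le: "\<And>x. \<rho> x \<le> ennreal C"
    and step_measurable [measurable]: "(\<lambda>z. v (snd z) (fst z)) \<in> borel_measurable (borel \<Otimes>\<^sub>M U)"
begin

definition joint :: "('a \<times> 'a) measure" where
  "joint = M \<Otimes>\<^sub>M density lborel \<rho>"

definition start :: "'a \<times> 'a \<Rightarrow> 'a" where
  "start z = fst z - snd z"

definition moved :: "'l \<Rightarrow> 'a \<times> 'a \<Rightarrow> 'a" where
  "moved l z = fst z + v l (fst z) - snd z"

definition start_density :: "'a \<Rightarrow> ennreal" where
  "start_density = mollified \<rho> M (\<lambda>X. X)"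

definition moved_density :: "'a \<Rightarrow> ennreal" where
  "moved_density = mollified \<rho> (M \<Otimes>\<^sub>M U) (\<lambda>z. fst z + v (snd z) (fst z))"

sublocale K: prob_space "density lborel \<rho>"
  by (rule prob_spaceI) (simp add: emeasure_density density_integral)

sublocale MU: pair_prob_space M U ..

sublocale J: pair_prob_space M "density lborel \<rho>" ..

sublocale joint: prob_space joint
  unfolding joint_def by (rule J.prob_space_axioms)

lemma sets_joint [measurable_cong]: "sets joint = sets (borel \<Otimes>\<^sub>M borel)"
  unfolding joint_def by (intro sets_pair_measure_cong) (simp_all add: sets_M)

lemma start_measurable [measurable]: "start \<in> borel_measurable joint"
  unfolding start_def[abs_def] by measurable

lemma step_measurable_compose [measurable (raw)]:
  assumes "f \<in> borel_measurable L" "g \<in> measurable L U"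
  shows "(\<lambda>x. v (g x) (f x)) \<in> borel_measurable L"
  using measurable_compose[OF measurable_Pair[OF assms] step_measurable] by simp

lemma moved_measurable2 [measurable]: "(\<lambda>u. moved (snd u) (fst u)) \<in> borel_measurable (joint \<Otimes>\<^sub>M U)"
  unfolding moved_def by measurable

lemma moved_measurable:
  assumes "l \<in> space U"
  shows "moved l \<in> borel_measurable joint"
proof -
  have [measurable]: "(\<lambda>_. l) \<in> measurable joint U" using assms by simp
  show ?thesis unfolding moved_def[abs_def] by measurable
qed

lemma start_density_measurable [measurable]: "start_density \<in> borel_measurable borel"
  unfolding start_density_def by (rule mollified_measurable[OF M.sigma_finite_measure_axioms]) measurable

lemma moved_density_measurable [measurable]: "moved_density \<in> borel_measurable borel"
  unfolding moved_density_def by (rule mollified_measurable[OF MU.sigma_finite_measure_axioms]) measurable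

lemma start_density_less_top: "start_density x < \<top>"
  unfolding start_density_def by (rule mollified_less_top[OF M.prob_space_axioms density_le])

lemma moved_density_less_top: "moved_density x < \<top>"
  unfolding moved_density_def by (rule mollified_less_top[OF MU.prob_space_axioms density_le])

lemma distr_start: "distr joint borel start = density lborel start_density"
  unfolding joint_def start_def[abs_def] start_density_def
  by (rule distr_subtract_noise[OF M.prob_space_axioms _ _ K.prob_space_axioms]) measurable

lemma moved_slice_density_measurable:
  assumes "l \<in> space U"
  shows "mollified \<rho> M (\<lambda>X. X + v l X) \<in> borel_measurable borel"
proof (rule mollified_measurable[OF M.sigma_finite_measure_axioms density_measurable])
  have [measurable]: "(\<lambda>_. l) \<in> measurable M U" using assms by simp
  show "(\<lambda>X. X + v l X) \<in> borel_measurable M" by measurable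
qed

lemma distr_moved:
  assumes "l \<in> space U"
  shows "distr joint borel (moved l) = density lborel (mollified \<rho> M (\<lambda>X. X + v l X))"
proof -
  have [measurable]: "(\<lambda>_. l) \<in> measurable M U" using assms by simp
  show ?thesis
    unfolding joint_def moved_def[abs_def]
    by (rule distr_subtract_noise[OF M.prob_space_axioms _ _ K.prob_space_axioms]) measurable
qed

lemma distr_moved_average:
  "distr (joint \<Otimes>\<^sub>M U) borel (\<lambda>u. moved (snd u) (fst u)) = density lborel moved_density"
proof -
  let ?shift = "\<lambda>z. fst z + v (snd z) (fst z)"
  have "distr (joint \<Otimes>\<^sub>M U) borel (\<lambda>u. moved (snd u) (fst u)) =
      distr (distr (joint \<Otimes>\<^sub>M U) ((M \<Otimes>\<^sub>M U) \<Otimes>\<^sub>M density lborel \<rho>) (\<lambda>u. ((fst (fst u), snd u), snd (fst u))))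
        borel (\<lambda>z. ?shift (fst z) - snd z)"
    unfolding joint_def by (subst distr_distr) (simp_all add: moved_def comp_def)
  also have "\<dots> = density lborel moved_density"
    unfolding joint_def moved_density_def
      distr_pair_rotate[OF M.prob_space_axioms K.prob_space_axioms U.prob_space_axioms]
    by (rule distr_subtract_noise[OF MU.prob_space_axioms _ _ K.prob_space_axioms]) measurable
  finally show ?thesis .
qed

lemma distr_joint_fst: "distr joint M fst = M"
  unfolding joint_def by (rule K.distr_pair_fst)

lemma AE_joint_noise:
  assumes zero: "\<And>\<xi>. norm \<xi> > \<epsilon> \<Longrightarrow> \<rho> \<xi> = 0"
  shows "AE z in joint. norm (snd z) \<le> \<epsilon>"
  unfolding joint_def
proof (rule J.AE_pair_measure)
  have "AE \<xi> in density lborel \<rho>. norm \<xi> \<le> \<epsilon>"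
    using zero by (auto simp: AE_density not_le[symmetric])
  then show "AE x in M. AE y in density lborel \<rho>. norm (snd (x, y)) \<le> \<epsilon>" by simp
qed measurable

end

lemma distr_pair_marginal:
  assumes "prob_space U" "f \<in> measurable P M" "distr P M f = M"
  shows "distr (P \<Otimes>\<^sub>M U) (M \<Otimes>\<^sub>M U) (\<lambda>u. (f (fst u), snd u)) = M \<Otimes>\<^sub>M U"
proof -
  interpret prob_space U by fact
  have "distr P M f \<Otimes>\<^sub>M distr U U (\<lambda>l. l) = distr (P \<Otimes>\<^sub>M U) (M \<Otimes>\<^sub>M U) (\<lambda>(x, l). (f x, l))"
    using assms(2) by (intro pair_measure_distr) (simp_all add: sigma_finite_measure_axioms)
  then show ?thesis by (simp add: assms(3) case_prod_beta')
qed

locale noisy_step_pair = A: noisy_step M U \<rho> v C + B: noisy_step N U \<rho> v C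
  for M N :: "'a::euclidean_space measure" and U :: "'l measure" and \<rho> v C
begin

definition moved_pair :: "(('a \<times> 'a) \<times> ('a \<times> 'a)) \<times> 'l \<Rightarrow> 'a \<times> 'a" where
  "moved_pair u = (A.moved (snd u) (fst (fst u)), B.moved (snd u) (snd (fst u)))"

lemma moved_pair_measurable:
  assumes "sets \<Lambda> = sets (A.joint \<Otimes>\<^sub>M B.joint)"
  shows "moved_pair \<in> measurable (\<Lambda> \<Otimes>\<^sub>M U) (borel \<Otimes>\<^sub>M borel)"
proof -
  note [measurable_cong] = assms
  show ?thesis
    unfolding moved_pair_def[abs_def] A.moved_def B.moved_def by measurable
qed

lemma coupling_moved:
  assumes \<Lambda>: "coupling A.joint B.joint \<Lambda>"
  shows "coupling (density lborel A.moved_density) (density lborel B.moved_density)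
    (distr (\<Lambda> \<Otimes>\<^sub>M U) (borel \<Otimes>\<^sub>M borel) moved_pair)"
proof -
  note \<Lambda>D = couplingD[OF \<Lambda>] and m = moved_pair_measurable[OF couplingD(5)[OF \<Lambda>]]
  let ?move = "\<lambda>u. A.moved (snd u) (fst u)"
  have "distr (distr (\<Lambda> \<Otimes>\<^sub>M U) (borel \<Otimes>\<^sub>M borel) moved_pair) borel fst =
      distr (distr (\<Lambda> \<Otimes>\<^sub>M U) (A.joint \<Otimes>\<^sub>M U) (\<lambda>u. (fst (fst u), snd u))) borel ?move"
    using \<Lambda>D m by (subst (1 2) distr_distr) (simp_all add: comp_def moved_pair_def)
  then have "distr (distr (\<Lambda> \<Otimes>\<^sub>M U) (borel \<Otimes>\<^sub>M borel) moved_pair) borel fst = density lborel A.moved_density"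
    using \<Lambda>D A.U.prob_space_axioms by (simp add: distr_pair_marginal A.distr_moved_average)
  moreover have "distr (distr (\<Lambda> \<Otimes>\<^sub>M U) (borel \<Otimes>\<^sub>M borel) moved_pair) borel snd =
      distr (distr (\<Lambda> \<Otimes>\<^sub>M U) (B.joint \<Otimes>\<^sub>M U) (\<lambda>u. (snd (fst u), snd u))) borel ?move"
    using \<Lambda>D m by (subst (1 2) distr_distr) (simp_all add: comp_def moved_pair_def)
  then have "distr (distr (\<Lambda> \<Otimes>\<^sub>M U) (borel \<Otimes>\<^sub>M borel) moved_pair) borel snd = density lborel B.moved_density"
    using \<Lambda>D A.U.prob_space_axioms by (simp add: distr_pair_marginal B.distr_moved_average)
  ultimately show ?thesis
    by (simp add: coupling_def cong: distr_cong sets_pair_measure_cong)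
qed

lemma absolutely_continuous_distr_moved_pair_slice:
  assumes \<Lambda>: "coupling A.joint B.joint \<Lambda>" "absolutely_continuous (A.joint \<Otimes>\<^sub>M B.joint) \<Lambda>" and l: "l \<in> space U"
  shows "absolutely_continuous (lborel \<Otimes>\<^sub>M lborel) (distr \<Lambda> (borel \<Otimes>\<^sub>M borel) (\<lambda>z. moved_pair (z, l)))"
proof -
  let ?a = "mollified \<rho> M (\<lambda>X. X + v l X)" and ?b = "mollified \<rho> N (\<lambda>X. X + v l X)"
  note [measurable] = A.moved_measurable[OF l] B.moved_measurable[OF l]
    A.moved_slice_density_measurable[OF l] B.moved_slice_density_measurable[OF l]
  have sigma_finite: "sigma_finite_measure (density lborel ?b)"
    unfolding B.distr_moved[OF l, symmetric]
    by (intro prob_space_imp_sigma_finite B.joint.prob_space_distr B.moved_measurable[OF l])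
  have "distr (A.joint \<Otimes>\<^sub>M B.joint) (borel \<Otimes>\<^sub>M borel) (\<lambda>z. moved_pair (z, l)) =
      density lborel ?a \<Otimes>\<^sub>M density lborel ?b"
    using pair_measure_distr[of "A.moved l" A.joint borel "B.moved l" B.joint borel] sigma_finite
    by (simp add: A.distr_moved[OF l] B.distr_moved[OF l] moved_pair_def case_prod_beta')
  also have "\<dots> = density (lborel \<Otimes>\<^sub>M lborel) (\<lambda>(x, y). ?a x * ?b y)"
    by (rule pair_measure_density) (simp_all add: sigma_finite lborel.sigma_finite_measure_axioms)
  finally have "absolutely_continuous (lborel \<Otimes>\<^sub>M lborel)
      (distr (A.joint \<Otimes>\<^sub>M B.joint) (borel \<Otimes>\<^sub>M borel) (\<lambda>z. moved_pair (z, l)))"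
    by (simp add: absolutely_continuousI_density)
  moreover have "absolutely_continuous (distr (A.joint \<Otimes>\<^sub>M B.joint) (borel \<Otimes>\<^sub>M borel) (\<lambda>z. moved_pair (z, l)))
      (distr \<Lambda> (borel \<Otimes>\<^sub>M borel) (\<lambda>z. moved_pair (z, l)))"
    by (rule absolutely_continuous_distr[OF \<Lambda>(2) couplingD(5)[OF \<Lambda>(1)]]) (simp add: moved_pair_def)
  ultimately show ?thesis by (auto simp: absolutely_continuous_def)
qed

lemma absolutely_continuous_distr_moved_pair:
  assumes \<Lambda>: "coupling A.joint B.joint \<Lambda>" "absolutely_continuous (A.joint \<Otimes>\<^sub>M B.joint) \<Lambda>"
  shows "absolutely_continuous (lborel \<Otimes>\<^sub>M lborel) (distr (\<Lambda> \<Otimes>\<^sub>M U) (borel \<Otimes>\<^sub>M borel) moved_pair)"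
  unfolding absolutely_continuous_def
proof
  note [measurable] = moved_pair_measurable[OF couplingD(5)[OF \<Lambda>(1)]]
  interpret \<Lambda>: prob_space \<Lambda> by (rule coupling_imp_prob_space[OF \<Lambda>(1) A.joint.prob_space_axioms])
  interpret \<Lambda>U: pair_prob_space \<Lambda> U ..
  have sets_lborel_pair: "sets (lborel \<Otimes>\<^sub>M lborel) = sets (borel \<Otimes>\<^sub>M borel :: ('a \<times> 'a) measure)"
    by (intro sets_pair_measure_cong) simp_all
  fix E :: "('a \<times> 'a) set"
  assume E: "E \<in> null_sets (lborel \<Otimes>\<^sub>M lborel)"
  then have [measurable]: "E \<in> sets (borel \<Otimes>\<^sub>M borel)" using sets_lborel_pair by auto
  have slice: "(\<integral>\<^sup>+z. indicator E (moved_pair (z, l)) \<partial>\<Lambda>) = 0" if l: "l \<in> space U" for l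
  proof -
    have "(\<lambda>z. moved_pair (z, l)) \<in> measurable \<Lambda> (borel \<Otimes>\<^sub>M borel)"
      using measurable_compose[OF measurable_Pair2'[OF l]] moved_pair_measurable[OF couplingD(5)[OF \<Lambda>(1)]]
      by blast
    moreover have "emeasure (distr \<Lambda> (borel \<Otimes>\<^sub>M borel) (\<lambda>z. moved_pair (z, l))) E = 0"
      using absolutely_continuous_distr_moved_pair_slice[OF \<Lambda> l] E by (auto simp: absolutely_continuous_def)
    ultimately show ?thesis
      using nn_integral_distr[of "\<lambda>z. moved_pair (z, l)" \<Lambda> "borel \<Otimes>\<^sub>M borel" "indicator E"] by simp
  qed
  have "emeasure (distr (\<Lambda> \<Otimes>\<^sub>M U) (borel \<Otimes>\<^sub>M borel) moved_pair) E =
      (\<integral>\<^sup>+u. indicator E (moved_pair u) \<partial>(\<Lambda> \<Otimes>\<^sub>M U))"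
    using nn_integral_distr[of moved_pair "\<Lambda> \<Otimes>\<^sub>M U" "borel \<Otimes>\<^sub>M borel" "indicator E"] by simp
  also have "\<dots> = (\<integral>\<^sup>+l. \<integral>\<^sup>+z. indicator E (moved_pair (z, l)) \<partial>\<Lambda> \<partial>U)"
    by (subst \<Lambda>U.nn_integral_snd[symmetric]) simp_all
  also have "\<dots> = (\<integral>\<^sup>+l. 0 \<partial>U)" by (intro nn_integral_cong slice)
  finally show "E \<in> null_sets (distr (\<Lambda> \<Otimes>\<^sub>M U) (borel \<Otimes>\<^sub>M borel) moved_pair)" by auto
qed

lemma exists_almost_stationary_coupling:
  assumes k[measurable]: "k \<in> borel_measurable (borel \<Otimes>\<^sub>M borel)" and k_le_1: "\<And>z. k z \<le> 1" and e: "e > 0"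
  shows "\<exists>\<Lambda>. coupling A.joint B.joint \<Lambda> \<and>
    (\<integral>\<^sup>+z. \<integral>\<^sup>+l. k (moved_pair (z, l)) \<partial>U \<partial>\<Lambda>) \<le>
      (\<integral>\<^sup>+z. k (A.start (fst z), B.start (snd z)) \<partial>\<Lambda>) + ennreal e
      + (\<integral>\<^sup>+x. A.moved_density x - A.start_density x \<partial>lborel)
      + (\<integral>\<^sup>+x. B.moved_density x - B.start_density x \<partial>lborel)"
proof -
  let ?P = "density lborel A.start_density" and ?Q = "density lborel B.start_density"
  interpret PQ: pair_prob_space ?P ?Q
    unfolding A.distr_start[symmetric] B.distr_start[symmetric] pair_prob_space_def pair_sigma_finite_def
    by (simp add: A.joint.prob_space_distr B.joint.prob_space_distr prob_space_imp_sigma_finite)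
  have sets_PQ: "sets (?P \<Otimes>\<^sub>M ?Q) = sets (borel \<Otimes>\<^sub>M borel)"
    and sets_lborel_pair: "sets (lborel \<Otimes>\<^sub>M lborel) = sets (borel \<Otimes>\<^sub>M borel :: ('a \<times> 'a) measure)"
    by (intro sets_pair_measure_cong; simp)+
  have k_measurable_PQ: "k \<in> borel_measurable (?P \<Otimes>\<^sub>M ?Q)"
    and k_measurable_lborel: "k \<in> borel_measurable (lborel \<Otimes>\<^sub>M lborel)"
    using k by (simp_all add: sets_PQ sets_lborel_pair cong: measurable_cong_sets)
  obtain P where P: "coupling ?P ?Q P" "absolutely_continuous (?P \<Otimes>\<^sub>M ?Q) P"
    and opt: "\<And>P'. subcoupling ?P ?Q P' \<Longrightarrow> absolutely_continuous (?P \<Otimes>\<^sub>M ?Q) P' \<Longrightarrow>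
      (\<integral>\<^sup>+z. k z \<partial>P') \<le> (\<integral>\<^sup>+z. k z \<partial>P) + ennreal e"
    using PQ.exists_almost_optimal_coupling[OF k_measurable_PQ k_le_1 e] by blast
  obtain \<Lambda> where \<Lambda>: "coupling A.joint B.joint \<Lambda>" "absolutely_continuous (A.joint \<Otimes>\<^sub>M B.joint) \<Lambda>"
    and P_eq: "distr \<Lambda> (borel \<Otimes>\<^sub>M borel) (map_prod A.start B.start) = P"
    using coupling_lift[OF A.joint.prob_space_axioms B.joint.prob_space_axioms A.start_measurable B.start_measurable] P
    unfolding A.distr_start B.distr_start by blast
  let ?moved = "distr (\<Lambda> \<Otimes>\<^sub>M U) (borel \<Otimes>\<^sub>M borel) moved_pair"
  obtain P' where P': "subcoupling ?P ?Q P'" "absolutely_continuous (?P \<Otimes>\<^sub>M ?Q) P'"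
    and gain: "(\<integral>\<^sup>+z. k z \<partial>?moved) \<le> (\<integral>\<^sup>+z. k z \<partial>P')
      + (\<integral>\<^sup>+x. A.moved_density x - A.start_density x \<partial>lborel) + (\<integral>\<^sup>+x. B.moved_density x - B.start_density x \<partial>lborel)"
    using exists_thinned_subcoupling[OF lborel.sigma_finite_measure_axioms lborel.sigma_finite_measure_axioms
        PQ.M2.sigma_finite_measure_axioms, of A.start_density A.moved_density B.moved_density,
        OF _ _ A.start_density_less_top A.moved_density_less_top
        _ _ B.start_density_less_top B.moved_density_less_top coupling_imp_subcoupling[OF coupling_moved[OF \<Lambda>(1)]]
        absolutely_continuous_distr_moved_pair[OF \<Lambda>] k_measurable_lborel k_le_1]
    by auto
  note [measurable] = moved_pair_measurable[OF couplingD(5)[OF \<Lambda>(1)]] and [measurable_cong] = couplingD(5)[OF \<Lambda>(1)]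
  have "(\<integral>\<^sup>+z. \<integral>\<^sup>+l. k (moved_pair (z, l)) \<partial>U \<partial>\<Lambda>) = (\<integral>\<^sup>+z. k z \<partial>?moved)"
    by (simp add: nn_integral_distr A.U.nn_integral_fst[symmetric])
  moreover have "(\<integral>\<^sup>+z. k z \<partial>P) = (\<integral>\<^sup>+z. k (A.start (fst z), B.start (snd z)) \<partial>\<Lambda>)"
  proof -
    have "map_prod A.start B.start \<in> measurable \<Lambda> (borel \<Otimes>\<^sub>M borel)" by (simp add: map_prod_def split_beta)
    then show ?thesis unfolding P_eq[symmetric] by (simp add: nn_integral_distr map_prod_def split_beta)
  qed
  ultimately show ?thesis
    using gain order_trans[OF _ add_right_mono[OF add_right_mono[OF opt[OF P']]]] \<Lambda>(1) by auto
qed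

end

subsection \<open>Couplings close to the diagonal\<close>

text \<open>Inner regularity of the image measure on the graph replaces Lusin's theorem: \<open>F\<close> is continuous on the
  projection of \<open>K\<close>.\<close>

lemma Lusin_graph:
  fixes F :: "'a::polish_space \<Rightarrow> 'b::polish_space"
  assumes M: "sets M = sets borel" "prob_space M" and F[measurable]: "F \<in> borel_measurable borel"
    and e: "e > 0"
  shows "\<exists>K. compact K \<and> (\<forall>z\<in>K. snd z = F (fst z)) \<and> measure M {x. (x, F x) \<notin> K} \<le> e"
proof -
  interpret prob_space M by fact
  note [measurable_cong] = M(1)
  have space_M: "space M = UNIV" using sets_eq_imp_space_eq[OF M(1)] by simp
  let ?G = "{z. snd z = F (fst z)} :: ('a \<times> 'b) set" and ?N = "distr M borel (\<lambda>x. (x, F x))"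
  have graph_measurable: "(\<lambda>x. (x, F x)) \<in> measurable M borel" by measurable
  interpret N: prob_space ?N by (rule prob_space_distr[OF graph_measurable])
  have "?G = {z \<in> space (borel \<Otimes>\<^sub>M borel). dist (snd z) (F (fst z)) \<le> 0}" by (auto simp: space_pair_measure)
  also have "\<dots> \<in> sets (borel \<Otimes>\<^sub>M borel)" by measurable
  finally have G: "?G \<in> sets borel" unfolding borel_prod .
  have "emeasure ?N ?G = emeasure M (space M)"
    using G by (subst emeasure_distr[OF graph_measurable]) (auto simp: space_M)
  then have "1 = (SUP K \<in> {K. K \<subseteq> ?G \<and> compact K}. emeasure ?N K)"
    using inner_regular[OF _ _ G, of ?N] by (simp add: N.emeasure_eq_measure emeasure_space_1)
  moreover have "ennreal (1 - e) < 1" using e ennreal_less_iff[of "1 - e" 1]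
    by (cases "e \<le> 1") (auto simp: ennreal_neg)
  ultimately have "\<exists>K\<in>{K. K \<subseteq> ?G \<and> compact K}. ennreal (1 - e) < emeasure ?N K"
    by (metis (no_types, lifting) less_SUP_iff)
  then obtain K where K: "K \<subseteq> ?G" "compact K" "ennreal (1 - e) < emeasure ?N K" by blast
  have [measurable]: "K \<in> sets borel" using K(2) by (simp add: compact_imp_closed)
  have "measure ?N K = measure M {x \<in> space M. (x, F x) \<in> K}"
    by (subst measure_distr[OF graph_measurable]) (auto intro!: arg_cong[where f="measure M"])
  then have "1 - e < measure M {x \<in> space M. (x, F x) \<in> K}"
    using K(3) unfolding N.emeasure_eq_measure by (metis ennreal_leI not_le)
  moreover have "measure M {x. (x, F x) \<notin> K} = 1 - measure M {x \<in> space M. (x, F x) \<in> K}"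
    using prob_neg[of "\<lambda>x. (x, F x) \<in> K"] by (simp add: space_M)
  ultimately show ?thesis using K by (intro exI[of _ K]) auto
qed

lemma measure_coupling_fst: "coupling M N P \<Longrightarrow> A \<in> sets M \<Longrightarrow> measure P (fst -` A \<inter> space P) = measure M A"
  using measure_distr[of fst P M A] couplingD[of M N P] by simp

lemma measure_coupling_snd: "coupling M N P \<Longrightarrow> B \<in> sets N \<Longrightarrow> measure P (snd -` B \<inter> space P) = measure N B"
  using measure_distr[of snd P N B] couplingD[of M N P] by simp

lemma measure_coupling_Un_le:
  assumes P: "coupling M N P" "prob_space M" and A: "A \<in> sets M" and B: "B \<in> sets N" and E: "E \<in> sets P"
    and covered: "D \<subseteq> (fst -` A \<inter> space P) \<union> (snd -` B \<inter> space P) \<union> E"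
  shows "measure P D \<le> measure M A + measure N B + measure P E"
proof -
  interpret P: prob_space P by (rule coupling_imp_prob_space[OF P])
  note bad_sets = measurable_sets[OF couplingD(1)[OF P(1)] A] measurable_sets[OF couplingD(2)[OF P(1)] B]
  have "measure P D \<le> measure P ((fst -` A \<inter> space P) \<union> (snd -` B \<inter> space P) \<union> E)"
    using bad_sets E by (intro P.finite_measure_mono[OF covered]) auto
  also have "\<dots> \<le> measure P (fst -` A \<inter> space P) + measure P (snd -` B \<inter> space P) + measure P E"
    using measure_Un_le[OF sets.Un[OF bad_sets] E] measure_Un_le[OF bad_sets] by linarith
  finally show ?thesis
    by (simp add: measure_coupling_fst[OF P(1) A] measure_coupling_snd[OF P(1) B])
qed

lemma sets_coupling_borel:
  fixes M :: "'a::second_countable_topology measure" and N :: "'b::second_countable_topology measure"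
  assumes "coupling M N P" "sets M = sets borel" "sets N = sets borel"
  shows "sets P = sets borel"
  using couplingD(5)[OF assms(1)] sets_pair_measure_cong[OF assms(2,3)] unfolding borel_prod by simp

lemma measure_le_thickening_if_coupling:
  fixes M N :: "'a::polish_space measure"
  assumes P: "coupling M N P" and M: "sets M = sets borel" "prob_space M" and N: "sets N = sets borel"
    and C: "closed C"
  shows "measure M C \<le> measure N {x. infdist x C \<le> \<eta>} + measure P {z. dist (fst z) (snd z) \<ge> \<eta>}"
proof -
  have sets: "sets P = sets borel" by (rule sets_coupling_borel[OF P M(1) N])
  have "C \<in> sets M" using C by (simp add: M(1))
  then have "measure M C = measure P (fst -` C \<inter> space P)"
    by (rule measure_coupling_fst[OF P, symmetric])
  also have "\<dots> \<le> measure M {} + measure N {x. infdist x C \<le> \<eta>} + measure P {z. dist (fst z) (snd z) \<ge> \<eta>}"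
  proof (rule measure_coupling_Un_le[OF P M(2)])
    show "{x. infdist x C \<le> \<eta>} \<in> sets N"
      unfolding N by (intro borel_closed closed_Collect_le continuous_intros)
    show "{z. dist (fst z) (snd z) \<ge> \<eta>} \<in> sets P"
      unfolding sets by (intro borel_closed closed_Collect_le continuous_intros)
    show "fst -` C \<inter> space P \<subseteq> (fst -` {} \<inter> space P) \<union> (snd -` {x. infdist x C \<le> \<eta>} \<inter> space P)
        \<union> {z. dist (fst z) (snd z) \<ge> \<eta>}"
    proof clarsimp
      fix x y assume "x \<in> C" "\<not> \<eta> \<le> dist x y"
      then show "infdist y C \<le> \<eta>" using infdist_le[of x C y] by (simp add: dist_commute)
    qed
  qed simp
  finally show ?thesis by simp
qed

lemma tendsto_measure_thickening:
  fixes C :: "'a::polish_space set"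
  assumes N: "sets N = sets borel" "prob_space N" and C: "closed C" "C \<noteq> {}"
  shows "(\<lambda>n. measure N {x. infdist x C \<le> 1 / real (Suc n)}) \<longlonglongrightarrow> measure N C"
proof -
  interpret N: prob_space N by fact
  let ?A = "\<lambda>n. {x. infdist x C \<le> 1 / real (Suc n)}"
  have "(\<Inter>n. ?A n) = C"
  proof (intro equalityI subsetI)
    fix x assume "x \<in> (\<Inter>n. ?A n)"
    then have "infdist x C \<le> 0"
      by (intro LIMSEQ_le_const[OF LIMSEQ_Suc[OF lim_1_over_n]]) auto
    then have "infdist x C = 0" using infdist_nonneg[of x C] by linarith
    then show "x \<in> C" using in_closed_iff_infdist_zero[OF C] by blast
  qed auto
  moreover have "(\<lambda>n. measure N (?A n)) \<longlonglongrightarrow> measure N (\<Inter>n. ?A n)"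
  proof (rule N.finite_Lim_measure_decseq)
    have "?A n \<in> sets borel" for n
      by (intro borel_closed closed_Collect_le continuous_intros)
    then show "range ?A \<subseteq> sets N" by (auto simp: N(1))
    have "?A n \<subseteq> ?A m" if "m \<le> n" for m n
      using frac_le[of 1 1 "real (Suc m)" "real (Suc n)"] that by auto
    then show "decseq ?A" by (auto simp: decseq_def)
  qed
  ultimately show ?thesis by simp
qed

lemma eq_if_couplings_near_diagonal:
  fixes M N :: "'a::polish_space measure"
  assumes M: "sets M = sets borel" "prob_space M" and N: "sets N = sets borel" "prob_space N"
    and near: "\<And>\<eta>. \<eta> > 0 \<Longrightarrow> \<exists>P. coupling M N P \<and> measure P {z. dist (fst z) (snd z) \<ge> \<eta>} \<le> \<eta>"
  shows "M = N"
proof (rule prob_space_eq_if_le[OF M(2) N(2)])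
  interpret M: prob_space M by fact
  interpret N: prob_space N by fact
  show s: "sets M = sets N" by (simp add: M N)
  have le_on_closed: "measure M C \<le> measure N C" if C: "closed C" for C
  proof (cases "C = {}")
    case False
    have "measure M C \<le> measure N {x. infdist x C \<le> 1 / real (Suc n)} + 1 / real (Suc n)" for n
    proof -
      obtain P where "coupling M N P"
        "measure P {z. dist (fst z) (snd z) \<ge> 1 / real (Suc n)} \<le> 1 / real (Suc n)"
        using near[of "1 / real (Suc n)"] by auto
      then show ?thesis
        using measure_le_thickening_if_coupling[OF _ M N(1) C, of P "1 / real (Suc n)"] by linarith
    qed
    moreover have "(\<lambda>n. measure N {x. infdist x C \<le> 1 / real (Suc n)} + 1 / real (Suc n)) \<longlonglongrightarrow> measure N C + 0"
      by (intro tendsto_add tendsto_measure_thickening N C False LIMSEQ_Suc[OF lim_1_over_n])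
    ultimately show ?thesis by (intro LIMSEQ_le_const[where a="measure M C"]) auto
  qed simp
  show "M \<le> N"
  proof (subst le_measure[OF s], rule ballI)
    fix A assume A: "A \<in> sets M"
    have "emeasure M A = (SUP K \<in> {K. K \<subseteq> A \<and> compact K}. emeasure M K)"
      using A by (intro inner_regular M) (simp_all add: M M.emeasure_eq_measure)
    also have "\<dots> \<le> emeasure N A"
    proof (rule SUP_least)
      fix K assume K: "K \<in> {K. K \<subseteq> A \<and> compact K}"
      then have "measure M K \<le> measure N K" by (simp add: le_on_closed compact_imp_closed)
      also have "\<dots> \<le> measure N A" using K A s by (intro N.finite_measure_mono) auto
      finally show "emeasure M K \<le> emeasure N A"
        by (simp add: M.emeasure_eq_measure N.emeasure_eq_measure)
    qed
    finally show "emeasure M A \<le> emeasure N A" .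
  qed
qed

lemma exists_lower_bound_off_diagonal:
  fixes F :: "'a::metric_space \<Rightarrow> 'b::metric_space" and \<psi> :: "('a \<times> 'b) \<times> ('a \<times> 'b) \<Rightarrow> real"
  assumes K: "compact K" "\<And>z. z \<in> K \<Longrightarrow> snd z = F (fst z)" and \<psi>: "continuous_on UNIV \<psi>"
    and pos: "\<And>x y. x \<noteq> y \<Longrightarrow> \<psi> ((x, F x), (y, F y)) > 0" and "\<eta> > 0"
  shows "\<exists>\<tau>>0. \<forall>x y. (x, F x) \<in> K \<longrightarrow> (y, F y) \<in> K \<longrightarrow> dist x y \<ge> \<eta> \<longrightarrow> \<tau> \<le> \<psi> ((x, F x), (y, F y))"
proof -
  let ?D = "(K \<times> K) \<inter> {z. \<eta> \<le> dist (fst (fst z)) (fst (snd z))}"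
  have positive: "\<psi> z > 0" if "z \<in> ?D" for z
  proof -
    have "z = ((fst (fst z), F (fst (fst z))), (fst (snd z), F (fst (snd z))))"
      using that K(2)[of "fst z"] K(2)[of "snd z"] by (auto simp: prod_eq_iff)
    moreover have "fst (fst z) \<noteq> fst (snd z)" using that \<open>\<eta> > 0\<close> by auto
    ultimately show ?thesis using pos by metis
  qed
  have "compact ?D"
    by (intro compact_Int_closed compact_Times K closed_Collect_le continuous_intros)
  have "\<exists>\<tau>>0. \<forall>z\<in>?D. \<tau> \<le> \<psi> z"
  proof (cases "?D = {}")
    case False
    from continuous_attains_inf[OF \<open>compact ?D\<close> False continuous_on_subset[OF \<psi> subset_UNIV]] positive
    show ?thesis by blast
  qed (auto intro: exI[of _ 1])
  then show ?thesis by force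
qed

lemma (in prob_space) prob_ge_le_if_nn_integral_le:
  assumes [measurable]: "u \<in> borel_measurable M" and nn_integral_le: "(\<integral>\<^sup>+x. u x \<partial>M) \<le> ennreal (\<tau> * a)"
    and "\<tau> > 0" "a \<ge> 0"
  shows "prob {x \<in> space M. ennreal \<tau> \<le> u x} \<le> a"
proof -
  let ?A = "{x \<in> space M. ennreal \<tau> \<le> u x}"
  have "ennreal \<tau> * emeasure M ?A = (\<integral>\<^sup>+x. ennreal \<tau> * indicator ?A x \<partial>M)"
    by (simp add: nn_integral_cmult_indicator)
  also have "\<dots> \<le> (\<integral>\<^sup>+x. u x \<partial>M)"
    by (intro nn_integral_mono) (auto simp: indicator_def)
  also have "\<dots> \<le> ennreal \<tau> * ennreal a" using nn_integral_le \<open>\<tau> > 0\<close> \<open>a \<ge> 0\<close> by (simp add: ennreal_mult)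
  finally show ?thesis
    using \<open>\<tau> > 0\<close> \<open>a \<ge> 0\<close> by (simp add: ennreal_mult_le_mult_iff emeasure_eq_measure)
qed

lemma measure_coupling_le_if_cost_ge:
  assumes P: "coupling M N P" "prob_space M" and A: "A \<in> sets M" and B: "B \<in> sets N" and D: "D \<subseteq> space P"
    and u: "u \<in> borel_measurable P" "(\<integral>\<^sup>+z. u z \<partial>P) \<le> ennreal (\<tau> * e)" "\<tau> > 0" "e \<ge> 0"
    and cost: "\<And>z. z \<in> D \<Longrightarrow> fst z \<notin> A \<Longrightarrow> snd z \<notin> B \<Longrightarrow> ennreal \<tau> \<le> u z"
  shows "measure P D \<le> measure M A + measure N B + e"
proof -
  interpret P: prob_space P by (rule coupling_imp_prob_space[OF P])
  have "measure P D \<le> measure M A + measure N B + measure P {z \<in> space P. ennreal \<tau> \<le> u z}"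
    using D cost u(1) by (intro measure_coupling_Un_le[OF P A B]) auto
  then show ?thesis using P.prob_ge_le_if_nn_integral_le[OF u] by linarith
qed

lemma eq_if_couplings_of_vanishing_cost:
  fixes M N :: "'a::polish_space measure" and F :: "'a \<Rightarrow> 'b::polish_space"
    and \<psi> :: "('a \<times> 'b) \<times> ('a \<times> 'b) \<Rightarrow> real"
  defines "cost \<equiv> \<lambda>z. \<psi> ((fst z, F (fst z)), (snd z, F (snd z)))"
  assumes M: "sets M = sets borel" "prob_space M" and N: "sets N = sets borel" "prob_space N"
    and F[measurable]: "F \<in> borel_measurable borel" and \<psi>: "continuous_on UNIV \<psi>"
    and pos: "\<And>x y. x \<noteq> y \<Longrightarrow> cost (x, y) > 0"
    and couplings: "\<And>C \<delta>. compact C \<Longrightarrow> \<delta> > 0 \<Longrightarrow> \<exists>P. coupling M N P \<and>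
      (\<integral>\<^sup>+z. indicator (C \<times> C) (F (fst z), F (snd z)) * ennreal (cost z) \<partial>P) \<le> ennreal \<delta>"
  shows "M = N"
proof (rule eq_if_couplings_near_diagonal[OF M N])
  fix \<eta> :: real assume "\<eta> > 0"
  obtain K1 where K1: "compact K1" "\<And>z. z \<in> K1 \<Longrightarrow> snd z = F (fst z)" "measure M {x. (x, F x) \<notin> K1} \<le> \<eta> / 3"
    using Lusin_graph[OF M F, of "\<eta> / 3"] \<open>\<eta> > 0\<close> by auto
  obtain K2 where K2: "compact K2" "\<And>z. z \<in> K2 \<Longrightarrow> snd z = F (fst z)" "measure N {x. (x, F x) \<notin> K2} \<le> \<eta> / 3"
    using Lusin_graph[OF N F, of "\<eta> / 3"] \<open>\<eta> > 0\<close> by auto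
  let ?K = "K1 \<union> K2"
  have graph: "snd z = F (fst z)" if "z \<in> ?K" for z using that K1(2) K2(2) by blast
  obtain \<tau> where \<tau>: "\<tau> > 0"
    "\<And>x y. (x, F x) \<in> ?K \<Longrightarrow> (y, F y) \<in> ?K \<Longrightarrow> dist x y \<ge> \<eta> \<Longrightarrow> \<tau> \<le> cost (x, y)"
    using exists_lower_bound_off_diagonal[OF compact_Un[OF K1(1) K2(1)] graph \<psi> _ \<open>\<eta> > 0\<close>] pos
    by (force simp: cost_def)
  define C where "C = snd ` ?K"
  have C: "compact C" unfolding C_def by (intro compact_continuous_image compact_Un K1 K2 continuous_intros)
  define u where "u z = indicator (C \<times> C) (F (fst z), F (snd z)) * ennreal (cost z)" for z
  obtain P where P: "coupling M N P" and cost_P: "(\<integral>\<^sup>+z. u z \<partial>P) \<le> ennreal (\<tau> * (\<eta> / 3))"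
    using couplings[OF C, of "\<tau> * (\<eta> / 3)"] \<tau> \<open>\<eta> > 0\<close> by (auto simp: u_def)
  note sets_P = sets_coupling_borel[OF P M(1) N(1)]
  note [measurable_cong] = sets_P[folded borel_prod]
  interpret P: prob_space P by (rule coupling_imp_prob_space[OF P M(2)])
  have [measurable]: "K1 \<in> sets borel" "K2 \<in> sets borel" "C \<in> sets borel"
    using K1(1) K2(1) C by (auto simp: compact_imp_closed)
  have [measurable]: "u \<in> borel_measurable P"
    unfolding u_def cost_def using borel_measurable_continuous_onI[OF \<psi>] by measurable
  have "measure P {z. dist (fst z) (snd z) \<ge> \<eta>} \<le>
      measure M {x. (x, F x) \<notin> K1} + measure N {x. (x, F x) \<notin> K2} + \<eta> / 3"
  proof (rule measure_coupling_le_if_cost_ge[OF P M(2) _ _ _ _ cost_P \<tau>(1)])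
    fix z assume z: "z \<in> {z. \<eta> \<le> dist (fst z) (snd z)}" "fst z \<notin> {x. (x, F x) \<notin> K1}" "snd z \<notin> {x. (x, F x) \<notin> K2}"
    moreover have "F x \<in> C" if "(x, F x) \<in> ?K" for x using that unfolding C_def by force
    ultimately show "ennreal \<tau> \<le> u z"
      using \<tau>(2)[of "fst z" "snd z"] by (simp add: u_def ennreal_leI)
  next
    show "{z. \<eta> \<le> dist (fst z) (snd z)} \<subseteq> space P" using sets_eq_imp_space_eq[OF sets_P] by simp
  qed (use \<open>\<eta> > 0\<close> in \<open>simp_all add: M(1) N(1)\<close>)
  also have "\<dots> \<le> \<eta> / 3 + \<eta> / 3 + \<eta> / 3" by (intro add_mono K1 K2 order_refl)
  finally show "\<exists>P. coupling M N P \<and> measure P {z. dist (fst z) (snd z) \<ge> \<eta>} \<le> \<eta>"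
    using P by auto
qed

section \<open>Solutions and one Euler--Maruyama step\<close>

lemma gen_bound:
  assumes "f \<in> C0_inf"
  shows "\<exists>C\<ge>0. \<exists>r. \<forall>(S :: real^'m::finite^'n::finite) v y.
    \<bar>gen S v f y\<bar> \<le> C * (norm v + (norm S)\<^sup>2) * indicator (cball 0 r) y"
proof -
  obtain D where D: "D \<ge> 0" "\<And>is x. length is \<le> 2 \<Longrightarrow> \<bar>iter_pdiff is f x\<bar> \<le> D"
    using C0_inf_derivatives_bounded[OF assms, of 2] by blast
  obtain r where r: "closure {x. f x \<noteq> 0} \<subseteq> cball 0 r"
    using assms bounded_closure[of "{x. f x \<noteq> 0}"] by (auto simp: C0_inf_iff bounded_iff subset_iff)
  have "\<bar>gen S v f y\<bar> \<le> (real CARD('n))\<^sup>2 * D * (norm v + (norm S)\<^sup>2) * indicator (cball 0 r) y"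
    for S :: "real^'m^'n" and v y
  proof (cases "y \<in> cball 0 r")
    case True
    have "\<bar>gen S v f y\<bar> \<le> (real CARD('n))\<^sup>2 * (D * norm v + D * (norm S)\<^sup>2)"
      using D(2)[of "[_]"] D(2)[of "[_, _]"] by (intro abs_gen_le C0_inf_smooth[OF assms]) simp_all
    then show ?thesis using True by (simp add: algebra_simps)
  next
    case False
    then have "iter_pdiff is f y = 0" for "is" using support_iter_pdiff_subset r by blast
    from abs_gen_le[OF C0_inf_smooth[OF assms], of y 0 0 S v] this[of "[_]"] this[of "[_, _]"]
    show ?thesis using False by simp
  qed
  moreover have "(real CARD('n))\<^sup>2 * D \<ge> 0" using D(1) by simp
  ultimately show ?thesis by blast
qed

lemma abs_gen_bounded:
  assumes "f \<in> C0_inf"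
  shows "\<exists>C\<ge>0. \<forall>(S :: real^'m::finite^'n::finite) v y. \<bar>gen S v f y\<bar> \<le> C * (norm v + (norm S)\<^sup>2)"
proof -
  obtain C r where C: "C \<ge> 0"
    "\<And>S v y. \<bar>gen (S :: real^'m^'n) v f y\<bar> \<le> C * (norm v + (norm S)\<^sup>2) * indicator (cball 0 r) y"
    using gen_bound[OF assms, where 'm='m] by blast
  have "\<bar>gen S v f y\<bar> \<le> C * (norm v + (norm S)\<^sup>2)" for S :: "real^'m^'n" and v y
  proof -
    have "C * (norm v + (norm S)\<^sup>2) * indicator (cball 0 r) y \<le> C * (norm v + (norm S)\<^sup>2) * 1"
      using C(1) by (intro mult_left_mono) (auto simp: indicator_def)
    then show ?thesis using C(2)[of S v y] by simp
  qed
  then show ?thesis using C(1) by blast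
qed

lemma em_error_le_localised:
  fixes f :: "real^'n::finite \<Rightarrow> real"
  assumes "f \<in> C0_inf" "R \<ge> 0"
  shows "\<exists>K\<ge>0. \<exists>r. \<forall>x v h. \<forall>S :: real^'m::finite^'n. norm v \<le> R \<longrightarrow> norm S \<le> R \<longrightarrow> 0 \<le> h \<longrightarrow> h \<le> 1 \<longrightarrow>
    \<bar>em_error f h S v x\<bar> \<le> K * (h * sqrt h) * indicator (cball 0 r) x"
proof -
  obtain K where K: "K \<ge> 0" "\<And>x v h S. norm v \<le> R \<Longrightarrow> norm (S :: real^'m^'n) \<le> R \<Longrightarrow> 0 \<le> h \<Longrightarrow> h \<le> 1 \<Longrightarrow>
      \<bar>em_error f h S v x\<bar> \<le> K * (h * sqrt h)"
    using em_error_le[OF assms, where 'm='m] by blast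
  obtain C r where gen_le: "\<And>S v y.
      \<bar>gen (S :: real^'m^'n) v f y\<bar> \<le> C * (norm v + (norm S)\<^sup>2) * indicator (cball 0 r) y"
    using gen_bound[OF assms(1), where 'm='m] by blast
  obtain r' where r': "\<And>x. f x \<noteq> 0 \<Longrightarrow> norm x \<le> r'"
    using assms(1) by (auto simp: C0_inf_iff bounded_iff)
  define q where "q = max r r' + R * (1 + sqrt (2 * CARD('m)))"
  have "em_error f h S v x = 0"
    if x: "x \<notin> cball 0 q" and coefs_le: "norm v \<le> R" "norm S \<le> R" and h: "0 \<le> h" "h \<le> 1"
    for x v h and S :: "real^'m^'n"
  proof -
    have far: "norm x > max r r' + norm (em_step h v S l)" for l
    proof -
      have "norm (em_step h v S l) \<le> R * (1 + sqrt (2 * CARD('m))) * 1"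
        using norm_em_step_le[OF h coefs_le, of l] h(2) assms(2)
          mult_left_mono[of "sqrt h" 1 "R * (1 + sqrt (2 * CARD('m)))"]
        by simp
      then show ?thesis using x by (simp add: q_def)
    qed
    have "f (x + em_step h v S l) = 0" for l
      using far[of l] norm_diff_ineq[of x "em_step h v S l"] r'[of "x + em_step h v S l"] by linarith
    moreover have "norm x > max r r'" using far[of undefined] norm_ge_zero[of "em_step h v S undefined"] by linarith
    then have "f x = 0" "gen S v f x = 0" using r'[of x] gen_le[of S v x] by auto
    ultimately show ?thesis by (simp add: em_error_def em_average_const)
  qed
  then have "\<bar>em_error f h S v x\<bar> \<le> K * (h * sqrt h) * indicator (cball 0 q) x"
    if "norm v \<le> R" "norm S \<le> R" "0 \<le> h" "h \<le> 1" for x v h and S :: "real^'m^'n"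
    using K(2)[OF that, of x] that by (cases "x \<in> cball 0 q") auto
  then show ?thesis using K(1) by blast
qed

lemma column_measurable:
  fixes S :: "'a \<Rightarrow> real^'m::finite^'n::finite"
  assumes "S \<in> borel_measurable M"
  shows "(\<lambda>x. column j (S x)) \<in> borel_measurable M"
proof -
  have "continuous_on UNIV (\<lambda>A :: real^'m^'n. \<chi> i. A $ i $ j)" by (intro continuous_intros)
  then have "(\<lambda>A :: real^'m^'n. column j A) \<in> borel_measurable borel"
    unfolding column_def by (rule borel_measurable_continuous_onI)
  then show ?thesis by (rule measurable_compose[OF assms])
qed

lemma qfun_eq: "qfun Sig b x y = inner (x - y) (b x - b y) + (norm (Sig x - Sig y))\<^sup>2"
  by (simp add: qfun_def trace_mult_transpose)

locale diffusion =
  fixes Sig :: "real^'n::finite \<Rightarrow> real^'m::finite^'n" and b :: "real^'n \<Rightarrow> real^'n"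
  assumes Sig_measurable [measurable]: "Sig \<in> borel_measurable borel"
    and b_measurable [measurable]: "b \<in> borel_measurable borel"
begin

definition coef_size :: "real^'n \<Rightarrow> real" where
  "coef_size x = norm (b x) + (norm (Sig x))\<^sup>2"

definition trunc :: "real \<Rightarrow> (real^'n \<Rightarrow> 'c::zero) \<Rightarrow> real^'n \<Rightarrow> 'c" where
  "trunc R g x = (if coef_size x \<le> R then g x else 0)"

definition coef_tail :: "real \<Rightarrow> real^'n \<Rightarrow> real" where
  "coef_tail R x = (if coef_size x \<le> R then 0 else coef_size x)"

definition trunc_step :: "real \<Rightarrow> real \<Rightarrow> 'm \<times> bool \<Rightarrow> real^'n \<Rightarrow> real^'n" where
  "trunc_step R h l x = em_step h (trunc R b x) (trunc R Sig x) l"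

lemma coef_size_nonneg: "coef_size x \<ge> 0"
  by (simp add: coef_size_def)

lemma coef_tail_nonneg: "coef_tail R x \<ge> 0" and coef_tail_le: "coef_tail R x \<le> coef_size x"
  by (simp_all add: coef_tail_def coef_size_nonneg)

lemma coef_size_measurable [measurable]: "coef_size \<in> borel_measurable borel"
  unfolding coef_size_def[abs_def] by measurable

lemma coef_tail_measurable [measurable]: "coef_tail R \<in> borel_measurable borel"
  unfolding coef_tail_def[abs_def] by measurable

lemma norm_b_le_coef_size: "norm (b x) \<le> coef_size x"
  and norm_Sig_power2_le_coef_size: "(norm (Sig x))\<^sup>2 \<le> coef_size x"
  by (simp_all add: coef_size_def)

lemma norm_trunc_b_le: "R \<ge> 0 \<Longrightarrow> norm (trunc R b x) \<le> R"
  using norm_b_le_coef_size[of x] by (simp add: trunc_def)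

lemma norm_trunc_Sig_le:
  assumes "R \<ge> 1"
  shows "norm (trunc R Sig x) \<le> R"
proof (cases "coef_size x \<le> R")
  case True
  then have "(norm (Sig x))\<^sup>2 \<le> R" using norm_Sig_power2_le_coef_size[of x] by linarith
  also have "R \<le> R\<^sup>2" using assms by (simp add: power2_eq_square)
  finally show ?thesis using assms True by (simp add: trunc_def power2_le_iff_abs_le)
qed (use assms in \<open>simp add: trunc_def\<close>)

lemma trunc_measurable [measurable]:
  fixes g :: "real^'n \<Rightarrow> 'c::{zero, topological_space}"
  assumes [measurable]: "g \<in> borel_measurable borel"
  shows "trunc R g \<in> borel_measurable borel"
  unfolding trunc_def[abs_def] by measurable

lemma trunc_step_measurable [measurable]: "trunc_step R h l \<in> borel_measurable borel"
proof -
  note [measurable] = column_measurable[OF trunc_measurable[OF Sig_measurable]]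
  show ?thesis unfolding trunc_step_def[abs_def] em_step_def by measurable
qed

lemma em_average_trunc_step_le:
  assumes "f \<in> C0_inf"
  shows "\<exists>C\<ge>0. \<exists>r. \<forall>R\<ge>1. \<exists>K\<ge>0. \<exists>q. \<forall>h X y. 0 \<le> h \<longrightarrow> h \<le> 1 \<longrightarrow>
    em_average (\<lambda>l. f (y + trunc_step R h l X)) \<le> f y + h * gen (Sig X) (b X) f y
      + (h * C * coef_tail R X * indicator (cball 0 r) y + K * (h * sqrt h) * indicator (cball 0 q) y)"
proof -
  obtain C r where C: "C \<ge> 0"
    "\<And>S v y. \<bar>gen (S :: real^'m^'n) v f y\<bar> \<le> C * (norm v + (norm S)\<^sup>2) * indicator (cball 0 r) y"
    using gen_bound[OF assms, where 'm='m] by blast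
  have "\<exists>K\<ge>0. \<exists>q. \<forall>h X y. 0 \<le> h \<longrightarrow> h \<le> 1 \<longrightarrow>
    em_average (\<lambda>l. f (y + trunc_step R h l X)) \<le> f y + h * gen (Sig X) (b X) f y
      + (h * C * coef_tail R X * indicator (cball 0 r) y + K * (h * sqrt h) * indicator (cball 0 q) y)"
    if R: "R \<ge> 1" for R
  proof -
    obtain K q where K: "K \<ge> 0" "\<And>x v h S. norm v \<le> R \<Longrightarrow> norm (S :: real^'m^'n) \<le> R \<Longrightarrow> 0 \<le> h \<Longrightarrow> h \<le> 1 \<Longrightarrow>
        \<bar>em_error f h S v x\<bar> \<le> K * (h * sqrt h) * indicator (cball 0 q) x"
      using em_error_le_localised[OF assms order_trans[OF zero_le_one R], where 'm='m] by blast
    have "em_average (\<lambda>l. f (y + trunc_step R h l X)) \<le> f y + h * gen (Sig X) (b X) f y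
        + (h * C * coef_tail R X * indicator (cball 0 r) y + K * (h * sqrt h) * indicator (cball 0 q) y)"
      if h: "0 \<le> h" "h \<le> 1" for h X y
    proof -
      have "gen (trunc R Sig X) (trunc R b X) f y \<le>
          gen (Sig X) (b X) f y + C * coef_tail R X * indicator (cball 0 r) y"
        using C(2)[of "Sig X" "b X" y] by (auto simp: trunc_def coef_tail_def coef_size_def gen_zero)
      from mult_left_mono[OF this h(1)]
      show ?thesis
        using K(2)[of "trunc R b X" "trunc R Sig X" h y] h R
        by (simp add: norm_trunc_b_le norm_trunc_Sig_le trunc_step_def em_error_def abs_le_iff algebra_simps)
    qed
    then show ?thesis using K(1) by blast
  qed
  then show ?thesis using C(1) by blast
qed

lemma diff_op_measurable:
  assumes "f \<in> C0_inf"
  shows "diff_op Sig b f \<in> borel_measurable borel"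
proof -
  have [measurable]: "pdiff i f \<in> borel_measurable borel" "pdiff i (pdiff j f) \<in> borel_measurable borel" for i j
    using C0_inf_borel_measurable[OF C0_inf_iter_pdiff[OF assms], of "[_]"]
      C0_inf_borel_measurable[OF C0_inf_iter_pdiff[OF assms], of "[_, _]"] by simp_all
  have [measurable]: "(\<lambda>x. Sig x $ i $ j) \<in> borel_measurable borel" for i j
    by (rule measurable_compose[OF Sig_measurable]) (intro borel_measurable_continuous_onI continuous_intros)
  have [measurable]: "(\<lambda>x. b x $ i) \<in> borel_measurable borel" for i
    by (rule measurable_compose[OF b_measurable]) (intro borel_measurable_continuous_onI continuous_intros)
  show ?thesis
    unfolding diff_op_def[abs_def] matrix_matrix_mult_def transpose_def vec_lambda_beta by measurable
qed

end

locale diffusion_solution = diffusion Sig b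
  for Sig :: "real^'n::finite \<Rightarrow> real^'m::finite^'n" and b +
  fixes M :: "(real^'n) measure"
  assumes solution: "prob_solution Sig b M"
    and moment_finite: "(\<integral>\<^sup>+x. ennreal ((norm (Sig x))\<^sup>2 + norm (b x) * norm x) \<partial>M) < \<infinity>"
begin

sublocale prob_space M
  using solution by (simp add: prob_solution_def)

lemma sets_M [measurable_cong]: "sets M = sets borel"
  using solution by (simp add: prob_solution_def)

lemma integrable_moment: "integrable M (\<lambda>x. (norm (Sig x))\<^sup>2 + norm (b x) * norm x)"
  by (rule integrableI_nonneg) (use moment_finite in auto)

lemma integrable_coef_size: "integrable M coef_size"
proof (rule Bochner_Integration.integrable_bound)
  let ?g = "\<lambda>x. \<Sum>i\<in>UNIV. \<bar>indicator (cball 0 1) x *\<^sub>R b x $ i\<bar>"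
  have "integrable M (\<lambda>x. indicator (cball 0 1) x *\<^sub>R b x $ i)" for i
    using solution by (simp add: prob_solution_def set_integrable_def)
  then show "integrable M (\<lambda>x. ((norm (Sig x))\<^sup>2 + norm (b x) * norm x) + ?g x)"
    by (intro Bochner_Integration.integrable_add integrable_moment Bochner_Integration.integrable_sum integrable_abs)
  have "norm (b x) \<le> norm (b x) * norm x + ?g x" for x
  proof (cases "norm x \<le> 1")
    case True
    then have "norm (b x) \<le> ?g x" using norm_le_l1_cart[of "b x"] by simp
    then show ?thesis by (simp add: add_increasing)
  next
    case False
    then have "norm (b x) * 1 \<le> norm (b x) * norm x" by (intro mult_left_mono) auto
    moreover have "?g x \<ge> 0" by (simp add: sum_nonneg)
    ultimately show ?thesis by linarith
  qed
  moreover have "?g x \<ge> 0" for x by (simp add: sum_nonneg)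
  ultimately show "AE x in M. norm (coef_size x) \<le> norm (((norm (Sig x))\<^sup>2 + norm (b x) * norm x) + ?g x)"
    by (intro AE_I2) (simp add: coef_size_def)
qed measurable

lemma integrable_coef_tail: "integrable M (coef_tail R)"
  by (rule Bochner_Integration.integrable_bound[OF integrable_coef_size])
    (auto simp: coef_tail_nonneg coef_tail_le coef_size_nonneg)

lemma tendsto_integral_coef_tail: "(\<lambda>n. \<integral>x. coef_tail (real n) x \<partial>M) \<longlonglongrightarrow> 0"
proof -
  have "(\<lambda>n. \<integral>x. coef_tail (real n) x \<partial>M) \<longlonglongrightarrow> (\<integral>x. 0 \<partial>M)"
  proof (rule integral_dominated_convergence[OF _ _ integrable_coef_size])
    have "\<forall>\<^sub>F n in sequentially. coef_tail (real n) x = 0" for x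
    proof -
      obtain n where "coef_size x \<le> real n" using real_arch_simple by blast
      then show ?thesis by (intro eventually_sequentiallyI[of n]) (simp add: coef_tail_def)
    qed
    then show "AE x in M. (\<lambda>n. coef_tail (real n) x) \<longlonglongrightarrow> 0"
      by (intro AE_I2 tendsto_eventually)
  qed (simp_all add: coef_tail_nonneg coef_tail_le)
  then show ?thesis by simp
qed

lemma integrable_diff_op:
  assumes f: "f \<in> C0_inf"
  shows "integrable M (diff_op Sig b f)"
proof -
  note [measurable] = diff_op_measurable[OF f]
  obtain C r where C: "C \<ge> 0"
    "\<And>S v y. \<bar>gen (S :: real^'m^'n) v f y\<bar> \<le> C * (norm v + (norm S)\<^sup>2) * indicator (cball 0 r) y"
    using gen_bound[OF f, where 'm='m] by blast
  have "\<bar>diff_op Sig b f x\<bar> \<le> C * coef_size x" for x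
  proof -
    have "\<bar>diff_op Sig b f x\<bar> \<le> C * coef_size x * indicator (cball 0 r) x"
      using C(2)[of "Sig x" "b x" x] by (simp add: diff_op_eq_gen[OF C0_inf_smooth[OF f]] coef_size_def)
    also have "\<dots> \<le> C * coef_size x * 1"
      using C(1) by (intro mult_left_mono) (simp_all add: coef_size_nonneg indicator_def)
    finally show ?thesis by simp
  qed
  then show ?thesis
    using C(1)
    by (intro Bochner_Integration.integrable_bound[OF integrable_mult_right[OF integrable_coef_size, of C]])
      (simp_all add: coef_size_nonneg)
qed

lemma integral_diff_op: "f \<in> C0_inf \<Longrightarrow> (\<integral>x. diff_op Sig b f x \<partial>M) = 0"
  using solution by (simp add: prob_solution_def)

end

lemma C0_inf_translate: "f \<in> C0_inf \<Longrightarrow> (\<lambda>X. f (X - x)) \<in> C0_inf"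
  using C0_inf_affine[of f 1 1 "- x"] by simp

lemma gen_translate: "smooth f \<Longrightarrow> gen S v (\<lambda>X. f (X - x)) X = gen S v f (X - x)"
  using gen_affine[of f S v 1 "- x" 1 X] by (simp add: gen_eq_add[of S v])

abbreviation em_noise :: "('m::finite \<times> bool) measure" where
  "em_noise \<equiv> measure_pmf (pmf_of_set UNIV)"

lemma nn_integral_em_noise:
  fixes g :: "'m::finite \<times> bool \<Rightarrow> real"
  assumes "\<And>l. g l \<ge> 0"
  shows "(\<integral>\<^sup>+l. ennreal (g l) \<partial>em_noise) = ennreal (em_average g)"
proof -
  have "(\<integral>\<^sup>+l. ennreal (g l) \<partial>em_noise) = (\<Sum>l\<in>UNIV. ennreal (g l)) / ennreal (2 * real CARD('m))"
    by (simp add: nn_integral_pmf_of_set ennreal_of_nat_eq_real_of_nat mult.commute)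
  then show ?thesis
    using assms by (simp add: em_average_def sum_ennreal sum_nonneg divide_ennreal)
qed

lemma em_average_nonneg: "(\<And>l. g l \<ge> 0) \<Longrightarrow> em_average g \<ge> 0"
  by (simp add: em_average_def sum_nonneg)

lemma em_average_measurable [measurable (raw)]:
  fixes g :: "'m::finite \<times> bool \<Rightarrow> 'a \<Rightarrow> real"
  assumes [measurable]: "\<And>l. g l \<in> borel_measurable M"
  shows "(\<lambda>x. em_average (\<lambda>l. g l x)) \<in> borel_measurable M"
  unfolding em_average_def by measurable

lemma nn_integral_le_add_if_zero_mean:
  assumes "integrable M f" "\<And>x. f x \<ge> 0" "integrable M g" "\<And>x. g x \<ge> 0"
    and "integrable M d" "(\<integral>x. d x \<partial>M) = (0 :: real)"
    and u: "u \<in> borel_measurable M" "\<And>x. u x \<ge> 0" and u_le: "\<And>x. u x \<le> f x + d x + g x"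
  shows "(\<integral>\<^sup>+x. ennreal (u x) \<partial>M) \<le> (\<integral>\<^sup>+x. ennreal (f x) \<partial>M) + (\<integral>\<^sup>+x. ennreal (g x) \<partial>M)"
proof -
  have integrable_sum: "integrable M (\<lambda>x. f x + d x + g x)"
    using assms by (intro Bochner_Integration.integrable_add)
  then have integrable_u: "integrable M u"
    by (rule Bochner_Integration.integrable_bound[OF _ u(1)])
      (simp add: u(2) order_trans[OF u_le abs_ge_self])
  have "(\<integral>x. u x \<partial>M) \<le> (\<integral>x. f x + d x + g x \<partial>M)"
    by (rule integral_mono[OF integrable_u integrable_sum u_le])
  also have "\<dots> = (\<integral>x. f x \<partial>M) + (\<integral>x. g x \<partial>M)" using assms by simp
  finally have "ennreal (\<integral>x. u x \<partial>M) \<le> ennreal (\<integral>x. f x \<partial>M) + ennreal (\<integral>x. g x \<partial>M)"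
    using assms by (simp add: ennreal_leI flip: ennreal_plus)
  then show ?thesis
    using assms integrable_u by (simp add: nn_integral_eq_integral)
qed

lemma indicator_cball_measurable [measurable (raw)]:
  fixes f :: "'b \<Rightarrow> 'a::real_normed_vector" and e :: real
  assumes "f \<in> borel_measurable M"
  shows "(\<lambda>x. indicator (cball 0 e) (f x) :: real) \<in> borel_measurable M"
    and "(\<lambda>x. indicator (cball 0 e) (f x) :: ennreal) \<in> borel_measurable M"
  by (rule measurable_compose[OF assms], rule borel_measurable_indicator, simp)+

lemma nn_integral_moving_ball:
  fixes M :: "'a::euclidean_space measure"
  assumes "prob_space M" and [measurable_cong]: "sets M = sets borel"
    and u: "integrable M u" "\<And>X. u X \<ge> (0::real)"
  shows "(\<integral>\<^sup>+x. \<integral>\<^sup>+X. ennreal (u X * indicator (cball 0 r) (X - x)) \<partial>M \<partial>lborel) =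
    ennreal ((\<integral>X. u X \<partial>M) * measure lborel (cball (0::'a) r))"
proof -
  interpret prob_space M by fact
  interpret pair_sigma_finite M "lborel :: 'a measure" ..
  have [measurable]: "u \<in> borel_measurable M" using u(1) by simp
  have vol: "(\<integral>\<^sup>+x. indicator (cball 0 r) (X - x) \<partial>lborel) = ennreal (measure lborel (cball (0::'a) r))"
    for X :: 'a
    using nn_integral_lborel_reflect[of "\<lambda>x. indicator (cball (0::'a) r) x" X]
      emeasure_lborel_cball_finite[of "0::'a" r]
    by (simp add: emeasure_eq_ennreal_measure less_top)
  have "(\<integral>\<^sup>+x. \<integral>\<^sup>+X. ennreal (u X * indicator (cball 0 r) (X - x)) \<partial>M \<partial>lborel) =
      (\<integral>\<^sup>+X. \<integral>\<^sup>+x. ennreal (u X) * indicator (cball 0 r) (X - x) \<partial>lborel \<partial>M)"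
    by (subst Fubini') (simp_all add: ennreal_mult' u(2) ennreal_indicator)
  also have "\<dots> = (\<integral>\<^sup>+X. ennreal (u X) * ennreal (measure lborel (cball (0::'a) r)) \<partial>M)"
    by (intro nn_integral_cong) (simp add: nn_integral_cmult vol)
  also have "\<dots> = ennreal ((\<integral>X. u X \<partial>M) * measure lborel (cball (0::'a) r))"
    using u by (simp add: nn_integral_multc nn_integral_eq_integral ennreal_mult)
  finally show ?thesis .
qed

context diffusion
begin

lemma trunc_step_measurable2: "(\<lambda>z. trunc_step R h (snd z) (fst z)) \<in> borel_measurable (borel \<Otimes>\<^sub>M em_noise)"
  by (rule measurable_compose_countable[where g=snd and f="\<lambda>l z. trunc_step R h l (fst z)"]) simp_all

end

context diffusion_solution
begin

abbreviation stepped_density :: "(real^'n \<Rightarrow> real) \<Rightarrow> real \<Rightarrow> real \<Rightarrow> real^'n \<Rightarrow> ennreal" where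
  "stepped_density f R h \<equiv>
    mollified (\<lambda>x. ennreal (f x)) (M \<Otimes>\<^sub>M em_noise) (\<lambda>z. fst z + trunc_step R h (snd z) (fst z))"

abbreviation blurred_density :: "(real^'n \<Rightarrow> real) \<Rightarrow> real^'n \<Rightarrow> ennreal" where
  "blurred_density f \<equiv> mollified (\<lambda>x. ennreal (f x)) M (\<lambda>X. X)"

lemma stepped_density_eq:
  assumes f: "f \<in> C0_inf" "\<And>x. f x \<ge> 0"
  shows "stepped_density f R h x = (\<integral>\<^sup>+X. ennreal (em_average (\<lambda>l. f (X - x + trunc_step R h l X))) \<partial>M)"
proof -
  note [measurable] = trunc_step_measurable2 C0_inf_borel_measurable[OF f(1)]
  have "stepped_density f R h x = (\<integral>\<^sup>+X. \<integral>\<^sup>+l. ennreal (f (X + trunc_step R h l X - x)) \<partial>em_noise \<partial>M)"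
    unfolding mollified_def by (subst measure_pmf.nn_integral_fst[symmetric]) simp_all
  then show ?thesis
    using f(2) by (simp add: nn_integral_em_noise algebra_simps)
qed

lemma stepped_density_le:
  assumes f: "f \<in> C0_inf" "\<And>x. f x \<ge> 0"
    and rest: "integrable M (\<lambda>X. rest X (X - x))" "\<And>X y. rest X y \<ge> (0::real)"
    and average_le: "\<And>X y. em_average (\<lambda>l. f (y + trunc_step R h l X)) \<le> f y + h * gen (Sig X) (b X) f y + rest X y"
  shows "stepped_density f R h x \<le> blurred_density f x + (\<integral>\<^sup>+X. ennreal (rest X (X - x)) \<partial>M)"
  unfolding stepped_density_eq[OF f] unfolding mollified_def
proof (rule nn_integral_le_add_if_zero_mean[where d="\<lambda>X. h * diff_op Sig b (\<lambda>X. f (X - x)) X"])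
  note [measurable] = C0_inf_borel_measurable[OF f(1)]
  obtain C where "\<And>x. \<bar>f x\<bar> \<le> C" using C0_inf_bounded[OF f(1)] by blast
  then show "integrable M (\<lambda>X. f (X - x))" by (intro integrable_const_bound[where B=C]) simp_all
  show "integrable M (\<lambda>X. h * diff_op Sig b (\<lambda>X. f (X - x)) X)"
    "(\<integral>X. h * diff_op Sig b (\<lambda>X. f (X - x)) X \<partial>M) = 0"
    using integrable_diff_op[OF C0_inf_translate[OF f(1)]] integral_diff_op[OF C0_inf_translate[OF f(1)]]
    by simp_all
  show "(\<lambda>X. em_average (\<lambda>l. f (X - x + trunc_step R h l X))) \<in> borel_measurable M" by measurable
  show "em_average (\<lambda>l. f (X - x + trunc_step R h l X)) \<le>
      f (X - x) + h * diff_op Sig b (\<lambda>X. f (X - x)) X + rest X (X - x)" for X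
    using average_le[of "X - x" X] C0_inf_smooth[OF f(1)] C0_inf_smooth[OF C0_inf_translate[OF f(1)], of x]
    by (simp add: diff_op_eq_gen gen_translate)
qed (simp_all add: f rest em_average_nonneg)

text \<open>The mass gained by the density in one step; \<open>L\<^sup>*M = 0\<close> makes it \<open>o(h)\<close> up to the truncation tail.\<close>

definition mass_excess :: "(real^'n \<Rightarrow> real) \<Rightarrow> real \<Rightarrow> real \<Rightarrow> ennreal" where
  "mass_excess f R h = (\<integral>\<^sup>+x. stepped_density f R h x - blurred_density f x \<partial>lborel)"

lemma mass_excess_le:
  assumes f: "f \<in> C0_inf" "\<And>x. f x \<ge> 0"
    and u: "integrable M u" "\<And>X. u X \<ge> (0::real)" and c: "c \<ge> 0"
    and average_le: "\<And>X y. em_average (\<lambda>l. f (y + trunc_step R h l X)) \<le> f y + h * gen (Sig X) (b X) f y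
      + (u X * indicator (cball 0 r) y + c * indicator (cball 0 q) y)"
  shows "mass_excess f R h
    \<le> ennreal ((\<integral>X. u X \<partial>M) * measure lborel (cball (0::real^'n) r) + c * measure lborel (cball (0::real^'n) q))"
proof -
  interpret pair_sigma_finite M "lborel :: (real^'n) measure" ..
  have [measurable]: "u \<in> borel_measurable M" using u(1) by simp
  let ?ball = "\<lambda>u r x. \<integral>\<^sup>+X. ennreal (u X * indicator (cball 0 r) (X - x)) \<partial>M"
    and ?vol = "\<lambda>r. measure lborel (cball (0::real^'n) r)"
  have "stepped_density f R h x - blurred_density f x \<le> ?ball u r x + ?ball (\<lambda>_. c) q x" for x
  proof -
    have "integrable M (\<lambda>X. u X * indicator (cball 0 r) (X - x))"
      by (rule Bochner_Integration.integrable_bound[OF u(1)]) (auto simp: indicator_def)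
    moreover have "integrable M (\<lambda>X. c * indicator (cball 0 q) (X - x))"
      using c by (intro integrable_const_bound[where B=c]) (auto simp: indicator_def)
    ultimately have "stepped_density f R h x \<le> blurred_density f x +
        (\<integral>\<^sup>+X. ennreal (u X * indicator (cball 0 r) (X - x) + c * indicator (cball 0 q) (X - x)) \<partial>M)"
      using u(2) c
      by (intro stepped_density_le[OF f _ _ average_le] Bochner_Integration.integrable_add) simp_all
    moreover obtain D where "\<And>x. \<bar>f x\<bar> \<le> D" using C0_inf_bounded[OF f(1)] by blast
    then have "blurred_density f x < \<top>"
      by (intro mollified_less_top[OF prob_space_axioms, where C=D] ennreal_leI) (simp add: abs_le_iff)
    ultimately show ?thesis
      using u(2) c by (simp add: ennreal_minus_le_iff nn_integral_add less_top[symmetric])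
  qed
  then have "mass_excess f R h \<le> (\<integral>\<^sup>+x. ?ball u r x + ?ball (\<lambda>_. c) q x \<partial>lborel)"
    unfolding mass_excess_def by (rule nn_integral_mono)
  also have "\<dots> = ennreal ((\<integral>X. u X \<partial>M) * ?vol r) + ennreal (c * ?vol q)"
    using nn_integral_moving_ball[OF prob_space_axioms sets_M u, of r] c
      nn_integral_moving_ball[OF prob_space_axioms sets_M, of "\<lambda>_. c" q]
    by (subst nn_integral_add) (simp_all add: prob_space)
  also have "\<dots> = ennreal ((\<integral>X. u X \<partial>M) * ?vol r + c * ?vol q)"
    using u(2) c by (simp add: ennreal_plus)
  finally show ?thesis .
qed

lemma mass_excess_le_tail:
  assumes f: "f \<in> C0_inf" "\<And>x. f x \<ge> 0"
  shows "\<exists>C\<ge>0. \<forall>R\<ge>1. \<exists>K\<ge>0. \<forall>h. 0 \<le> h \<longrightarrow> h \<le> 1 \<longrightarrow>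
    mass_excess f R h \<le> ennreal (h * C * (\<integral>X. coef_tail R X \<partial>M) + K * (h * sqrt h))"
proof -
  obtain C r where C: "C \<ge> 0" and expansion: "\<And>R. R \<ge> 1 \<Longrightarrow> \<exists>K\<ge>0. \<exists>q. \<forall>h X y. 0 \<le> h \<longrightarrow> h \<le> 1 \<longrightarrow>
    em_average (\<lambda>l. f (y + trunc_step R h l X)) \<le> f y + h * gen (Sig X) (b X) f y
      + (h * C * coef_tail R X * indicator (cball 0 r) y + K * (h * sqrt h) * indicator (cball 0 q) y)"
    using em_average_trunc_step_le[OF f(1)] by blast
  let ?vol = "\<lambda>r. measure lborel (cball (0::real^'n) r)"
  have "\<exists>K\<ge>0. \<forall>h. 0 \<le> h \<longrightarrow> h \<le> 1 \<longrightarrow>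
    mass_excess f R h \<le> ennreal (h * (C * ?vol r) * (\<integral>X. coef_tail R X \<partial>M) + K * (h * sqrt h))"
    if R: "R \<ge> 1" for R
  proof -
    obtain K q where K: "K \<ge> 0" and average_le: "\<And>h X y. 0 \<le> h \<Longrightarrow> h \<le> 1 \<Longrightarrow>
      em_average (\<lambda>l. f (y + trunc_step R h l X)) \<le> f y + h * gen (Sig X) (b X) f y
        + (h * C * coef_tail R X * indicator (cball 0 r) y + K * (h * sqrt h) * indicator (cball 0 q) y)"
      using expansion[OF R] by blast
    have "mass_excess f R h \<le> ennreal (h * (C * ?vol r) * (\<integral>X. coef_tail R X \<partial>M) + (K * ?vol q) * (h * sqrt h))"
      if h: "0 \<le> h" "h \<le> 1" for h
      using mass_excess_le[OF f _ _ _ average_le[OF h]] C K h(1)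
      by (simp add: integrable_coef_tail coef_tail_nonneg mult_ac)
    then show ?thesis using K by (intro exI[of _ "K * ?vol q"]) simp
  qed
  then show ?thesis using C by (intro exI[of _ "C * ?vol r"]) simp
qed

end

section \<open>The dissipative case\<close>

definition gauss :: "'a::real_inner \<Rightarrow> real" where
  "gauss z = exp (- (norm z)\<^sup>2 / 2)"

lemma gauss_pos: "gauss z > 0" and gauss_le_1: "gauss z \<le> 1"
  by (simp_all add: gauss_def)

lemma gauss_measurable [measurable]: "gauss \<in> borel_measurable (borel :: 'a::euclidean_space measure)"
  unfolding gauss_def[abs_def] by measurable

lemma norm_times_gauss_le: "norm z * gauss z \<le> 1"
proof -
  have "0 \<le> (norm z - 1)\<^sup>2" by simp
  then have "norm z \<le> 1 + (norm z)\<^sup>2 / 2" by (simp add: power2_diff)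
  also have "\<dots> \<le> exp ((norm z)\<^sup>2 / 2)" by (rule exp_ge_add_one_self)
  finally show ?thesis by (simp add: gauss_def exp_minus field_simps)
qed

text \<open>Because \<open>e\<^sup>t \<ge> 1 + t\<close>, the second-order expansion of the Gaussian along a step is a lower bound.\<close>

lemma gauss_add_ge: "gauss (z + u) \<ge> gauss z * (1 - inner z u - (norm u)\<^sup>2 / 2)"
proof -
  have "(norm (z + u))\<^sup>2 = (norm z)\<^sup>2 + 2 * inner z u + (norm u)\<^sup>2"
    by (simp add: power2_norm_eq_inner inner_add_left inner_add_right inner_commute)
  then have "gauss (z + u) = gauss z * exp (- inner z u - (norm u)\<^sup>2 / 2)"
    by (simp add: gauss_def exp_add[symmetric] field_simps)
  moreover have "1 - inner z u - (norm u)\<^sup>2 / 2 \<le> exp (- inner z u - (norm u)\<^sup>2 / 2)"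
    using exp_ge_add_one_self[of "- inner z u - (norm u)\<^sup>2 / 2"] by linarith
  ultimately show ?thesis by (simp add: gauss_def)
qed

lemma em_average_quadratic:
  fixes S :: "real^'m::finite^'n::finite"
  assumes "h \<ge> 0"
  shows "em_average (\<lambda>l. 1 - inner z (em_step h v S l) - (norm (em_step h v S l))\<^sup>2 / 2) =
    1 - h * (inner z v + (norm S)\<^sup>2) - h\<^sup>2 * (norm v)\<^sup>2 / 2"
proof -
  let ?q = "\<lambda>u. 1 - inner z u - (norm u)\<^sup>2 / 2" and ?m = "real CARD('m)"
  have pair: "?q (a + c) + ?q (a - c) = 2 - 2 * inner z a - (norm a)\<^sup>2 - (norm c)\<^sup>2" for a c
    by (simp add: power2_norm_eq_inner inner_add_left inner_add_right inner_diff_left inner_diff_right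
        inner_commute field_simps)
  have "em_average (\<lambda>l. ?q (em_step h v S l)) =
      (\<Sum>j\<in>(UNIV :: 'm set). (2 - 2 * h * inner z v - h\<^sup>2 * (norm v)\<^sup>2)
        - 2 * h * ?m * (norm (column j S))\<^sup>2) / (2 * ?m)"
    unfolding em_average_em_step[of ?q] pair using assms by (simp add: power_mult_distrib mult.assoc)
  also have "\<dots> = (?m * (2 - 2 * h * inner z v - h\<^sup>2 * (norm v)\<^sup>2) - 2 * h * ?m * (norm S)\<^sup>2) / (2 * ?m)"
    unfolding sum_subtractf sum_distrib_left[symmetric] sum_norm_column_power2 by (simp add: algebra_simps)
  also have "\<dots> = 1 - h * (inner z v + (norm S)\<^sup>2) - h\<^sup>2 * (norm v)\<^sup>2 / 2"
    by (simp add: field_simps)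
  finally show ?thesis .
qed

lemma em_average_gauss_ge:
  fixes S :: "real^'m::finite^'n::finite"
  assumes "h \<ge> 0"
  shows "em_average (\<lambda>l. gauss (z + em_step h v S l)) \<ge>
    gauss z - h * (gauss z * (inner z v + (norm S)\<^sup>2)) - h\<^sup>2 * (norm v)\<^sup>2 / 2"
proof -
  let ?q = "\<lambda>u. 1 - inner z u - (norm u)\<^sup>2 / 2"
  have "gauss z * (h\<^sup>2 * (norm v)\<^sup>2 / 2) \<le> 1 * (h\<^sup>2 * (norm v)\<^sup>2 / 2)"
    by (intro mult_right_mono gauss_le_1) simp
  then have "gauss z - h * (gauss z * (inner z v + (norm S)\<^sup>2)) - h\<^sup>2 * (norm v)\<^sup>2 / 2
      \<le> gauss z * em_average (\<lambda>l. ?q (em_step h v S l))"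
    unfolding em_average_quadratic[OF assms] by (simp add: algebra_simps)
  also have "\<dots> = em_average (\<lambda>l. gauss z * ?q (em_step h v S l))"
    by (simp add: em_average_def sum_distrib_left)
  also have "\<dots> \<le> em_average (\<lambda>l. gauss (z + em_step h v S l))"
    by (intro em_average_mono gauss_add_ge)
  finally show ?thesis .
qed

lemma gauss_mult_inner_le: "gauss z * inner z v \<le> norm v"
proof -
  have "gauss z * inner z v \<le> gauss z * (norm z * norm v)"
    using gauss_pos[of z] by (intro mult_left_mono norm_cauchy_schwarz) simp
  also have "\<dots> = (norm z * gauss z) * norm v" by simp
  also have "\<dots> \<le> 1 * norm v" by (intro mult_right_mono norm_times_gauss_le) simp
  finally show ?thesis by simp
qed

context diffusion
begin

text \<open>The shift by \<open>2\<close> bounds the weight by the Gaussian of any points within distance \<open>1\<close> of \<open>x\<close> and \<open>y\<close>.\<close>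

definition dissipation :: "real \<Rightarrow> real^'n \<Rightarrow> real^'n \<Rightarrow> real" where
  "dissipation R x y = (if coef_size x \<le> R \<and> coef_size y \<le> R
     then exp (- (norm (x - y) + 2)\<^sup>2 / 2) * - qfun Sig b x y else 0)"

definition mean_dissipation :: "real \<Rightarrow> ((real^'n) \<times> (real^'n)) measure \<Rightarrow> ennreal" where
  "mean_dissipation R P = (\<integral>\<^sup>+z. ennreal (dissipation R (fst z) (snd z)) \<partial>P)"

lemma dissipation_measurable [measurable]:
  "(\<lambda>z. dissipation R (fst z) (snd z)) \<in> borel_measurable (borel \<Otimes>\<^sub>M borel)"
  unfolding dissipation_def qfun_eq by measurable

lemma trunc_diff_le_coef_tail:
  assumes "R < coef_size x \<or> R < coef_size y"
  shows "norm (trunc R b x - trunc R b y) + (norm (trunc R Sig x - trunc R Sig y))\<^sup>2 \<le> coef_tail R x + coef_tail R y"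
  using assms coef_size_nonneg[of x] coef_size_nonneg[of y]
  by (auto simp: trunc_def coef_tail_def simp flip: coef_size_def)

lemma dissipation_le_if_close:
  assumes "qfun Sig b X Y \<le> 0" and \<epsilon>: "\<epsilon> \<le> 1" "norm (x - X) \<le> \<epsilon>" "norm (y - Y) \<le> \<epsilon>"
    and coefs_le: "coef_size X \<le> R" "coef_size Y \<le> R"
  shows "dissipation R X Y + gauss (x - y) * (inner (x - y) (b X - b Y) + (norm (Sig X - Sig Y))\<^sup>2)
    \<le> 2 * \<epsilon> * (coef_size X + coef_size Y)"
proof -
  let ?w = "(x - X) - (y - Y)"
  have w: "norm ?w \<le> 2 * \<epsilon>" using norm_triangle_ineq4[of "x - X" "y - Y"] \<epsilon> by linarith
  have \<epsilon>_nonneg: "\<epsilon> \<ge> 0" using \<epsilon>(2) norm_ge_zero order_trans by blast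
  have "norm (x - y) \<le> norm (X - Y) + norm ?w"
    using norm_triangle_ineq[of "X - Y" ?w] by simp
  then have "(norm (x - y))\<^sup>2 \<le> (norm (X - Y) + 2)\<^sup>2" using w \<epsilon>(1) by (intro power_mono) auto
  then have "exp (- (norm (X - Y) + 2)\<^sup>2 / 2) \<le> gauss (x - y)" by (simp add: gauss_def)
  then have "dissipation R X Y \<le> gauss (x - y) * - qfun Sig b X Y"
    using coefs_le assms(1) by (simp add: dissipation_def mult_right_mono_neg)
  moreover have "gauss (x - y) * inner ?w (b X - b Y) \<le> 2 * \<epsilon> * (coef_size X + coef_size Y)"
  proof -
    have "inner ?w (b X - b Y) \<le> norm ?w * norm (b X - b Y)" by (rule norm_cauchy_schwarz)
    also have "\<dots> \<le> (2 * \<epsilon>) * (coef_size X + coef_size Y)"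
      using norm_triangle_ineq4[of "b X" "b Y"] norm_b_le_coef_size[of X] norm_b_le_coef_size[of Y] \<epsilon>_nonneg
      by (intro mult_mono w) auto
    finally have "gauss (x - y) * inner ?w (b X - b Y) \<le> gauss (x - y) * (2 * \<epsilon> * (coef_size X + coef_size Y))"
      using gauss_pos[of "x - y"] by (intro mult_left_mono) auto
    also have "\<dots> \<le> 1 * (2 * \<epsilon> * (coef_size X + coef_size Y))"
      using \<epsilon>_nonneg by (intro mult_right_mono gauss_le_1) (simp add: coef_size_nonneg)
    finally show ?thesis by simp
  qed
  ultimately show ?thesis by (simp add: qfun_eq inner_diff_left algebra_simps)
qed

lemma dissipation_add_gauss_le:
  assumes q: "qfun Sig b X Y \<le> 0" and \<epsilon>: "\<epsilon> \<le> 1" "norm (x - X) \<le> \<epsilon>" "norm (y - Y) \<le> \<epsilon>"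
  shows "dissipation R X Y + gauss (x - y) *
      (inner (x - y) (trunc R b X - trunc R b Y) + (norm (trunc R Sig X - trunc R Sig Y))\<^sup>2)
    \<le> 2 * \<epsilon> * (coef_size X + coef_size Y) + (coef_tail R X + coef_tail R Y)"
proof (cases "coef_size X \<le> R \<and> coef_size Y \<le> R")
  case True
  then show ?thesis
    using dissipation_le_if_close[OF q \<epsilon>, of R] coef_tail_nonneg[of R X] coef_tail_nonneg[of R Y]
    by (simp add: trunc_def)
next
  case False
  let ?v = "trunc R b X - trunc R b Y" and ?S = "trunc R Sig X - trunc R Sig Y"
  have "gauss (x - y) * (norm ?S)\<^sup>2 \<le> 1 * (norm ?S)\<^sup>2" by (intro mult_right_mono gauss_le_1) simp
  then have "gauss (x - y) * (inner (x - y) ?v + (norm ?S)\<^sup>2) \<le> coef_tail R X + coef_tail R Y"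
    using gauss_mult_inner_le[of "x - y" ?v] trunc_diff_le_coef_tail[of R X Y] False
    by (simp add: distrib_left not_le)
  moreover have "\<epsilon> \<ge> 0" using \<epsilon>(2) norm_ge_zero order_trans by blast
  then have "0 \<le> 2 * \<epsilon> * (coef_size X + coef_size Y)" by (simp add: coef_size_nonneg)
  moreover have "dissipation R X Y = 0" using False by (auto simp: dissipation_def)
  ultimately show ?thesis by linarith
qed

lemma coupled_step_gain:
  assumes q: "qfun Sig b X Y \<le> 0" and h: "h \<ge> 0" and R: "R \<ge> 0"
    and \<epsilon>: "\<epsilon> \<le> 1" "norm (x - X) \<le> \<epsilon>" "norm (y - Y) \<le> \<epsilon>"
  shows "gauss (x - y) + h * dissipation R X Y \<le>
    em_average (\<lambda>l. gauss (x - y + (trunc_step R h l X - trunc_step R h l Y)))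
      + (2 * h\<^sup>2 * R\<^sup>2 + h * (2 * \<epsilon>) * (coef_size X + coef_size Y) + h * (coef_tail R X + coef_tail R Y))"
proof -
  let ?v = "trunc R b X - trunc R b Y" and ?S = "trunc R Sig X - trunc R Sig Y"
  have "norm ?v \<le> 2 * R"
    using norm_triangle_ineq4[of "trunc R b X" "trunc R b Y"]
      norm_trunc_b_le[OF R, of X] norm_trunc_b_le[OF R, of Y]
    by linarith
  then have "(norm ?v)\<^sup>2 \<le> (2 * R)\<^sup>2" by (intro power_mono) simp_all
  then have "h\<^sup>2 * (norm ?v)\<^sup>2 / 2 \<le> 2 * h\<^sup>2 * R\<^sup>2"
    using mult_left_mono[of _ _ "h\<^sup>2"] by (fastforce simp: power_mult_distrib)
  moreover have "gauss (x - y) - h * (gauss (x - y) * (inner (x - y) ?v + (norm ?S)\<^sup>2)) - h\<^sup>2 * (norm ?v)\<^sup>2 / 2 \<le>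
      em_average (\<lambda>l. gauss (x - y + (trunc_step R h l X - trunc_step R h l Y)))"
    unfolding trunc_step_def em_step_diff by (rule em_average_gauss_ge[OF h])
  moreover have "h * dissipation R X Y + h * (gauss (x - y) * (inner (x - y) ?v + (norm ?S)\<^sup>2))
      \<le> h * (2 * \<epsilon>) * (coef_size X + coef_size Y) + h * (coef_tail R X + coef_tail R Y)"
    using mult_left_mono[OF dissipation_add_gauss_le[OF q \<epsilon>, of R] h] by (simp add: algebra_simps)
  ultimately show ?thesis by linarith
qed

lemma dissipation_nonneg: "qfun Sig b x y \<le> 0 \<Longrightarrow> dissipation R x y \<ge> 0"
  by (simp add: dissipation_def mult_nonneg_nonpos)

lemma qfun_measurable [measurable]: "(\<lambda>z. qfun Sig b (fst z) (snd z)) \<in> borel_measurable (borel \<Otimes>\<^sub>M borel)"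
  unfolding qfun_eq by measurable

end

context diffusion_solution
begin

lemma noisy_step_trunc_step:
  assumes f: "f \<in> C0_inf" "\<And>x. f x \<ge> 0" "(\<integral>\<^sup>+x. ennreal (f x) \<partial>lborel) = 1" and C: "\<And>x. f x \<le> C"
  shows "noisy_step M em_noise (\<lambda>x. ennreal (f x)) (\<lambda>l. trunc_step R h l) C"
proof
  note [measurable] = C0_inf_borel_measurable[OF f(1)]
  show "(\<lambda>x. ennreal (f x)) \<in> borel_measurable borel" by measurable
  show "ennreal (f x) \<le> ennreal C" for x by (rule ennreal_leI[OF C])
qed (simp_all add: sets_M f(3) trunc_step_measurable2)

end

locale dissipative_pair = M: diffusion_solution Sig b M + N: diffusion_solution Sig b N
  for Sig :: "real^'n::finite \<Rightarrow> real^'m::finite^'n" and b M N +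
  assumes qfun_neg: "\<And>x y. x \<noteq> y \<Longrightarrow> qfun Sig b x y < 0"
begin

lemma qfun_nonpos: "qfun Sig b x y \<le> 0"
  using qfun_neg[of x y] by (cases "x = y") (auto simp: qfun_eq)

definition mean_size :: real where
  "mean_size = (\<integral>x. M.coef_size x \<partial>M) + (\<integral>x. M.coef_size x \<partial>N)"

definition mean_tail :: "real \<Rightarrow> real" where
  "mean_tail R = (\<integral>x. M.coef_tail R x \<partial>M) + (\<integral>x. M.coef_tail R x \<partial>N)"

lemma mean_size_nonneg: "mean_size \<ge> 0"
  by (simp add: mean_size_def M.coef_size_nonneg)

lemma mean_tail_nonneg: "mean_tail R \<ge> 0"
  by (simp add: mean_tail_def M.coef_tail_nonneg)

definition step_defect :: "(real^'n \<Rightarrow> real) \<Rightarrow> real \<Rightarrow> real \<Rightarrow> ennreal" where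
  "step_defect f R h = M.mass_excess f R h + N.mass_excess f R h"

end

locale coupled_step = dissipative_pair Sig b M N
  for Sig :: "real^'n::finite \<Rightarrow> real^'m::finite^'n" and b M N +
  fixes f :: "real^'n \<Rightarrow> real" and \<epsilon> R h D :: real
  assumes smooth_noise: "f \<in> C0_inf" "\<And>x. f x \<ge> 0" "(\<integral>\<^sup>+x. ennreal (f x) \<partial>lborel) = 1"
    and noise_le: "\<And>x. f x \<le> D" and small_noise: "\<And>x. norm x > \<epsilon> \<Longrightarrow> f x = 0" "\<epsilon> \<le> 1"
    and nonneg: "R \<ge> 0" "h \<ge> 0" "\<epsilon> \<ge> 0"
begin

sublocale step: noisy_step_pair M N em_noise "\<lambda>x. ennreal (f x)" "\<lambda>l. M.trunc_step R h l" D
  unfolding noisy_step_pair_def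
  using M.noisy_step_trunc_step[OF smooth_noise noise_le] N.noisy_step_trunc_step[OF smooth_noise noise_le]
  by simp

definition step_error :: "real^'n \<Rightarrow> real^'n \<Rightarrow> real" where
  "step_error X Y = 2 * h\<^sup>2 * R\<^sup>2 + h * (2 * \<epsilon>) * (M.coef_size X + M.coef_size Y)
    + h * (M.coef_tail R X + M.coef_tail R Y)"

definition mean_step_error :: real where
  "mean_step_error = 2 * h * R\<^sup>2 + 2 * \<epsilon> * mean_size + mean_tail R"

lemma step_error_nonneg: "step_error X Y \<ge> 0"
  using nonneg by (simp add: step_error_def M.coef_size_nonneg M.coef_tail_nonneg)

lemma mean_step_error_nonneg: "mean_step_error \<ge> 0"
  using nonneg by (simp add: mean_step_error_def mean_size_nonneg mean_tail_nonneg)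

context
  fixes \<Lambda> assumes \<Lambda>: "coupling step.A.joint step.B.joint \<Lambda>"
begin

lemma marginals:
  "(\<lambda>z. fst (fst z)) \<in> measurable \<Lambda> M" "distr \<Lambda> M (\<lambda>z. fst (fst z)) = M"
  "(\<lambda>z. fst (snd z)) \<in> measurable \<Lambda> N" "distr \<Lambda> N (\<lambda>z. fst (snd z)) = N"
  using couplingD[OF \<Lambda>] step.A.distr_joint_fst step.B.distr_joint_fst
    distr_distr[of fst step.A.joint M fst \<Lambda>] distr_distr[of fst step.B.joint N snd \<Lambda>]
  by (simp_all add: comp_def)

lemma integral_step_error:
  "integrable \<Lambda> (\<lambda>z. step_error (fst (fst z)) (fst (snd z)))"
  "(\<integral>z. step_error (fst (fst z)) (fst (snd z)) \<partial>\<Lambda>) = h * mean_step_error"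
proof -
  interpret \<Lambda>: prob_space \<Lambda> by (rule coupling_imp_prob_space[OF \<Lambda> step.A.joint.prob_space_axioms])
  note M_marginal = integrable_marginal[OF marginals(1,2)] and N_marginal = integrable_marginal[OF marginals(3,4)]
  show "integrable \<Lambda> (\<lambda>z. step_error (fst (fst z)) (fst (snd z)))"
    "(\<integral>z. step_error (fst (fst z)) (fst (snd z)) \<partial>\<Lambda>) = h * mean_step_error"
    using M_marginal[OF M.integrable_coef_size] N_marginal[OF N.integrable_coef_size]
      M_marginal[OF M.integrable_coef_tail] N_marginal[OF N.integrable_coef_tail]
    by (simp_all add: step_error_def mean_step_error_def mean_size_def mean_tail_def \<Lambda>.prob_space
        power2_eq_square algebra_simps)
qed

lemma AE_coupled_step_gain:
  "AE z in \<Lambda>. gauss (step.A.start (fst z) - step.B.start (snd z)) + h * M.dissipation R (fst (fst z)) (fst (snd z))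
    \<le> em_average (\<lambda>l. gauss (fst (step.moved_pair (z, l)) - snd (step.moved_pair (z, l))))
      + step_error (fst (fst z)) (fst (snd z))"
proof -
  have "AE z in \<Lambda>. norm (snd (fst z)) \<le> \<epsilon>" "AE z in \<Lambda>. norm (snd (snd z)) \<le> \<epsilon>"
    by (rule AE_marginal[OF couplingD(1,3)[OF \<Lambda>]], rule step.A.AE_joint_noise, simp add: small_noise)
      (rule AE_marginal[OF couplingD(2,4)[OF \<Lambda>]], rule step.B.AE_joint_noise, simp add: small_noise)
  then show ?thesis
  proof eventually_elim
    case (elim z)
    let ?X = "fst (fst z)" and ?Y = "fst (snd z)"
    have "fst (step.moved_pair (z, l)) - snd (step.moved_pair (z, l)) =
        step.A.start (fst z) - step.B.start (snd z) + (M.trunc_step R h l ?X - M.trunc_step R h l ?Y)" for l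
      by (simp add: step.moved_pair_def step.A.moved_def step.B.moved_def step.A.start_def step.B.start_def)
    then show ?case
      using elim M.coupled_step_gain[OF qfun_nonpos nonneg(2,1) small_noise(2),
          of "step.A.start (fst z)" ?X "step.B.start (snd z)" ?Y]
      by (simp add: step.A.start_def step.B.start_def step_error_def)
  qed
qed

lemma nn_integral_coupled_step_gain:
  "(\<integral>\<^sup>+z. ennreal (gauss (step.A.start (fst z) - step.B.start (snd z))) \<partial>\<Lambda>)
      + ennreal h * (\<integral>\<^sup>+z. ennreal (M.dissipation R (fst (fst z)) (fst (snd z))) \<partial>\<Lambda>)
    \<le> (\<integral>\<^sup>+z. \<integral>\<^sup>+l. ennreal (gauss (fst (step.moved_pair (z, l)) - snd (step.moved_pair (z, l)))) \<partial>em_noise \<partial>\<Lambda>)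
      + ennreal (h * mean_step_error)"
proof -
  note [measurable_cong] = couplingD(5)[OF \<Lambda>]
  let ?avg = "\<lambda>z. em_average (\<lambda>l. gauss (fst (step.moved_pair (z, l)) - snd (step.moved_pair (z, l))))"
  have [measurable]: "(\<lambda>z. M.dissipation R (fst (fst z)) (fst (snd z))) \<in> borel_measurable \<Lambda>"
    using measurable_compose[OF _ M.dissipation_measurable, of "\<lambda>z. (fst (fst z), fst (snd z))" \<Lambda>] by simp
  have [measurable]: "?avg \<in> borel_measurable \<Lambda>"
    by (simp add: step.moved_pair_def step.A.moved_def step.B.moved_def)
  have "(\<integral>\<^sup>+z. ennreal (gauss (step.A.start (fst z) - step.B.start (snd z))) \<partial>\<Lambda>)
      + ennreal h * (\<integral>\<^sup>+z. ennreal (M.dissipation R (fst (fst z)) (fst (snd z))) \<partial>\<Lambda>)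
      = (\<integral>\<^sup>+z. ennreal (gauss (step.A.start (fst z) - step.B.start (snd z))
          + h * M.dissipation R (fst (fst z)) (fst (snd z))) \<partial>\<Lambda>)"
    using nonneg by (simp add: ennreal_plus ennreal_mult gauss_pos less_imp_le M.dissipation_nonneg qfun_nonpos
        nn_integral_add nn_integral_cmult)
  also have "\<dots> \<le> (\<integral>\<^sup>+z. ennreal (?avg z + step_error (fst (fst z)) (fst (snd z))) \<partial>\<Lambda>)"
    using AE_coupled_step_gain by (intro nn_integral_mono_AE) (auto intro: ennreal_leI)
  also have "\<dots> = (\<integral>\<^sup>+z. ennreal (?avg z) \<partial>\<Lambda>) + ennreal (h * mean_step_error)"
    using integral_step_error
    by (simp add: ennreal_plus em_average_nonneg gauss_pos less_imp_le step_error_nonneg nn_integral_add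
        nn_integral_eq_integral)
  finally show ?thesis
    by (simp add: nn_integral_em_noise less_imp_le[OF gauss_pos])
qed

end

lemma exists_coupling_dissipation_le:
  assumes h: "h > 0"
  shows "\<exists>P. coupling M N P \<and> ennreal h * M.mean_dissipation R P \<le>
    ennreal (h * (h + mean_step_error)) + step_defect f R h"
proof -
  let ?k = "\<lambda>z. ennreal (gauss (fst z - snd z))"
  obtain \<Lambda> where \<Lambda>: "coupling step.A.joint step.B.joint \<Lambda>"
    and stationary: "(\<integral>\<^sup>+z. \<integral>\<^sup>+l. ?k (step.moved_pair (z, l)) \<partial>em_noise \<partial>\<Lambda>) \<le>
      (\<integral>\<^sup>+z. ?k (step.A.start (fst z), step.B.start (snd z)) \<partial>\<Lambda>) + (ennreal (h\<^sup>2) + step_defect f R h)"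
    using step.exists_almost_stationary_coupling[of ?k "h\<^sup>2"] h
    by (auto simp: gauss_le_1 ennreal_le_1 add.assoc step.A.moved_density_def step.B.moved_density_def
        step.A.start_density_def step.B.start_density_def step_defect_def M.mass_excess_def N.mass_excess_def)
  interpret \<Lambda>: prob_space \<Lambda> by (rule coupling_imp_prob_space[OF \<Lambda> step.A.joint.prob_space_axioms])
  let ?G = "\<integral>\<^sup>+z. ?k (step.A.start (fst z), step.B.start (snd z)) \<partial>\<Lambda>"
  let ?D = "\<integral>\<^sup>+z. ennreal (M.dissipation R (fst (fst z)) (fst (snd z))) \<partial>\<Lambda>"
  have "?G \<le> (\<integral>\<^sup>+z. 1 \<partial>\<Lambda>)" by (intro nn_integral_mono) (simp add: gauss_le_1 ennreal_le_1)
  then have "?G < \<top>" by (simp add: \<Lambda>.emeasure_space_1 order.strict_trans1)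
  moreover have "?G + ennreal h * ?D \<le> ?G + (ennreal (h\<^sup>2) + step_defect f R h + ennreal (h * mean_step_error))"
    using nn_integral_coupled_step_gain[OF \<Lambda>] add_right_mono[OF stationary, of "ennreal (h * mean_step_error)"]
    by (simp add: add.assoc order_trans)
  ultimately have "ennreal h * ?D \<le> ennreal (h\<^sup>2) + step_defect f R h + ennreal (h * mean_step_error)"
    by (auto simp: ennreal_add_left_cancel_le)
  also have "\<dots> = ennreal (h * (h + mean_step_error)) + step_defect f R h"
    using h mean_step_error_nonneg by (simp add: power2_eq_square distrib_left ennreal_plus ac_simps)
  finally have "ennreal h * ?D \<le> ennreal (h * (h + mean_step_error)) + step_defect f R h" .
  moreover have "coupling M N (distr \<Lambda> (M \<Otimes>\<^sub>M N) (map_prod fst fst))"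
    using coupling_distr[OF \<Lambda>, of fst M fst N] step.A.distr_joint_fst step.B.distr_joint_fst
    by (simp add: step.A.sets_joint)
  moreover have "M.mean_dissipation R (distr \<Lambda> (M \<Otimes>\<^sub>M N) (map_prod fst fst)) = ?D"
    using marginals(1,3)[OF \<Lambda>] unfolding M.mean_dissipation_def
    by (subst nn_integral_distr) (simp_all add: map_prod_def split_beta)
  ultimately show ?thesis by auto
qed

end

context dissipative_pair
begin

lemma step_defect_le:
  assumes f: "f \<in> C0_inf" "\<And>x. f x \<ge> 0"
  shows "\<exists>C\<ge>0. \<forall>R\<ge>1. \<exists>K\<ge>0. \<forall>h. 0 \<le> h \<longrightarrow> h \<le> 1 \<longrightarrow> step_defect f R h \<le> ennreal (h * C * mean_tail R + K * (h * sqrt h))"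
proof -
  obtain CM where CM: "CM \<ge> 0" "\<And>R. R \<ge> 1 \<Longrightarrow> \<exists>K\<ge>0. \<forall>h. 0 \<le> h \<longrightarrow> h \<le> 1 \<longrightarrow>
      M.mass_excess f R h \<le> ennreal (h * CM * (\<integral>x. M.coef_tail R x \<partial>M) + K * (h * sqrt h))"
    using M.mass_excess_le_tail[OF f] by blast
  obtain CN where CN: "CN \<ge> 0" "\<And>R. R \<ge> 1 \<Longrightarrow> \<exists>K\<ge>0. \<forall>h. 0 \<le> h \<longrightarrow> h \<le> 1 \<longrightarrow>
      N.mass_excess f R h \<le> ennreal (h * CN * (\<integral>x. M.coef_tail R x \<partial>N) + K * (h * sqrt h))"
    using N.mass_excess_le_tail[OF f] by blast
  have "\<exists>K\<ge>0. \<forall>h. 0 \<le> h \<longrightarrow> h \<le> 1 \<longrightarrow> step_defect f R h \<le> ennreal (h * (CM + CN) * mean_tail R + K * (h * sqrt h))"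
    if R: "R \<ge> 1" for R
  proof -
    let ?tM = "\<integral>x. M.coef_tail R x \<partial>M" and ?tN = "\<integral>x. M.coef_tail R x \<partial>N"
    have tails: "?tM \<ge> 0" "?tN \<ge> 0" by (simp_all add: M.coef_tail_nonneg)
    obtain KM where KM: "KM \<ge> 0" "\<And>h. 0 \<le> h \<Longrightarrow> h \<le> 1 \<Longrightarrow>
        M.mass_excess f R h \<le> ennreal (h * CM * ?tM + KM * (h * sqrt h))"
      using CM(2)[OF R] by blast
    obtain KN where KN: "KN \<ge> 0" "\<And>h. 0 \<le> h \<Longrightarrow> h \<le> 1 \<Longrightarrow>
        N.mass_excess f R h \<le> ennreal (h * CN * ?tN + KN * (h * sqrt h))"
      using CN(2)[OF R] by blast
    have "step_defect f R h \<le> ennreal (h * (CM + CN) * mean_tail R + (KM + KN) * (h * sqrt h))"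
      if h: "0 \<le> h" "h \<le> 1" for h
    proof -
      have "step_defect f R h \<le>
          ennreal (h * CM * ?tM + KM * (h * sqrt h)) + ennreal (h * CN * ?tN + KN * (h * sqrt h))"
        unfolding step_defect_def using h by (intro add_mono KM KN)
      also have "\<dots> = ennreal ((h * CM * ?tM + KM * (h * sqrt h)) + (h * CN * ?tN + KN * (h * sqrt h)))"
        using h(1) CM(1) CN(1) KM(1) KN(1) tails by (intro ennreal_plus[symmetric]) simp_all
      also have "\<dots> \<le> ennreal (h * (CM + CN) * mean_tail R + (KM + KN) * (h * sqrt h))"
        using mult_nonneg_nonneg[OF h(1) mult_nonneg_nonneg[OF CM(1) tails(2)]]
          mult_nonneg_nonneg[OF h(1) mult_nonneg_nonneg[OF CN(1) tails(1)]]
        by (intro ennreal_leI) (simp add: mean_tail_def algebra_simps)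
      finally show ?thesis .
    qed
    then show ?thesis using KM(1) KN(1) by (intro exI[of _ "KM + KN"]) simp
  qed
  then show ?thesis using CM(1) CN(1) by (intro exI[of _ "CM + CN"]) simp
qed

end

lemma exists_pos_mult_le:
  assumes "a \<ge> 0" "\<delta> > (0 :: real)"
  obtains s where "0 < s" "s \<le> 1" "a * s \<le> \<delta>"
proof
  let ?s = "min 1 (\<delta> / (a + 1))"
  show "0 < ?s" "?s \<le> 1" using assms by simp_all
  have "a * ?s \<le> (a + 1) * (\<delta> / (a + 1))" using assms by (intro mult_mono) simp_all
  then show "a * ?s \<le> \<delta>" using assms by simp
qed

lemma (in coupled_step) exists_coupling_dissipation_le_if_defect_le:
  assumes h: "0 < h" "h \<le> 1" and "C \<ge> 0" "K \<ge> 0"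
    and defect: "step_defect f R h \<le> ennreal (h * C * mean_tail R + K * (h * sqrt h))"
  shows "\<exists>P. coupling M N P \<and> M.mean_dissipation R P
    \<le> ennreal (2 * \<epsilon> * mean_size + (1 + C) * mean_tail R + (1 + 2 * R\<^sup>2 + K) * sqrt h)"
proof -
  obtain P where P: "coupling M N P"
    and D: "ennreal h * M.mean_dissipation R P \<le> ennreal (h * (h + mean_step_error)) + step_defect f R h"
    using exists_coupling_dissipation_le[OF h(1)] by blast
  note D
  also have "\<dots> \<le> ennreal (h * (h + mean_step_error)) + ennreal (h * C * mean_tail R + K * (h * sqrt h))"
    by (rule add_left_mono[OF defect])
  also have "\<dots> = ennreal (h * (h + mean_step_error) + (h * C * mean_tail R + K * (h * sqrt h)))"
    using assms mean_step_error_nonneg mean_tail_nonneg by (intro ennreal_plus[symmetric]) simp_all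
  also have "h * (h + mean_step_error) + (h * C * mean_tail R + K * (h * sqrt h)) =
      h * (h + mean_step_error + C * mean_tail R + K * sqrt h)"
    by (simp add: algebra_simps)
  also have "ennreal (h * (h + mean_step_error + C * mean_tail R + K * sqrt h)) =
      ennreal h * ennreal (h + mean_step_error + C * mean_tail R + K * sqrt h)"
    using assms mean_step_error_nonneg mean_tail_nonneg by (intro ennreal_mult) simp_all
  finally have "M.mean_dissipation R P \<le> ennreal (h + mean_step_error + C * mean_tail R + K * sqrt h)"
    using h(1) by (simp add: ennreal_mult_le_mult_iff)
  moreover have "h + mean_step_error + C * mean_tail R + K * sqrt h
      \<le> 2 * \<epsilon> * mean_size + (1 + C) * mean_tail R + (1 + 2 * R\<^sup>2 + K) * sqrt h"
  proof -
    have "h * (1 + 2 * R\<^sup>2) \<le> sqrt h * (1 + 2 * R\<^sup>2)" using h by (intro mult_right_mono le_sqrt) simp_all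
    then show ?thesis by (simp add: mean_step_error_def algebra_simps)
  qed
  ultimately show ?thesis using P order_trans[OF _ ennreal_leI] by blast
qed

context dissipative_pair
begin

lemma exists_coupling_dissipation_le_tail:
  fixes f :: "real^'n \<Rightarrow> real"
  assumes f: "f \<in> C0_inf" "\<And>x. f x \<ge> 0" "(\<integral>\<^sup>+x. ennreal (f x) \<partial>lborel) = 1"
    and \<epsilon>: "\<And>x. norm x > \<epsilon> \<Longrightarrow> f x = 0" "0 \<le> \<epsilon>" "\<epsilon> \<le> 1"
  shows "\<exists>C\<ge>0. \<forall>R\<ge>1. \<exists>K\<ge>0. \<forall>h>0. h \<le> 1 \<longrightarrow> (\<exists>P. coupling M N P \<and>
    M.mean_dissipation R P \<le> ennreal (2 * \<epsilon> * mean_size + C * mean_tail R + K * sqrt h))"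
proof -
  obtain D where D: "\<And>x. \<bar>f x\<bar> \<le> D" using C0_inf_bounded[OF f(1)] by blast
  obtain C where C: "C \<ge> 0" and defect: "\<And>R. R \<ge> 1 \<Longrightarrow> \<exists>K\<ge>0. \<forall>h. 0 \<le> h \<longrightarrow> h \<le> 1 \<longrightarrow>
      step_defect f R h \<le> ennreal (h * C * mean_tail R + K * (h * sqrt h))"
    using step_defect_le[OF f(1,2)] by blast
  have "\<exists>K\<ge>0. \<forall>h>0. h \<le> 1 \<longrightarrow> (\<exists>P. coupling M N P \<and> M.mean_dissipation R P
      \<le> ennreal (2 * \<epsilon> * mean_size + (1 + C) * mean_tail R + K * sqrt h))" if R: "R \<ge> 1" for R
  proof -
    obtain K where K: "K \<ge> 0" "\<And>h. 0 \<le> h \<Longrightarrow> h \<le> 1 \<Longrightarrow>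
        step_defect f R h \<le> ennreal (h * C * mean_tail R + K * (h * sqrt h))"
      using defect[OF R] by blast
    have "\<exists>P. coupling M N P \<and> M.mean_dissipation R P
        \<le> ennreal (2 * \<epsilon> * mean_size + (1 + C) * mean_tail R + (1 + 2 * R\<^sup>2 + K) * sqrt h)"
      if h: "0 < h" "h \<le> 1" for h
    proof -
      interpret coupled_step Sig b M N f \<epsilon> R h D
        using f \<epsilon> R h D by unfold_locales (auto simp: abs_le_iff)
      show ?thesis using exists_coupling_dissipation_le_if_defect_le[OF h C K(1)] K(2) h by simp
    qed
    then show ?thesis using K(1) by (intro exI[of _ "1 + 2 * R\<^sup>2 + K"]) simp
  qed
  then show ?thesis using C by (intro exI[of _ "1 + C"]) simp
qed

lemma dissipation_mono: "R \<le> R' \<Longrightarrow> M.dissipation R x y \<le> M.dissipation R' x y"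
  using M.dissipation_nonneg[OF qfun_nonpos, of R' x y] by (auto simp: M.dissipation_def)

lemma tendsto_mean_tail: "(\<lambda>n. mean_tail (real n)) \<longlonglongrightarrow> 0"
  using tendsto_add[OF M.tendsto_integral_coef_tail N.tendsto_integral_coef_tail] by (simp add: mean_tail_def)

lemma exists_coupling_small_dissipation:
  assumes \<delta>: "\<delta> > 0"
  shows "\<exists>P. coupling M N P \<and> M.mean_dissipation R P \<le> ennreal \<delta>"
proof -
  obtain \<epsilon> where \<epsilon>: "0 < \<epsilon>" "\<epsilon> \<le> 1" "2 * mean_size * \<epsilon> \<le> \<delta> / 3"
    using exists_pos_mult_le[of "2 * mean_size" "\<delta> / 3"] \<delta> mean_size_nonneg by auto
  obtain f :: "real^'n \<Rightarrow> real" where f: "f \<in> C0_inf" "\<And>x. f x \<ge> 0" "\<And>x. norm x \<ge> \<epsilon> \<Longrightarrow> f x = 0"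
    "(\<integral>\<^sup>+x. ennreal (f x) \<partial>lborel) = 1"
    using exists_mollifier[OF \<epsilon>(1)] by auto
  obtain C where "C \<ge> 0" and bound: "\<And>R. R \<ge> 1 \<Longrightarrow> \<exists>K\<ge>0. \<forall>h>0. h \<le> 1 \<longrightarrow> (\<exists>P. coupling M N P \<and>
      M.mean_dissipation R P \<le> ennreal (2 * \<epsilon> * mean_size + C * mean_tail R + K * sqrt h))"
    using exists_coupling_dissipation_le_tail[OF f(1,2,4), of \<epsilon>] f(3) \<epsilon> by auto
  have "eventually (\<lambda>n. C * mean_tail (real n) < \<delta> / 3) sequentially"
    using \<delta> by (intro order_tendstoD(2)[OF tendsto_mult_right_zero[OF tendsto_mean_tail]]) simp
  moreover have "eventually (\<lambda>n. real n \<ge> max 1 R) sequentially" by real_asymp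
  ultimately obtain n where n: "real n \<ge> max 1 R" "C * mean_tail (real n) < \<delta> / 3"
    using eventually_happens[OF eventually_conj] by fastforce
  then obtain K where "K \<ge> 0" and small_step: "\<And>h. 0 < h \<Longrightarrow> h \<le> 1 \<Longrightarrow> \<exists>P. coupling M N P \<and>
      M.mean_dissipation (real n) P
        \<le> ennreal (2 * \<epsilon> * mean_size + C * mean_tail (real n) + K * sqrt h)"
    using bound[of "real n"] by auto
  obtain s where s: "0 < s" "s \<le> 1" "K * s \<le> \<delta> / 3"
    using exists_pos_mult_le[OF \<open>K \<ge> 0\<close>, of "\<delta> / 3"] \<delta> by auto
  have "2 * \<epsilon> * mean_size + C * mean_tail (real n) + K * sqrt (s\<^sup>2) \<le> \<delta>"
    using n(2) \<epsilon>(3) s by (simp add: mult_ac)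
  moreover obtain P where P: "coupling M N P" "M.mean_dissipation (real n) P
      \<le> ennreal (2 * \<epsilon> * mean_size + C * mean_tail (real n) + K * sqrt (s\<^sup>2))"
    using small_step[of "s\<^sup>2"] s by (auto simp: power_le_one)
  moreover have "M.mean_dissipation R P \<le> M.mean_dissipation (real n) P"
    unfolding M.mean_dissipation_def using n(1) by (intro nn_integral_mono ennreal_leI dissipation_mono) simp
  ultimately have "M.mean_dissipation R P \<le> ennreal \<delta>"
    by (meson ennreal_leI order_trans)
  then show ?thesis using P(1) by blast
qed

lemma dissipative_uniqueness: "M = N"
proof (rule eq_if_couplings_of_vanishing_cost[OF M.sets_M M.prob_space_axioms N.sets_M N.prob_space_axioms])
  let ?F = "\<lambda>x. (b x, Sig x)"
  let ?\<psi> = "\<lambda>w. exp (- (norm (fst (fst w) - fst (snd w)) + 2)\<^sup>2 / 2) *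
    - (inner (fst (fst w) - fst (snd w)) (fst (snd (fst w)) - fst (snd (snd w)))
       + (norm (snd (snd (fst w)) - snd (snd (snd w))))\<^sup>2)"
  have cost: "?\<psi> ((x, ?F x), (y, ?F y)) = exp (- (norm (x - y) + 2)\<^sup>2 / 2) * - qfun Sig b x y" for x y
    by (simp add: qfun_eq)
  show "?F \<in> borel_measurable borel" by measurable
  show "continuous_on UNIV ?\<psi>" by (intro continuous_intros) simp
  show "?\<psi> ((fst (x, y), ?F (fst (x, y))), (snd (x, y), ?F (snd (x, y)))) > 0" if "x \<noteq> y" for x y
    unfolding fst_conv[of x y] snd_conv[of x y] cost using qfun_neg[OF that] by (simp add: mult_pos_neg)
  fix C :: "((real^'n) \<times> (real^'m^'n)) set" and \<delta> :: real
  assume "compact C" and \<delta>: "\<delta> > 0"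
  define R where "R = Sup ((\<lambda>w. norm (fst w) + (norm (snd w))\<^sup>2) ` C)"
  have R: "M.coef_size x \<le> R" if "?F x \<in> C" for x
  proof -
    have "compact ((\<lambda>w. norm (fst w) + (norm (snd w))\<^sup>2) ` C)"
      using \<open>compact C\<close> by (intro compact_continuous_image continuous_intros)
    then show ?thesis
      unfolding R_def M.coef_size_def using that
      by (intro cSup_upper bounded_imp_bdd_above compact_imp_bounded) force+
  qed
  obtain P where P: "coupling M N P" and small: "M.mean_dissipation R P \<le> ennreal \<delta>"
    using exists_coupling_small_dissipation[OF \<delta>] by blast
  let ?cost = "\<lambda>z. ?\<psi> ((fst z, ?F (fst z)), (snd z, ?F (snd z)))"
  have "(\<integral>\<^sup>+z. indicator (C \<times> C) (?F (fst z), ?F (snd z)) * ennreal (?cost z) \<partial>P) \<le> M.mean_dissipation R P"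
    unfolding cost M.mean_dissipation_def using R
    by (intro nn_integral_mono) (auto simp: M.dissipation_def indicator_def)
  also note small
  finally show "\<exists>P. coupling M N P \<and>
      (\<integral>\<^sup>+z. indicator (C \<times> C) (?F (fst z), ?F (snd z)) * ennreal (?cost z) \<partial>P) \<le> ennreal \<delta>"
    using P by blast
qed

end

section \<open>The expansive case\<close>

lemma integral_eq_0_if_dominated_limit:
  fixes g :: "'a \<Rightarrow> real"
  assumes G: "\<And>n. G n \<in> borel_measurable M" "\<And>n. (\<integral>x. G n x \<partial>M) = 0"
    and bound: "\<And>n x. \<bar>G n x\<bar> \<le> w x" "integrable M w" and lim: "\<And>x. (\<lambda>n. G n x) \<longlonglongrightarrow> g x"
  shows "(\<integral>x. g x \<partial>M) = 0"
proof -
  have "g \<in> borel_measurable M" by (rule borel_measurable_LIMSEQ_real[OF lim G(1)])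
  then have "(\<lambda>n. \<integral>x. G n x \<partial>M) \<longlonglongrightarrow> (\<integral>x. g x \<partial>M)"
    by (intro integral_dominated_convergence[where w=w] G bound AE_I2) (simp_all add: lim bound(1))
  then show ?thesis by (simp add: G(2) LIMSEQ_const_iff)
qed

context diffusion_solution
begin

lemma integrable_b: "integrable M b"
  by (rule Bochner_Integration.integrable_bound[OF integrable_coef_size])
    (use norm_b_le_coef_size in \<open>auto simp: coef_size_nonneg\<close>)

lemma integral_gen_affine:
  assumes "f \<in> C0_inf" "s \<noteq> 0"
  shows "(\<integral>x. c * s\<^sup>2 * gen (Sig x) 0 f (a + s *\<^sub>R x) + c * s * ddir (b x) f (a + s *\<^sub>R x) \<partial>M) = 0"
  using integral_diff_op[OF C0_inf_affine[OF assms, of c a]] C0_inf_affine[OF assms, of c a]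
  by (simp add: diff_op_eq_gen C0_inf_smooth gen_affine assms)

lemma gen_measurable:
  assumes "f \<in> C0_inf"
  shows "(\<lambda>x. gen (Sig x) 0 f (a + s *\<^sub>R x)) \<in> borel_measurable borel"
    "(\<lambda>x. ddir (b x) f (a + s *\<^sub>R x)) \<in> borel_measurable borel"
proof -
  have [measurable]: "pdiff i f \<in> borel_measurable borel" "pdiff i (pdiff j f) \<in> borel_measurable borel" for i j
    using C0_inf_borel_measurable[OF C0_inf_iter_pdiff[OF assms], of "[_]"]
      C0_inf_borel_measurable[OF C0_inf_iter_pdiff[OF assms], of "[_, _]"] by simp_all
  have [measurable]: "(\<lambda>x. column j (Sig x) $ i) \<in> borel_measurable borel" for i j
    by (rule measurable_compose[OF column_measurable[OF Sig_measurable]])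
      (intro borel_measurable_continuous_onI continuous_intros)
  have [measurable]: "(\<lambda>x. b x $ i) \<in> borel_measurable borel" for i
    by (rule measurable_compose[OF b_measurable]) (intro borel_measurable_continuous_onI continuous_intros)
  show "(\<lambda>x. gen (Sig x) 0 f (a + s *\<^sub>R x)) \<in> borel_measurable borel"
    "(\<lambda>x. ddir (b x) f (a + s *\<^sub>R x)) \<in> borel_measurable borel"
    unfolding gen_def ddir_ddir[OF C0_inf_smooth[OF assms]] unfolding ddir_def zero_index
    by measurable
qed

lemma integral_bump_slope_times_inner_b: "(\<integral>x. bump_slope a * inner (b x) a \<partial>M) = 0"
proof -
  obtain C where C: "C \<ge> 0" "\<And>S v y. \<bar>gen (S :: real^'m^'n) v bump y\<bar> \<le> C * (norm v + (norm S)\<^sup>2)"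
    using abs_gen_bounded[OF bump_C0_inf, where 'm='m] by blast
  define s where "s n = 1 / real (Suc n)" for n
  have s: "0 < s n" "s n \<le> 1" "s \<longlonglongrightarrow> 0" for n unfolding s_def by (simp, simp, real_asymp)
  let ?G = "\<lambda>n x. s n * gen (Sig x) 0 bump (a + s n *\<^sub>R x) + ddir (b x) bump (a + s n *\<^sub>R x)"
  show ?thesis
  proof (rule integral_eq_0_if_dominated_limit[where G="?G" and w="\<lambda>x. C * coef_size x"])
    fix n
    note [measurable] = gen_measurable[OF bump_C0_inf]
    show "?G n \<in> borel_measurable M" by measurable
    show "(\<integral>x. ?G n x \<partial>M) = 0"
      using integral_gen_affine[OF bump_C0_inf, of "s n" "1 / s n" a] s(1)[of n] by (simp add: power2_eq_square)
    show "\<bar>?G n x\<bar> \<le> C * coef_size x" for x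
    proof -
      have "\<bar>s n * gen (Sig x) 0 bump (a + s n *\<^sub>R x)\<bar> \<le> 1 * (C * (norm (Sig x))\<^sup>2)"
        unfolding abs_mult using s(1,2)[of n] C(2)[of "Sig x" 0] by (intro mult_mono) auto
      moreover have "\<bar>ddir (b x) bump (a + s n *\<^sub>R x)\<bar> \<le> C * norm (b x)"
        using C(2)[of 0 "b x"] by (simp add: gen_0_left)
      ultimately show ?thesis
        by (simp add: coef_size_def distrib_left)
    qed
  next
    fix x :: "real^'n"
    have "(\<lambda>n. a + s n *\<^sub>R x) \<longlonglongrightarrow> a + 0 *\<^sub>R x" by (intro tendsto_intros s)
    then have arg: "(\<lambda>n. a + s n *\<^sub>R x) \<longlonglongrightarrow> a" by simp
    have "(\<lambda>n. ?G n x) \<longlonglongrightarrow> 0 * gen (Sig x) 0 bump a + ddir (b x) bump a"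
      by (intro tendsto_intros s arg tendsto_gen tendsto_smooth smooth_ddir C0_inf_smooth[OF bump_C0_inf])
    then show "(\<lambda>n. ?G n x) \<longlonglongrightarrow> bump_slope a * inner (b x) a" by (simp add: ddir_bump)
  qed (use integrable_coef_size in simp_all)
qed

lemma integral_b_eq_0: "(\<integral>x. b x \<partial>M) = 0"
proof (rule ccontr)
  let ?B = "\<integral>x. b x \<partial>M"
  assume B: "?B \<noteq> 0"
  define a where "a = (1 / (2 * norm ?B)) *\<^sub>R ?B"
  have "bump_slope a * inner ?B a = 0"
    using integral_bump_slope_times_inner_b[of a] integrable_b by simp
  moreover have "norm a < 1" using B by (simp add: a_def)
  ultimately show False using bump_slope_neq_0[of a] B by (simp add: a_def)
qed

definition energy :: "real^'n \<Rightarrow> real" where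
  "energy x = inner x (b x) + (norm (Sig x))\<^sup>2"

lemma energy_measurable [measurable]: "energy \<in> borel_measurable borel"
  unfolding energy_def[abs_def] by measurable

lemma integrable_norm_b_times_norm: "integrable M (\<lambda>x. norm (b x) * norm x)"
  by (rule Bochner_Integration.integrable_bound[OF integrable_moment]) auto

lemma integrable_norm_Sig_power2: "integrable M (\<lambda>x. (norm (Sig x))\<^sup>2)"
  by (rule Bochner_Integration.integrable_bound[OF integrable_moment]) auto

lemma integrable_inner_b: "integrable M (\<lambda>x. inner x (b x))"
  by (rule Bochner_Integration.integrable_bound[OF integrable_norm_b_times_norm])
    (use Cauchy_Schwarz_ineq2 in \<open>auto simp: mult.commute\<close>)

lemma integrable_energy: "integrable M energy"
  unfolding energy_def[abs_def]
  by (intro Bochner_Integration.integrable_add integrable_inner_b integrable_norm_Sig_power2)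

lemma integral_energy_eq_0: "(\<integral>x. energy x \<partial>M) = 0"
proof -
  let ?slope = "bump_slope :: real^'n \<Rightarrow> real"
  obtain C where C: "C \<ge> 0" "\<And>S v y. \<bar>gen (S :: real^'m^'n) v bump y\<bar> \<le> C * (norm v + (norm S)\<^sup>2)"
    using abs_gen_bounded[OF bump_C0_inf, where 'm='m] by blast
  obtain D where D: "\<And>x. \<bar>?slope x\<bar> \<le> D" using C0_inf_bounded[OF bump_slope_C0_inf] by blast
  define s where "s n = 1 / real (Suc n)" for n
  have s: "0 < s n" "s \<longlonglongrightarrow> 0" for n unfolding s_def by (simp, real_asymp)
  let ?G = "\<lambda>n x. gen (Sig x) 0 bump (s n *\<^sub>R x) + ?slope (s n *\<^sub>R x) * inner (b x) x"
  have "(\<integral>x. ?slope 0 * energy x \<partial>M) = 0"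
  proof (rule integral_eq_0_if_dominated_limit[where G="?G"
        and w="\<lambda>x. (C + D) * ((norm (Sig x))\<^sup>2 + norm (b x) * norm x)"])
    fix n
    note [measurable] = gen_measurable(1)[OF bump_C0_inf, of 0 "s n", simplified]
      C0_inf_borel_measurable[OF bump_slope_C0_inf]
    show "?G n \<in> borel_measurable M" by measurable
    show "(\<integral>x. ?G n x \<partial>M) = 0"
      using integral_gen_affine[OF bump_C0_inf, of "s n" "1 / (s n)\<^sup>2" 0] s(1)[of n]
      by (simp add: power2_eq_square ddir_bump)
    show "\<bar>?G n x\<bar> \<le> (C + D) * ((norm (Sig x))\<^sup>2 + norm (b x) * norm x)" for x
    proof -
      have "\<bar>?slope (s n *\<^sub>R x) * inner (b x) x\<bar> \<le> D * (norm (b x) * norm x)"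
        unfolding abs_mult using D Cauchy_Schwarz_ineq2[of "b x" x]
        by (intro mult_mono) (auto intro: order_trans[OF abs_ge_zero])
      moreover have "\<bar>gen (Sig x) 0 bump (s n *\<^sub>R x)\<bar> \<le> C * (norm (Sig x))\<^sup>2"
        using C(2)[of "Sig x" 0] by simp
      moreover have "0 \<le> C * (norm (b x) * norm x)" "0 \<le> D * (norm (Sig x))\<^sup>2"
        using C(1) order_trans[OF abs_ge_zero D] by simp_all
      ultimately show ?thesis unfolding distrib_left distrib_right by linarith
    qed
  next
    fix x :: "real^'n"
    have "(\<lambda>n. s n *\<^sub>R x) \<longlonglongrightarrow> 0 *\<^sub>R x" by (intro tendsto_intros s)
    then have arg: "(\<lambda>n. s n *\<^sub>R x) \<longlonglongrightarrow> 0" by simp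
    have "(\<lambda>n. ?G n x) \<longlonglongrightarrow> gen (Sig x) 0 bump 0 + ?slope 0 * inner (b x) x"
      by (intro tendsto_intros arg tendsto_gen tendsto_smooth C0_inf_smooth bump_C0_inf bump_slope_C0_inf)
    then show "(\<lambda>n. ?G n x) \<longlonglongrightarrow> ?slope 0 * energy x"
      by (simp add: gen_bump_0 energy_def inner_commute algebra_simps)
  qed (use integrable_moment in simp_all)
  then show ?thesis using bump_slope_neq_0[of "0 :: real^'n"] by simp
qed

end

lemma (in prob_space) eq_return_if_AE_eq:
  assumes "AE y in M. y = x"
  shows "M = return M x"
proof (rule measure_eqI)
  fix A assume A: "A \<in> sets M"
  show "emeasure M A = emeasure (return M x) A"
  proof (cases "x \<in> A")
    case True
    then have "AE y in M. y \<in> A" using assms by auto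
    then show ?thesis using A True by (simp add: emeasure_eq_measure prob_eq_1)
  next
    case False
    then have "AE y in M. y \<notin> A" using assms by auto
    then show ?thesis using A False by (simp add: emeasure_eq_measure prob_eq_0)
  qed
qed simp

lemma (in pair_sigma_finite) integral_inner_product:
  fixes f :: "'a \<Rightarrow> 'c::euclidean_space" and g :: "'b \<Rightarrow> 'c"
  assumes f: "integrable M1 f" and g: "integrable M2 g"
  shows "integrable (M1 \<Otimes>\<^sub>M M2) (\<lambda>z. inner (f (fst z)) (g (snd z)))"
    "(\<integral>z. inner (f (fst z)) (g (snd z)) \<partial>(M1 \<Otimes>\<^sub>M M2)) = inner (\<integral>x. f x \<partial>M1) (\<integral>y. g y \<partial>M2)"
proof -
  have [measurable]: "f \<in> borel_measurable M1" "g \<in> borel_measurable M2" using f g by auto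
  have "integrable (M1 \<Otimes>\<^sub>M M2) (\<lambda>z. norm (f (fst z)) * norm (g (snd z)))"
    using f g by (intro Fubini_integrable) simp_all
  then show integrable_inner: "integrable (M1 \<Otimes>\<^sub>M M2) (\<lambda>z. inner (f (fst z)) (g (snd z)))"
    by (rule Bochner_Integration.integrable_bound) (simp_all add: Cauchy_Schwarz_ineq2)
  show "(\<integral>z. inner (f (fst z)) (g (snd z)) \<partial>(M1 \<Otimes>\<^sub>M M2)) = inner (\<integral>x. f x \<partial>M1) (\<integral>y. g y \<partial>M2)"
    using integral_fst'[OF integrable_inner] f g by simp
qed

lemma (in pair_sigma_finite) integral_times_product:
  fixes f :: "'a \<Rightarrow> real" and g :: "'b \<Rightarrow> real"
  assumes "integrable M1 f" "integrable M2 g"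
  shows "integrable (M1 \<Otimes>\<^sub>M M2) (\<lambda>z. f (fst z) * g (snd z))"
    "(\<integral>z. f (fst z) * g (snd z) \<partial>(M1 \<Otimes>\<^sub>M M2)) = (\<integral>x. f x \<partial>M1) * (\<integral>y. g y \<partial>M2)"
  using integral_inner_product[OF assms] by simp_all

lemma (in sigma_finite_measure) integral_weighted_covariance:
  fixes f g :: "'a \<Rightarrow> 'c::euclidean_space" and w :: "'a \<Rightarrow> real"
  assumes w: "integrable M w" and f: "integrable M (\<lambda>x. w x *\<^sub>R f x)" and g: "integrable M (\<lambda>x. w x *\<^sub>R g x)"
    and fg: "integrable M (\<lambda>x. w x * inner (f x) (g x))"
  shows "integrable (M \<Otimes>\<^sub>M M) (\<lambda>z. w (fst z) * w (snd z) * inner (f (fst z) - f (snd z)) (g (fst z) - g (snd z)))"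
    "(\<integral>z. w (fst z) * w (snd z) * inner (f (fst z) - f (snd z)) (g (fst z) - g (snd z)) \<partial>(M \<Otimes>\<^sub>M M)) =
      2 * ((\<integral>x. w x \<partial>M) * (\<integral>x. w x * inner (f x) (g x) \<partial>M) - inner (\<integral>x. w x *\<^sub>R f x \<partial>M) (\<integral>x. w x *\<^sub>R g x \<partial>M))"
proof -
  interpret pair_sigma_finite M M ..
  have expand: "w (fst z) * w (snd z) * inner (f (fst z) - f (snd z)) (g (fst z) - g (snd z)) =
      (w (fst z) * inner (f (fst z)) (g (fst z))) * w (snd z)
      + w (fst z) * (w (snd z) * inner (f (snd z)) (g (snd z)))
      - inner (w (fst z) *\<^sub>R f (fst z)) (w (snd z) *\<^sub>R g (snd z))
      - inner (w (fst z) *\<^sub>R g (fst z)) (w (snd z) *\<^sub>R f (snd z))" for z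
    by (simp add: inner_diff_left inner_diff_right inner_commute algebra_simps)
  note terms = integral_times_product[OF fg w] integral_times_product[OF w fg]
    integral_inner_product[OF f g] integral_inner_product[OF g f]
  show "integrable (M \<Otimes>\<^sub>M M) (\<lambda>z. w (fst z) * w (snd z) * inner (f (fst z) - f (snd z)) (g (fst z) - g (snd z)))"
    unfolding expand by (intro Bochner_Integration.integrable_diff Bochner_Integration.integrable_add terms)
  show "(\<integral>z. w (fst z) * w (snd z) * inner (f (fst z) - f (snd z)) (g (fst z) - g (snd z)) \<partial>(M \<Otimes>\<^sub>M M)) =
      2 * ((\<integral>x. w x \<partial>M) * (\<integral>x. w x * inner (f x) (g x) \<partial>M) - inner (\<integral>x. w x *\<^sub>R f x \<partial>M) (\<integral>x. w x *\<^sub>R g x \<partial>M))"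
    unfolding expand using terms
    by (simp add: Bochner_Integration.integrable_diff Bochner_Integration.integrable_add inner_commute)
qed


context diffusion_solution
begin

abbreviation ball_weight :: "nat \<Rightarrow> real^'n \<Rightarrow> real" where
  "ball_weight n \<equiv> indicator (cball 0 (real n))"

lemma tendsto_integral_cball:
  fixes u :: "real^'n \<Rightarrow> 'c::{banach, second_countable_topology}"
  assumes u: "integrable M u"
  shows "(\<lambda>n. \<integral>x. ball_weight n x *\<^sub>R u x \<partial>M) \<longlonglongrightarrow> (\<integral>x. u x \<partial>M)"
proof -
  have "(\<Union>n. cball (0 :: real^'n) (real n)) = UNIV"
    using real_arch_simple by auto
  then show ?thesis
    using set_integral_cont_up[of "\<lambda>n. cball 0 (real n)" M u] u
    by (simp add: set_lebesgue_integral_def set_integrable_def incseq_def subset_cball sets_M)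
qed

lemma integrable_ball_weight_scaleR:
  fixes u :: "real^'n \<Rightarrow> 'c::{banach, second_countable_topology}"
  shows "integrable M u \<Longrightarrow> integrable M (\<lambda>x. ball_weight n x *\<^sub>R u x)"
  by (rule integrable_scaleR_left integrable_mult_indicator) (simp_all add: sets_M)

lemma norm_integral_ball_weight_id_le: "norm (\<integral>x. ball_weight n x *\<^sub>R x \<partial>M) \<le> real n"
proof -
  have "norm (\<integral>x. ball_weight n x *\<^sub>R x \<partial>M) \<le> (\<integral>x. norm (ball_weight n x *\<^sub>R x) \<partial>M)"
    by (rule integral_norm_bound)
  also have "\<dots> \<le> real n"
    by (intro integral_le_const integrable_const_bound[where B="real n"]) (auto simp: indicator_def)
  finally show ?thesis .
qed

abbreviation drift_tail :: "nat \<Rightarrow> real" where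
  "drift_tail n \<equiv> (\<integral>x. norm (b x) * norm x \<partial>M) - (\<integral>x. ball_weight n x * (norm (b x) * norm x) \<partial>M)"

lemma norm_integral_ball_weight_b_le:
  "real n * norm (\<integral>x. ball_weight n x *\<^sub>R b x \<partial>M) \<le> drift_tail n"
proof -
  note integrable_terms = integrable_b integrable_ball_weight_scaleR[OF integrable_b, of n]
    integrable_norm_b_times_norm integrable_ball_weight_scaleR[OF integrable_norm_b_times_norm, of n, simplified]
  have "(\<integral>x. ball_weight n x *\<^sub>R b x \<partial>M) = - (\<integral>x. b x - ball_weight n x *\<^sub>R b x \<partial>M)"
    using integrable_terms by (simp add: integral_b_eq_0)
  then have "real n * norm (\<integral>x. ball_weight n x *\<^sub>R b x \<partial>M) \<le>
      real n * (\<integral>x. norm (b x - ball_weight n x *\<^sub>R b x) \<partial>M)"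
    by (simp add: mult_left_mono)
  also have "\<dots> = (\<integral>x. real n * norm (b x - ball_weight n x *\<^sub>R b x) \<partial>M)" by simp
  also have "\<dots> \<le> (\<integral>x. norm (b x) * norm x - ball_weight n x * (norm (b x) * norm x) \<partial>M)"
    using integrable_terms
    by (intro integral_mono) (auto simp: indicator_def mult.commute[of "norm (b _)"] intro!: mult_right_mono)
  also have "\<dots> = drift_tail n" using integrable_terms by simp
  finally show ?thesis .
qed

lemma integral_qfun_cball:
  "integrable (M \<Otimes>\<^sub>M M) (\<lambda>z. ball_weight n (fst z) * ball_weight n (snd z) * qfun Sig b (fst z) (snd z))"
  "(\<integral>z. ball_weight n (fst z) * ball_weight n (snd z) * qfun Sig b (fst z) (snd z) \<partial>(M \<Otimes>\<^sub>M M)) =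
    2 * (measure M (cball 0 (real n)) * (\<integral>x. ball_weight n x * energy x \<partial>M)
      - inner (\<integral>x. ball_weight n x *\<^sub>R x \<partial>M) (\<integral>x. ball_weight n x *\<^sub>R b x \<partial>M)
      - (norm (\<integral>x. ball_weight n x *\<^sub>R Sig x \<partial>M))\<^sup>2)"
proof -
  let ?w = "ball_weight n"
  have w: "integrable M ?w"  "(\<integral>x. ?w x \<partial>M) = measure M (cball 0 (real n))"
    using integrable_real_indicator[of "cball 0 (real n)" M] by (simp_all add: sets_M emeasure_eq_measure)
  have x: "integrable M (\<lambda>x. ?w x *\<^sub>R x)"
    by (rule integrable_const_bound[where B="real n"]) (auto simp: indicator_def)
  have b: "integrable M (\<lambda>x. ?w x *\<^sub>R b x)" by (rule integrable_ball_weight_scaleR[OF integrable_b])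
  have Sig: "integrable M (\<lambda>x. ?w x *\<^sub>R Sig x)"
  proof (rule Bochner_Integration.integrable_bound)
    show "integrable M (\<lambda>x. 1 + (norm (Sig x))\<^sup>2)" using integrable_norm_Sig_power2 by simp
    have "norm A \<le> 1 + (norm A)\<^sup>2" for A :: "real^'m^'n"
      using sum_squares_bound[of 1 "norm A"] norm_ge_zero[of A] by (simp del: norm_ge_zero)
    then show "AE x in M. norm (?w x *\<^sub>R Sig x) \<le> norm (1 + (norm (Sig x))\<^sup>2)"
      by (auto simp: indicator_def)
  qed measurable
  have inner_b: "integrable M (\<lambda>x. ?w x * inner x (b x))"
    using integrable_ball_weight_scaleR[OF integrable_inner_b] by simp
  have inner_Sig: "integrable M (\<lambda>x. ?w x * inner (Sig x) (Sig x))"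
    using integrable_ball_weight_scaleR[OF integrable_norm_Sig_power2] by (simp add: power2_norm_eq_inner)
  note drift = integral_weighted_covariance[OF w(1) x b inner_b]
    and noise = integral_weighted_covariance[OF w(1) Sig Sig inner_Sig]
  have q: "?w (fst z) * ?w (snd z) * qfun Sig b (fst z) (snd z) =
      ?w (fst z) * ?w (snd z) * inner (fst z - snd z) (b (fst z) - b (snd z)) +
      ?w (fst z) * ?w (snd z) * inner (Sig (fst z) - Sig (snd z)) (Sig (fst z) - Sig (snd z))" for z
    by (simp add: qfun_eq power2_norm_eq_inner distrib_left)
  show "integrable (M \<Otimes>\<^sub>M M) (\<lambda>z. ?w (fst z) * ?w (snd z) * qfun Sig b (fst z) (snd z))"
    unfolding q by (intro Bochner_Integration.integrable_add drift noise)
  have "(\<integral>x. ?w x * energy x \<partial>M) = (\<integral>x. ?w x * inner x (b x) \<partial>M) + (\<integral>x. ?w x * inner (Sig x) (Sig x) \<partial>M)"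
    using inner_b inner_Sig by (simp add: energy_def power2_norm_eq_inner distrib_left)
  then show "(\<integral>z. ?w (fst z) * ?w (snd z) * qfun Sig b (fst z) (snd z) \<partial>(M \<Otimes>\<^sub>M M)) =
    2 * (measure M (cball 0 (real n)) * (\<integral>x. ?w x * energy x \<partial>M)
      - inner (\<integral>x. ?w x *\<^sub>R x \<partial>M) (\<integral>x. ?w x *\<^sub>R b x \<partial>M) - (norm (\<integral>x. ?w x *\<^sub>R Sig x \<partial>M))\<^sup>2)"
    unfolding q Bochner_Integration.integral_add[OF drift(1) noise(1)] drift(2) noise(2) w(2)
    by (simp add: power2_norm_eq_inner distrib_left)
qed

lemma integral_qfun_cball_le:
  "(\<integral>z. ball_weight n (fst z) * ball_weight n (snd z) * qfun Sig b (fst z) (snd z) \<partial>(M \<Otimes>\<^sub>M M))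
    \<le> 2 * \<bar>\<integral>x. ball_weight n x * energy x \<partial>M\<bar> + 2 * drift_tail n"
proof -
  let ?\<xi> = "\<integral>x. ball_weight n x *\<^sub>R x \<partial>M" and ?\<beta> = "\<integral>x. ball_weight n x *\<^sub>R b x \<partial>M"
    and ?U = "\<integral>x. ball_weight n x * energy x \<partial>M"
  have "measure M (cball 0 (real n)) * ?U \<le> 1 * \<bar>?U\<bar>"
    by (rule order_trans[OF mult_left_mono[OF abs_ge_self] mult_right_mono]) simp_all
  moreover have "- inner ?\<xi> ?\<beta> \<le> drift_tail n"
  proof -
    have "- inner ?\<xi> ?\<beta> \<le> norm ?\<xi> * norm ?\<beta>"
      using Cauchy_Schwarz_ineq2[of ?\<xi> ?\<beta>] by linarith
    also have "\<dots> \<le> real n * norm ?\<beta>"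
      by (intro mult_right_mono norm_integral_ball_weight_id_le) simp
    also have "\<dots> \<le> drift_tail n" by (rule norm_integral_ball_weight_b_le)
    finally show ?thesis .
  qed
  ultimately have "measure M (cball 0 (real n)) * ?U + - inner ?\<xi> ?\<beta> + - (norm (\<integral>x. ball_weight n x *\<^sub>R Sig x \<partial>M))\<^sup>2
      \<le> 1 * \<bar>?U\<bar> + drift_tail n + 0"
    by (intro add_mono) simp_all
  then show ?thesis unfolding integral_qfun_cball(2) by simp
qed

lemma tendsto_integral_qfun_cball_bound:
  "(\<lambda>n. 2 * \<bar>\<integral>x. ball_weight n x * energy x \<partial>M\<bar> + 2 * drift_tail n) \<longlonglongrightarrow> 0"
proof -
  have "(\<lambda>n. \<integral>x. ball_weight n x * energy x \<partial>M) \<longlonglongrightarrow> 0"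
    using tendsto_integral_cball[OF integrable_energy] by (simp add: integral_energy_eq_0)
  moreover have "drift_tail \<longlonglongrightarrow> (\<integral>x. norm (b x) * norm x \<partial>M) - (\<integral>x. norm (b x) * norm x \<partial>M)"
    by (intro tendsto_diff tendsto_const
        tendsto_integral_cball[OF integrable_norm_b_times_norm, unfolded real_scaleR_def])
  then have "drift_tail \<longlonglongrightarrow> 0" by simp
  ultimately have "(\<lambda>n. 2 * \<bar>\<integral>x. ball_weight n x * energy x \<partial>M\<bar> + 2 * drift_tail n) \<longlonglongrightarrow> 2 * \<bar>0\<bar> + 2 * 0"
    by (intro tendsto_add tendsto_mult_left tendsto_rabs)
  then show ?thesis by simp
qed

lemma AE_qfun_eq_0:
  assumes nonneg: "\<And>x y. qfun Sig b x y \<ge> 0"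
  shows "AE z in M \<Otimes>\<^sub>M M. qfun Sig b (fst z) (snd z) = 0"
proof -
  let ?w = "\<lambda>n z. ball_weight n (fst z) * ball_weight n (snd z)"
  let ?q = "\<lambda>z. qfun Sig b (fst z) (snd z)"
  let ?bound = "\<lambda>n. 2 * \<bar>\<integral>x. ball_weight n x * energy x \<partial>M\<bar> + 2 * drift_tail n"
  have "(\<integral>\<^sup>+z. ennreal (?q z) \<partial>(M \<Otimes>\<^sub>M M)) = (\<integral>\<^sup>+z. liminf (\<lambda>n. ennreal (?w n z * ?q z)) \<partial>(M \<Otimes>\<^sub>M M))"
  proof (rule nn_integral_cong)
    fix z :: "(real^'n) \<times> (real^'n)"
    have "eventually (\<lambda>n. real n \<ge> max (norm (fst z)) (norm (snd z))) sequentially"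
      using filterlim_real_sequentially unfolding filterlim_at_top by blast
    then have "eventually (\<lambda>n. ennreal (?w n z * ?q z) = ennreal (?q z)) sequentially"
      by eventually_elim simp
    then show "ennreal (?q z) = liminf (\<lambda>n. ennreal (?w n z * ?q z))"
      using lim_imp_Liminf[OF _ tendsto_eventually] by force
  qed
  also have "\<dots> \<le> liminf (\<lambda>n. \<integral>\<^sup>+z. ennreal (?w n z * ?q z) \<partial>(M \<Otimes>\<^sub>M M))"
    by (rule nn_integral_liminf) measurable
  also have "\<dots> \<le> liminf (\<lambda>n. ennreal (?bound n))"
    using integral_qfun_cball_le integral_qfun_cball(1) nonneg
    by (intro Liminf_mono always_eventually allI) (simp add: nn_integral_eq_integral ennreal_leI)
  also have "\<dots> = 0"
    using lim_imp_Liminf[OF _ tendsto_ennrealI[OF tendsto_integral_qfun_cball_bound]] by simp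
  finally have "(\<integral>\<^sup>+z. ennreal (?q z) \<partial>(M \<Otimes>\<^sub>M M)) = 0" by simp
  then have "AE z in M \<Otimes>\<^sub>M M. ennreal (?q z) = 0" by (subst (asm) nn_integral_0_iff_AE) measurable
  then show ?thesis by eventually_elim (use nonneg in \<open>simp add: antisym\<close>)
qed

lemma expansive_imp_Dirac:
  assumes pos: "\<And>x y. x \<noteq> y \<Longrightarrow> qfun Sig b x y > 0"
  shows "\<exists>x. M = return borel x \<and> b x = 0 \<and> Sig x = 0"
proof -
  interpret pair_sigma_finite M M ..
  have nonneg: "qfun Sig b x y \<ge> 0" for x y using pos[of x y] by (cases "x = y") (auto simp: qfun_eq)
  have "AE x in M. AE y in M. qfun Sig b x y = 0"
    using AE_pair[OF AE_qfun_eq_0[OF nonneg]] by simp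
  then obtain x where "AE y in M. qfun Sig b x y = 0"
    using eventually_happens'[OF ae_filter_bot] by auto
  then have "AE y in M. y = x"
  proof eventually_elim
    case (elim y)
    then show ?case using pos[of x y] by force
  qed
  then have M: "M = return borel x"
    using eq_return_if_AE_eq return_sets_cong[OF sets_M] by simp
  have "b x = 0" using integral_b_eq_0 by (simp add: M integral_return)
  moreover have "energy x = 0" using integral_energy_eq_0 by (simp add: M integral_return)
  ultimately show ?thesis using M by (auto simp: energy_def)
qed

end

theorem theorem1:
  fixes Sig :: "real^'n::finite \<Rightarrow> real^'m::finite^'n"
    and b :: "real^'n \<Rightarrow> real^'n"
  assumes "Sig \<in> borel_measurable borel"
    and "b \<in> borel_measurable borel"
    and "(\<forall>x y. x \<noteq> y \<longrightarrow> qfun Sig b x y > 0) \<or> (\<forall>x y. x \<noteq> y \<longrightarrow> qfun Sig b x y < 0)"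
  shows "\<forall>\<mu> \<nu>. prob_solution Sig b \<mu>
           \<and> (\<integral>\<^sup>+x. ennreal ((norm (Sig x))\<^sup>2 + norm (b x) * norm x) \<partial>\<mu>) < \<infinity>
           \<and> prob_solution Sig b \<nu>
           \<and> (\<integral>\<^sup>+x. ennreal ((norm (Sig x))\<^sup>2 + norm (b x) * norm x) \<partial>\<nu>) < \<infinity>
           \<longrightarrow> \<mu> = \<nu>"
proof (intro allI impI, elim conjE)
  fix \<mu> \<nu>
  assume "prob_solution Sig b \<mu>" "(\<integral>\<^sup>+x. ennreal ((norm (Sig x))\<^sup>2 + norm (b x) * norm x) \<partial>\<mu>) < \<infinity>"
  then interpret \<mu>: diffusion_solution Sig b \<mu> using assms(1,2) by unfold_locales
  assume "prob_solution Sig b \<nu>" "(\<integral>\<^sup>+x. ennreal ((norm (Sig x))\<^sup>2 + norm (b x) * norm x) \<partial>\<nu>) < \<infinity>"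
  then interpret \<nu>: diffusion_solution Sig b \<nu> using assms(1,2) by unfold_locales
  from assms(3) show "\<mu> = \<nu>"
  proof
    assume expansive: "\<forall>x y. x \<noteq> y \<longrightarrow> qfun Sig b x y > 0"
    obtain x where x: "\<mu> = return borel x" "b x = 0" "Sig x = 0" using \<mu>.expansive_imp_Dirac expansive by blast
    obtain y where y: "\<nu> = return borel y" "b y = 0" "Sig y = 0" using \<nu>.expansive_imp_Dirac expansive by blast
    have "qfun Sig b x y = 0" by (simp add: qfun_eq x y)
    then have "x = y" using expansive by force
    then show ?thesis by (simp add: x y)
  next
    assume "\<forall>x y. x \<noteq> y \<longrightarrow> qfun Sig b x y < 0"
    then interpret dissipative_pair Sig b \<mu> \<nu> by unfold_locales blast
    show ?thesis by (rule dissipative_uniqueness)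
  qed
qed

end
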